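(* Two coverings of the plane by nonoriented complete folding t-curves are locally isomorphic if and only if they are associated to the same sequence $\Lambda\in\{-1,+1\}^{\mathbb{N}^*}$.
   Context: $\mathbb{N}=\{0,1,2,\dots\}$, $\mathbb{N}^*=\mathbb{N}\setminus\{0\}$. Fix a regular tiling $\mathcal{P}$ of $\mathbb{R}^2$ by equilateral triangles. T-curves. A bounded t-curve (resp. half t-curve, complete t-curve) is a sequence $(A_k)_{0\le k\le n}$ (resp. $(A_k)_{k\in\mathbb{N}}$, $(A_k)_{k\in\mathbb{Z}}$) of oriented sides of triangles of $\mathcal{P}$ such that, for any consecutive $A_k,A_{k+1}$, the terminal point of $A_k$ is the initial point of $A_{k+1}$ and the two segments form an angle $\pm\pi/3$ at that point (so they are two distinct sides of one triangle). The associated sequence is $(a_k)_{1\le k\le n}$ (resp. $(a_k)_{k\in\mathbb{N}^*}$, $(a_k)_{k\in\mathbb{Z}}$), where $a_k=+1$ (resp. $-1$) if one turns left (resp. right) when passing from $A_{k-1}$ to $A_k$. A nonoriented t-curve is a t-curve considered up to reversal of orientation. Folding curves. Let $T$ be the empty sequence and, inductively, $T_{\lambda_1\cdots\lambda_{n+1}}=(T_{\lambda_1\cdots\lambda_n},\lambda_{n+1},T_{\lambda_1\cdots\lambda_n},-\lambda_{n+1},T_{\lambda_1\cdots\lambda_n})$ for $\lambda_1,\dots,\lambda_{n+1}\in\{-1,+1\}$. An $n$-folding t-curve is a bounded t-curve associated to some $T_{\lambda_1\cdots\lambda_n}$. A complete folding t-curve is a complete t-curve which is an inductive limit of $n$-folding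 t-curves, i.e. $C=\bigcup_n C_n$ with $C_n$ an $n$-folding t-curve which is a subcurve of $C_{n+1}$ for each $n\in\mathbb{N}$. For each complete folding t-curve $C$ there is a unique sequence $\Lambda=(\lambda_n)_{n\in\mathbb{N}^*}\in\{-1,+1\}^{\mathbb{N}^*}$, not depending on the orientation of $C$, such that each bounded subcurve of $C$ is contained in a t-curve associated to some $T_{\lambda_1\cdots\lambda_n}$; $C$ is said to be associated to $\Lambda$. Coverings. A set $\mathcal{C}$ of t-curves is a covering of the plane if each side of a triangle of $\mathcal{P}$ is the support of exactly one segment of exactly one curve of $\mathcal{C}$. All the curves of a covering by complete folding t-curves are associated to the same sequence $\Lambda$; the covering is then said to be associated to $\Lambda$. Local isomorphism. Curves are drawn with slightly rounded angles (in a uniform way), so that the curves of a covering do not pass through the vertices of the triangles and are pairwise disjoint. A covering by nonoriented curves is identified with the subset of $\mathbb{R}^2$ which is the union of its curves. $B(x,r)$ is the closed ball of center $x$ and radius $r$, and $(B(x,r)\cap E,x)\cong(B(y,r)\cap F,y)$ means that the translation taking $x$ to $y$ maps $B(x,r)\cap E$ onto $B(y,r)\cap F$. Two subsets $E,F\subset\mathbb{R}^2$ are locally isomorphic if, for each $x\in\mathbb{R}^2$ (resp. $y\in\mathbb{R}^2$) and each positive real $r$, there exists $y\in\mathbb{R}^2$ (resp. $x\in\mathbb{R}^2$) such that $(B(x,r)\cap E,x)\cong(B(y,r)\cap F,y)$. *)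

theory Defs
  imports "HOL-Analysis.Analysis" "HOL-Library.Sublist"
begin

text \<open>
  The plane is the type \<^typ>\<open>complex\<close>. A tiling is the set of its triangles, each triangle being
  given by the set of its three vertices. With \<open>w = cis (pi / 3) * u\<close>, the lattice points are
  \<open>c + a u + b w\<close>, and each lattice point \<open>x\<close> contributes the two triangles \<open>x, x + u, x + w\<close>
  and \<open>x, x + w, x + w - u\<close>.
\<close>

definition regular_triangular_tiling :: "complex set set \<Rightarrow> bool" where
  "regular_triangular_tiling P \<longleftrightarrow>
     (\<exists>c u w. u \<noteq> 0 \<and> w = cis (pi / 3) * u \<and>
        P = (\<Union>a::int. \<Union>b::int. let x = c + of_int a * u + of_int b * w
               in {{x, x + u, x + w}, {x, x + w, x + w - u}}))"

type_synonym oside = "complex \<times> complex"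

definition oriented_sides :: "complex set set \<Rightarrow> oside set" where
  "oriented_sides P = {(p, q). p \<noteq> q \<and> (\<exists>T\<in>P. p \<in> T \<and> q \<in> T)}"

definition support :: "oside \<Rightarrow> complex set" where
  "support A = closed_segment (fst A) (snd A)"

definition joins :: "oside \<Rightarrow> oside \<Rightarrow> bool" where
  "joins A B \<longleftrightarrow> snd A = fst B \<and>
     (snd B - fst B = cis (pi / 3) * (fst A - snd A) \<or>
      snd B - fst B = cis (- pi / 3) * (fst A - snd A))"

text \<open>The sign of the cross product of the two directions: \<open>1\<close> is a left turn.\<close>

definition turn :: "oside \<Rightarrow> oside \<Rightarrow> int" where
  "turn A B = (if Im (cnj (snd A - fst A) * (snd B - fst B)) > 0 then 1 else -1)"

definition bounded_tcurve :: "complex set set \<Rightarrow> oside list \<Rightarrow> bool" where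
  "bounded_tcurve P As \<longleftrightarrow> As \<noteq> [] \<and> set As \<subseteq> oriented_sides P \<and> successively joins As"

definition associated_sequence :: "oside list \<Rightarrow> int list" where
  "associated_sequence As = map2 turn As (tl As)"

definition complete_tcurve :: "complex set set \<Rightarrow> (int \<Rightarrow> oside) \<Rightarrow> bool" where
  "complete_tcurve P A \<longleftrightarrow> (\<forall>k. A k \<in> oriented_sides P) \<and> (\<forall>k. joins (A k) (A (k + 1)))"

text \<open>The bounded subcurve \<open>(A\<^sub>k)\<close>, \<open>i \<le> k \<le> i + m\<close>, of a complete curve.\<close>

definition subcurve :: "(int \<Rightarrow> oside) \<Rightarrow> int \<Rightarrow> nat \<Rightarrow> oside list" where
  "subcurve A i m = map (\<lambda>k. A (i + int k)) [0..<Suc m]"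

text \<open>Sequences are indexed from \<open>1\<close>; the value at \<open>0\<close> is never used.\<close>

definition sign_sequence :: "(nat \<Rightarrow> int) \<Rightarrow> bool" where
  "sign_sequence \<Lambda> \<longleftrightarrow> (\<forall>n\<ge>1. \<Lambda> n \<in> {-1, 1})"

primrec T_seq :: "(nat \<Rightarrow> int) \<Rightarrow> nat \<Rightarrow> int list" where
  "T_seq \<Lambda> 0 = []"
| "T_seq \<Lambda> (Suc n) =
     T_seq \<Lambda> n @ [\<Lambda> (Suc n)] @ T_seq \<Lambda> n @ [- \<Lambda> (Suc n)] @ T_seq \<Lambda> n"

definition folding_tcurve :: "complex set set \<Rightarrow> nat \<Rightarrow> oside list \<Rightarrow> bool" where
  "folding_tcurve P n As \<longleftrightarrow> bounded_tcurve P As \<and>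
     (\<exists>\<Lambda>. sign_sequence \<Lambda> \<and> associated_sequence As = T_seq \<Lambda> n)"

text \<open>The curve \<open>C\<^sub>n\<close> of the inductive limit is the part of \<open>A\<close> with indices from \<open>s n\<close> to
  \<open>s n + m n\<close>; the sign sequence witnessing that it is an \<open>n\<close>-folding curve may depend on \<open>n\<close>.\<close>

definition complete_folding_tcurve :: "complex set set \<Rightarrow> (int \<Rightarrow> oside) \<Rightarrow> bool" where
  "complete_folding_tcurve P A \<longleftrightarrow> complete_tcurve P A \<and>
     (\<exists>(s :: nat \<Rightarrow> int) (m :: nat \<Rightarrow> nat).
        (\<forall>n. folding_tcurve P n (subcurve A (s n) (m n))) \<and>
        (\<forall>n. {s n..s n + int (m n)} \<subseteq> {s (Suc n)..s (Suc n) + int (m (Suc n))}) \<and>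
        (\<Union>n. {s n..s n + int (m n)}) = UNIV)"

definition curve_associated :: "complex set set \<Rightarrow> (int \<Rightarrow> oside) \<Rightarrow> (nat \<Rightarrow> int) \<Rightarrow> bool" where
  "curve_associated P A \<Lambda> \<longleftrightarrow>
     (\<forall>i m. \<exists>n Bs. bounded_tcurve P Bs \<and> associated_sequence Bs = T_seq \<Lambda> n \<and>
        sublist (subcurve A i m) Bs)"

definition reverse_curve :: "(int \<Rightarrow> oside) \<Rightarrow> (int \<Rightarrow> oside)" where
  "reverse_curve A = (\<lambda>k. prod.swap (A (- k)))"

text \<open>A nonoriented curve is the set of its two orientations.\<close>

definition nonoriented :: "(int \<Rightarrow> oside) \<Rightarrow> (int \<Rightarrow> oside) set" where
  "nonoriented A = {A, reverse_curve A}"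

definition is_covering :: "complex set set \<Rightarrow> (int \<Rightarrow> oside) set set \<Rightarrow> bool" where
  "is_covering P \<C> \<longleftrightarrow>
     (\<forall>S \<in> support ` oriented_sides P.
        (\<exists>!K. K \<in> \<C> \<and> (\<exists>A\<in>K. \<exists>k. support (A k) = S)) \<and>
        (\<forall>K\<in>\<C>. \<forall>A\<in>K. \<forall>j k. support (A j) = S \<and> support (A k) = S \<longrightarrow> j = k))"

definition folding_covering :: "complex set set \<Rightarrow> (int \<Rightarrow> oside) set set \<Rightarrow> bool" where
  "folding_covering P \<C> \<longleftrightarrow>
     \<C> \<subseteq> nonoriented ` {A. complete_folding_tcurve P A} \<and> is_covering P \<C>"

definition covering_associated ::
  "complex set set \<Rightarrow> (int \<Rightarrow> oside) set set \<Rightarrow> (nat \<Rightarrow> int) \<Rightarrow> bool" where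
  "covering_associated P \<C> \<Lambda> \<longleftrightarrow> (\<forall>K\<in>\<C>. \<forall>A\<in>K. curve_associated P A \<Lambda>)"

text \<open>
  Drawing with rounded angles. The part of each side within the fraction \<open>\<epsilon>\<close> of its length from
  an endpoint is dropped. At a corner \<open>p, v, q\<close> the two resulting free ends \<open>p'\<close> and \<open>q'\<close> are
  joined by the arc, inside the triangle \<open>v p' q'\<close>, of the circle tangent to the two sides at
  \<open>p'\<close> and \<open>q'\<close>; as the angle at \<open>v\<close> is \<open>pi / 3\<close>, its centre is \<open>v + 2/3 ((p' - v) + (q' - v))\<close>.
\<close>

definition draw_side :: "real \<Rightarrow> oside \<Rightarrow> complex set" where
  "draw_side \<epsilon> A =
     closed_segment (fst A + \<epsilon> *\<^sub>R (snd A - fst A)) (snd A + \<epsilon> *\<^sub>R (fst A - snd A))"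

definition draw_corner :: "real \<Rightarrow> oside \<Rightarrow> oside \<Rightarrow> complex set" where
  "draw_corner \<epsilon> A B =
     (let v = snd A;
          p' = v + \<epsilon> *\<^sub>R (fst A - v);
          q' = v + \<epsilon> *\<^sub>R (snd B - v);
          z = v + (2 / 3) *\<^sub>R ((p' - v) + (q' - v))
      in sphere z (dist z p') \<inter> convex hull {v, p', q'})"

definition draw_curve :: "real \<Rightarrow> (int \<Rightarrow> oside) \<Rightarrow> complex set" where
  "draw_curve \<epsilon> A = (\<Union>k. draw_side \<epsilon> (A k) \<union> draw_corner \<epsilon> (A k) (A (k + 1)))"

definition draw_covering :: "real \<Rightarrow> (int \<Rightarrow> oside) set set \<Rightarrow> complex set" where
  "draw_covering \<epsilon> \<C> = (\<Union>K\<in>\<C>. \<Union>A\<in>K. draw_curve \<epsilon> A)"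

definition same_patch :: "real \<Rightarrow> complex \<Rightarrow> complex set \<Rightarrow> complex \<Rightarrow> complex set \<Rightarrow> bool" where
  "same_patch r x E y F \<longleftrightarrow> (\<lambda>z. z + (y - x)) ` (cball x r \<inter> E) = cball y r \<inter> F"

definition locally_isomorphic :: "complex set \<Rightarrow> complex set \<Rightarrow> bool" where
  "locally_isomorphic E F \<longleftrightarrow>
     (\<forall>r>0. (\<forall>x. \<exists>y. same_patch r x E y F) \<and> (\<forall>y. \<exists>x. same_patch r x E y F))"

end

theory Submission
  imports Defs
begin

text \<open>In a covering the three strands through a vertex all turn the same way, so a covering is a sign
  function on the triangular lattice, and its curves are the orbits of a permutation of the sides,
  oriented along the cube roots of unity \<open>1, \<omega>, \<omega>\<^sup>2\<close>. Along a folding curve the classes of the vertices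
  modulo \<open>1 - \<omega>\<close> repeat with period 3; on two of the classes the signs are \<open>\<lambda>\<close> and \<open>-\<lambda>\<close>, and on the
  third, the class \<open>r\<close>, one reads a folding curve again. All curves of a covering have the same type
  \<open>(r, \<lambda>)\<close>. Hence the restriction of the sign function to the class \<open>r\<close>, rescaled by \<open>2 + \<omega>\<close> or its
  conjugate, is a sign function of the same kind with the shifted sequence. By iteration, the
  sequence and the classes determine the signs except at the vertices of ever sparser
  sublattices, so that coverings with the same sequence agree on finite sets up to translation.
  Conversely the signs along a curve, and hence the sequence, can be read off from finite patches.\<close>

text \<open>The hard step is that the types agree. Strands of types \<open>(r, \<lambda>)\<close>
  and \<open>(r + 1, -\<lambda>)\<close> can share a vertex without a local contradiction: their
  demands coincide on class \<open>r + 2\<close>, and each other class is bound by only one of them.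
  The contradiction shows only in the derived words over a larger region, hence the reduction by
  symmetry to one configuration and the refutation tree for it.

  The levels may leave one vertex undetermined, the limit of the nested classes, where either sign
  is possible. Curves are therefore compared with folding sequences only through finite windows
  (\<open>FS\<close>), and patches through a translation chosen so that an undetermined vertex lands
  on one of the right sign.

  By definition a complete folding curve may use a different sequence for each \<open>n\<close>, and
  two curves of a covering are not known to share theirs. So windows are taken from a set
  \<open>\<S>\<close> of sequences: all sign sequences to find a sequence, a singleton to identify
  it.\<close>

section \<open>Folding sequences\<close>

text \<open>The positive indices below \<open>3 ^ n\<close> carry the sequence \<open>T_seq L n\<close>; the value at \<open>0\<close> is junk.\<close>

function tau :: "(nat \<Rightarrow> int) \<Rightarrow> int \<Rightarrow> int" where
  "tau L i = (if i = 0 then 1 else if i mod 3 = 0 then tau (\<lambda>n. L (Suc n)) (i div 3)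
     else if i mod 3 = 1 then L 1 else - L 1)"
  by auto
termination
  by (relation "Wellfounded.measure (\<lambda>(L, i). nat \<bar>i\<bar>)") auto

declare tau.simps [simp del]

definition tl_seq :: "(nat \<Rightarrow> int) \<Rightarrow> nat \<Rightarrow> int" where
  "tl_seq L = (\<lambda>n. L (Suc n))"

lemma tau_1: "i mod 3 = 1 \<Longrightarrow> tau L i = L 1"
  by (subst tau.simps) auto

lemma tau_2: "i mod 3 = 2 \<Longrightarrow> tau L i = - L 1"
  by (subst tau.simps) auto

lemma tau_3: "i \<noteq> 0 \<Longrightarrow> tau L (3 * i) = tau (tl_seq L) i"
  by (subst tau.simps) (auto simp: tl_seq_def)

lemma mod3_cases:
  fixes i :: int
  obtains (0) "i mod 3 = 0" | (1) "i mod 3 = 1" | (2) "i mod 3 = 2"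
proof -
  have "i mod 3 = 0 \<or> i mod 3 = 1 \<or> i mod 3 = 2" by presburger
  with that show thesis by blast
qed

lemma sign_tl: "sign_sequence L \<Longrightarrow> sign_sequence (tl_seq L)"
  by (auto simp: sign_sequence_def tl_seq_def)

lemma sign_1: "sign_sequence L \<Longrightarrow> L (Suc n) = 1 \<or> L (Suc n) = - 1"
  by (auto simp: sign_sequence_def)

lemma tau_neg: "i \<noteq> 0 \<Longrightarrow> tau L (- i) = - tau L i"
proof (induction L i rule: tau.induct)
  case (1 L i)
  show ?case
  proof (cases i rule: mod3_cases)
    case 0
    then obtain q where q: "i = 3 * q" by auto
    with 1 have "q \<noteq> 0" by auto
    with 1(1) 0 q have "tau (tl_seq L) (- q) = - tau (tl_seq L) q"
      by (simp add: tl_seq_def)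
    then show ?thesis
      using \<open>q \<noteq> 0\<close> tau_3[of q L] tau_3[of "- q" L] q by simp
  next
    case 1
    then have "(- i) mod 3 = 2" by presburger
    with 1 show ?thesis by (simp add: tau_1 tau_2)
  next
    case 2
    then have "(- i) mod 3 = 1" by presburger
    with 2 show ?thesis by (simp add: tau_1 tau_2)
  qed
qed

text \<open>Off the multiples of \<open>3 ^ n\<close> the value is decided within the first
  \<open>n\<close> levels, and level \<open>k\<close> repeats with period
  \<open>3 ^ k\<close>.\<close>

lemma tau_period: "\<not> 3 ^ n dvd i \<Longrightarrow> tau L (i + 3 ^ n * q) = tau L i"
proof (induction n arbitrary: L i)
  case (Suc n)
  show ?case
  proof (cases i rule: mod3_cases)
    case 0
    then obtain p where p: "i = 3 * p" by auto
    with Suc.prems have np: "\<not> 3 ^ n dvd p" by auto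
    have "\<not> 3 ^ n dvd p + 3 ^ n * q" using np by (simp add: dvd_add_left_iff)
    then have "p + 3 ^ n * q \<noteq> 0" "p \<noteq> 0" using np by (metis dvd_0_right)+
    then have "tau L (3 * (p + 3 ^ n * q)) = tau L (3 * p)"
      using Suc.IH[OF np, of "tl_seq L"] tau_3[of p L] tau_3[of "p + 3 ^ n * q" L] by metis
    then show ?thesis by (simp add: p algebra_simps)
  next
    case 1
    then have "(i + 3 ^ Suc n * q) mod 3 = 1" by (simp add: mult.assoc mod_add_eq)
    with 1 show ?thesis by (simp add: tau_1)
  next
    case 2
    then have "(i + 3 ^ Suc n * q) mod 3 = 2" by (simp add: mult.assoc)
    with 2 show ?thesis by (simp add: tau_2)
  qed
qed simp

text \<open>The multiples of \<open>3 ^ n\<close> that are not multiples of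
  \<open>3 ^ (n + 1)\<close> carry both signs; \<open>tau_window\<close> uses this to realise either
  sign at an undetermined index.\<close>

lemma tau_pow:
  "tau L (3 ^ n * (3 * q + 1)) = L (Suc n)" "tau L (3 ^ n * (3 * q + 2)) = - L (Suc n)"
proof (induction n arbitrary: L)
  case 0
  case 1 show ?case by (simp add: tau_1)
  case 2 show ?case by (simp add: tau_2)
next
  case (Suc n)
  have "3 * q + 1 \<noteq> 0" "3 * q + 2 \<noteq> 0" by presburger+
  then have *: "3 ^ n * (3 * q + 1) \<noteq> 0" "3 ^ n * (3 * q + 2) \<noteq> 0" by auto
  case 1 show ?case using Suc(1)[of "tl_seq L"] tau_3[OF *(1), of L]
    by (simp add: mult.assoc tl_seq_def)
  case 2 show ?case using Suc(2)[of "tl_seq L"] tau_3[OF *(2), of L]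
    by (simp add: mult.assoc tl_seq_def)
qed

lemma upt_thirds:
  fixes m :: nat
  assumes "0 < m"
  shows "[1..<3 * m] = [1..<m] @ [m] @ map (\<lambda>i. i + m) [1..<m] @ [2 * m] @ map (\<lambda>i. i + 2 * m) [1..<m]"
proof -
  have "[1..<3 * m] = [1..<m] @ [m..<2 * m] @ [2 * m..<3 * m]"
    using assms upt_add_eq_append[of 1 "2 * m" m] upt_add_eq_append[of 1 m m]
    by (simp add: mult_2 mult_2_right numeral_3_eq_3 add.assoc)
  moreover have "[m..<2 * m] = m # map (\<lambda>i. i + m) [1..<m]"
    using assms by (subst upt_conv_Cons) (auto intro!: nth_equalityI simp: mult_2 add.commute)
  moreover have "[2 * m..<3 * m] = 2 * m # map (\<lambda>i. i + 2 * m) [1..<m]"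
    using assms by (subst upt_conv_Cons) (auto intro!: nth_equalityI simp: add.commute)
  ultimately show ?thesis by simp
qed

text \<open>The three copies of \<open>T_seq L n\<close> in \<open>T_seq L (Suc n)\<close> reflect
  the periodicity of \<open>tau\<close> off the multiples of \<open>3 ^ n\<close>; the two
  separating entries are its values at \<open>3 ^ n\<close> and \<open>2 * 3 ^ n\<close>.\<close>

lemma T_seq_tau: "T_seq L n = map (\<lambda>i. tau L (int i)) [1..<3 ^ n]"
proof (induction n)
  case (Suc n)
  have nd: "\<not> 3 ^ n dvd int i" if "i \<in> set [1..<3 ^ n]" for i
  proof
    assume "3 ^ n dvd int i"
    then have "3 ^ n \<le> int i" using that by (intro zdvd_imp_le) auto
    moreover have "int i < int (3 ^ n)" using that by (simp del: of_nat_power)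
    ultimately show False by simp
  qed
  have p: "tau L (int i + 3 ^ n) = tau L (int i)" "tau L (int i + 2 * 3 ^ n) = tau L (int i)"
    if "i \<in> set [1..<3 ^ n]" for i
    using tau_period[OF nd[OF that], of L 1] tau_period[OF nd[OF that], of L 2]
    by (simp_all add: mult.commute)
  have "[1..<3 ^ Suc n] = [1..<3 ^ n] @ [3 ^ n] @ map (\<lambda>i. i + 3 ^ n) [1..<3 ^ n] @ [2 * 3 ^ n] @
      map (\<lambda>i. i + 2 * 3 ^ n) [1..<3 ^ n :: nat]"
    using upt_thirds[of "3 ^ n"] by simp
  then have "map (\<lambda>i. tau L (int i)) [1..<3 ^ Suc n] = T_seq L (Suc n)"
    using tau_pow[of L n 0] p by (simp add: Suc mult.commute del: upt_Suc)
  then show ?case by simp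
qed simp

section \<open>Sequences that locally agree with folding sequences\<close>

text \<open>The condition \<open>N < \<bar>j\<bar>\<close> keeps the window away from the junk value \<open>tau L 0\<close>.\<close>

definition FS :: "(nat \<Rightarrow> int) set \<Rightarrow> (int \<Rightarrow> int) \<Rightarrow> bool" where
  "FS \<S> a \<longleftrightarrow> (\<forall>N. \<exists>L\<in>\<S>. \<exists>j. N < \<bar>j\<bar> \<and> (\<forall>k. \<bar>k\<bar> \<le> N \<longrightarrow> a k = tau L (j + k)))"

lemma FS_mono: "FS \<S> a \<Longrightarrow> \<S> \<subseteq> \<S>' \<Longrightarrow> FS \<S>' a"
  unfolding FS_def by blast

lemma FS_shift:
  assumes "FS \<S> a"
  shows "FS \<S> (\<lambda>k. a (k + m))"
  unfolding FS_def
proof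
  fix N
  from assms obtain L j where *: "L \<in> \<S>" "N + \<bar>m\<bar> < \<bar>j\<bar>" "\<forall>k. \<bar>k\<bar> \<le> N + \<bar>m\<bar> \<longrightarrow> a k = tau L (j + k)"
    unfolding FS_def by blast
  then have "N < \<bar>j + m\<bar> \<and> (\<forall>k. \<bar>k\<bar> \<le> N \<longrightarrow> a (k + m) = tau L ((j + m) + k))"
    by (auto simp: algebra_simps)
  with * show "\<exists>L\<in>\<S>. \<exists>j. N < \<bar>j\<bar> \<and> (\<forall>k. \<bar>k\<bar> \<le> N \<longrightarrow> a (k + m) = tau L (j + k))" by blast
qed

text \<open>Reversing a curve reverses the order of its turns and negates them; as
  \<open>tau\<close> is odd, the window around \<open>j\<close> becomes the window around
  \<open>- j\<close>.\<close>

lemma FS_reverse: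
  assumes "FS \<S> a"
  shows "FS \<S> (\<lambda>k. - a (- k))"
  unfolding FS_def
proof
  fix N
  from assms obtain L j where *: "L \<in> \<S>" "N < \<bar>j\<bar>" "\<forall>k. \<bar>k\<bar> \<le> N \<longrightarrow> a k = tau L (j + k)"
    unfolding FS_def by blast
  have "- a (- k) = tau L (- j + k)" if "\<bar>k\<bar> \<le> N" for k
  proof -
    have "j - k \<noteq> 0" using that *(2) by auto
    then show ?thesis using *(3) that tau_neg[of "j - k" L] by auto
  qed
  with * show "\<exists>L\<in>\<S>. \<exists>j. N < \<bar>j\<bar> \<and> (\<forall>k. \<bar>k\<bar> \<le> N \<longrightarrow> - a (- k) = tau L (j + k))"
    by (intro bexI[of _ L] exI[of _ "- j"]) auto
qed

lemma tau_uminus: "i \<noteq> 0 \<Longrightarrow> tau (\<lambda>n. - L n) i = - tau L i"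
proof (induction L i rule: tau.induct)
  case (1 L i)
  then show ?case by (subst (1 2) tau.simps) auto
qed

text \<open>The set of all sign sequences is closed under negation; this is what lets reflections of
  the lattice act on typings.\<close>

lemma FS_uminus:
  assumes "FS {L. sign_sequence L} a"
  shows "FS {L. sign_sequence L} (\<lambda>k. - a k)"
  unfolding FS_def
proof
  fix N
  from assms obtain L j where *: "sign_sequence L" "N < \<bar>j\<bar>" "\<forall>k. \<bar>k\<bar> \<le> N \<longrightarrow> a k = tau L (j + k)"
    unfolding FS_def by blast
  have "- a k = tau (\<lambda>n. - L n) (j + k)" if "\<bar>k\<bar> \<le> N" for k
    using *(2,3) that by (subst tau_uminus) auto
  moreover have "sign_sequence (\<lambda>n. - L n)" using *(1) by (auto simp: sign_sequence_def)
  ultimately show "\<exists>L\<in>{L. sign_sequence L}. \<exists>j. N < \<bar>j\<bar> \<and> (\<forall>k. \<bar>k\<bar> \<le> N \<longrightarrow> - a k = tau L (j + k))"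
    using *(2) by (intro bexI[of _ "\<lambda>n. - L n"] exI[of _ j]) auto
qed

text \<open>For each window length the offset \<open>j\<close> determines a residue
  \<open>r\<close>, and the sequence a first entry \<open>l\<close>. There are only six such pairs,
  and a pair that works for a long window works for shorter ones, so one pair works for all
  lengths.\<close>

lemma FS_decomp:
  assumes "FS \<S> a" and sg: "\<And>L. L \<in> \<S> \<Longrightarrow> sign_sequence L"
  obtains r l where "r \<in> {0, 1, 2}" "l \<in> (\<lambda>L. L 1) ` \<S>"
    "\<And>k. a (3 * k + r + 1) = l" "\<And>k. a (3 * k + r + 2) = - l" "FS (tl_seq ` \<S>) (\<lambda>k. a (3 * k + r))"
proof -
  define Q where "Q N r l \<longleftrightarrow> (\<exists>L\<in>\<S>. \<exists>j. N < \<bar>j\<bar> \<and> L 1 = l \<and> (j + r) mod 3 = 0 \<and>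
    (\<forall>k. \<bar>k\<bar> \<le> N \<longrightarrow> a k = tau L (j + k)))" for N r l
  have QE: thesis if "Q N r l" "\<And>L j. L \<in> \<S> \<Longrightarrow> N < \<bar>j\<bar> \<Longrightarrow> L 1 = l \<Longrightarrow> (j + r) mod 3 = 0 \<Longrightarrow>
    (\<And>k. \<bar>k\<bar> \<le> N \<Longrightarrow> a k = tau L (j + k)) \<Longrightarrow> thesis" for N r l thesis
    using that(1) unfolding Q_def by (elim bexE exE conjE) (rule that(2), simp_all)
  have mono: "Q N r l" if "Q N' r l" "N \<le> N'" for N N' r l
    using that unfolding Q_def by (meson le_less_trans order_trans)
  have ex: "\<exists>r\<in>{0,1,2}. \<exists>l\<in>{1,-1}. Q N r l" for N
  proof -
    from assms(1) obtain L j where *: "L \<in> \<S>" "N < \<bar>j\<bar>" "\<forall>k. \<bar>k\<bar> \<le> N \<longrightarrow> a k = tau L (j + k)"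
      unfolding FS_def by blast
    obtain r where r: "r \<in> {0,1,2}" "(j + r) mod 3 = 0"
    proof (cases j rule: mod3_cases)
      case 0 then show ?thesis using that[of 0] by simp
    next
      case 1 then have "(j + 2) mod 3 = 0" by presburger
      then show ?thesis using that[of 2] by simp
    next
      case 2 then have "(j + 1) mod 3 = 0" by presburger
      then show ?thesis using that[of 1] by simp
    qed
    have "L 1 \<in> {1, -1}" using sg[OF *(1)] by (auto simp: sign_sequence_def)
    moreover have "Q N r (L 1)" unfolding Q_def using * r(2) by (intro bexI[of _ L] exI[of _ j] conjI refl) assumption+
    ultimately show ?thesis using r(1) by blast
  qed
  have "\<exists>r\<in>{0,1,2}. \<exists>l\<in>{1,-1}. \<forall>N. Q N r l"
  proof (rule ccontr)
    assume "\<not> ?thesis"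
    then have ex': "\<exists>N. \<not> Q N r l" if "r \<in> {0,1,2}" "l \<in> {1,-1}" for r l using that by blast
    define f where "f r l = (SOME N. \<not> Q N r l)" for r l
    have f: "\<not> Q (f r l) r l" if "r \<in> {0,1,2}" "l \<in> {1,-1}" for r l
      unfolding f_def by (rule someI_ex) (rule ex'[OF that])
    \<comment> \<open>\<open>M\<close> is at least every bound at which one of the six pairs fails,
      so no pair could serve the window of size \<open>M\<close>.\<close>
    define M where "M = Max ((\<lambda>(r, l). f r l) ` ({0,1,2} \<times> {1,-1::int}))"
    from ex[of M] obtain r l where rl: "r \<in> {0,1,2}" "l \<in> {1,-1}" "Q M r l" by blast
    have "f r l \<le> M" unfolding M_def using rl by (intro Max_ge) auto
    from mono[OF rl(3) this] f[OF rl(1,2)] show False by contradiction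
  qed
  then obtain r l where r: "r \<in> {0,1,2}" and Q: "\<And>N. Q N r l" by blast
  have "l \<in> (\<lambda>L. L 1) ` \<S>" using Q[of 0] unfolding Q_def by blast
  moreover have "a (3 * k + r + 1) = l \<and> a (3 * k + r + 2) = - l" for k
  proof -
    obtain L j where *: "L 1 = l" "(j + r) mod 3 = 0"
      "\<And>k'. \<bar>k'\<bar> \<le> \<bar>3 * k + r\<bar> + 2 \<Longrightarrow> a k' = tau L (j + k')"
      by (rule QE[OF Q[of "\<bar>3 * k + r\<bar> + 2"]]) (rule that, simp_all)
    have "(j + (3 * k + r + 1)) mod 3 = 1" "(j + (3 * k + r + 2)) mod 3 = 2"
      using *(2) by presburger+
    with * show ?thesis by (simp add: tau_1 tau_2)
  qed
  moreover have "FS (tl_seq ` \<S>) (\<lambda>k. a (3 * k + r))"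
    unfolding FS_def
  proof
    fix N
    \<comment> \<open>The bound covers
      \<open>\<bar>3 * k + r\<bar> \<le> 3 * \<bar>N\<bar> + 2\<close>, and it still gives
      \<open>N < \<bar>j'\<bar>\<close> when \<open>j = 3 * j' - r\<close> with
      \<open>r \<le> 2\<close>.\<close>
    obtain L j where *: "L \<in> \<S>" "3 * \<bar>N\<bar> + 5 < \<bar>j\<bar>" "(j + r) mod 3 = 0"
      "\<And>k. \<bar>k\<bar> \<le> 3 * \<bar>N\<bar> + 5 \<Longrightarrow> a k = tau L (j + k)"
      by (rule QE[OF Q[of "3 * \<bar>N\<bar> + 5"]]) (rule that, simp_all)
    from *(3) obtain j' where j': "j = 3 * j' - r" by (metis add_diff_cancel_right' mod_0_imp_dvd dvdE)
    have N: "N < \<bar>j'\<bar>" using *(2) r j' by auto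
    have "a (3 * k + r) = tau (tl_seq L) (j' + k)" if k: "\<bar>k\<bar> \<le> N" for k
    proof -
      have "\<bar>3 * k + r\<bar> \<le> 3 * \<bar>N\<bar> + 5" using k r by auto
      then have "a (3 * k + r) = tau L (j + (3 * k + r))" using *(4) by blast
      also have "j + (3 * k + r) = 3 * (j' + k)" by (simp add: j')
      also have "tau L \<dots> = tau (tl_seq L) (j' + k)" using N k by (intro tau_3) auto
      finally show ?thesis .
    qed
    with N *(1) show "\<exists>L\<in>tl_seq ` \<S>. \<exists>j. N < \<bar>j\<bar> \<and> (\<forall>k. \<bar>k\<bar> \<le> N \<longrightarrow> a (3 * k + r) = tau L (j + k))"
      by blast
  qed
  ultimately show ?thesis using that r by blast
qed

section \<open>An executable test for words of folding sequences\<close>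

fun split3 :: "bool list \<Rightarrow> bool list \<times> bool list \<times> bool list" where
  "split3 [] = ([], [], [])"
| "split3 (x # w) = (case split3 w of (p, q, r) \<Rightarrow> (x # r, p, q))"

definition opposite :: "bool list \<Rightarrow> bool list \<Rightarrow> bool" where
  "opposite y z \<longleftrightarrow> list_all (\<lambda>b. b) y \<and> list_all Not z \<or> list_all Not y \<and> list_all (\<lambda>b. b) z"

text \<open>A necessary condition for a word of signs, \<open>True\<close> standing for 1, to occur
  in a folding sequence, tested on \<open>n\<close> levels. The three disjuncts are the possible
  positions of the derived word among the residues modulo 3; the two residues after it carry
  constant opposite signs. Boolean lists keep the test executable inside the refutation
  trees.\<close>

primrec legal :: "nat \<Rightarrow> bool list \<Rightarrow> bool" where
  "legal 0 w = True"
| "legal (Suc n) w = (case split3 w of (x, y, z) \<Rightarrow>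
     opposite y z \<and> legal n x \<or> opposite z x \<and> legal n y \<or> opposite x y \<and> legal n z)"

definition reads :: "(int \<Rightarrow> int) \<Rightarrow> bool list \<Rightarrow> bool" where
  "reads a w \<longleftrightarrow> (\<forall>i<length w. w ! i = (a (int i) = 1))"

lemma reads_Cons: "reads a (x # w) \<longleftrightarrow> x = (a 0 = 1) \<and> reads (\<lambda>k. a (k + 1)) w"
  unfolding reads_def by (auto simp: less_Suc_eq_0_disj add.commute)

lemma reads_Nil [simp]: "reads a []" by (simp add: reads_def)

lemma reads_split3:
  "reads a w \<Longrightarrow> split3 w = (p, q, r) \<Longrightarrow>
   reads (\<lambda>k. a (3 * k)) p \<and> reads (\<lambda>k. a (3 * k + 1)) q \<and> reads (\<lambda>k. a (3 * k + 2)) r"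
proof (induction w arbitrary: a p q r)
  case (Cons x w)
  obtain p' q' r' where w: "split3 w = (p', q', r')" by (cases "split3 w")
  from Cons.prems(1) have "reads (\<lambda>k. a (k + 1)) w" by (simp add: reads_Cons)
  from Cons.IH[OF this w] Cons.prems w show ?case
    by (auto simp: reads_Cons algebra_simps)
qed simp

lemma reads_opposite:
  assumes "reads a y" "reads b z" "\<And>k. a k = l" "\<And>k. b k = - l" "l = 1 \<or> l = -1"
  shows "opposite y z"
  using assms by (auto simp: reads_def opposite_def list_all_length)

text \<open>The residue found by \<open>FS_decomp\<close> selects the disjunct of
  \<open>legal\<close>. For \<open>r = 1\<close> and \<open>r = 2\<close> the indices wrap past 3,
  so some of the formulas are used at \<open>k - 1\<close>.\<close>

lemma FS_legal:
  assumes "FS {L. sign_sequence L} a" "reads a w"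
  shows "legal n w"
  using assms
proof (induction n arbitrary: a w)
  case (Suc n)
  obtain x y z where w: "split3 w = (x, y, z)" by (cases "split3 w")
  note rd = reads_split3[OF Suc.prems(2) w]
  obtain r l where rl: "r \<in> {0, 1, 2}" "l \<in> (\<lambda>L. L 1) ` {L. sign_sequence L}"
    "\<And>k. a (3 * k + r + 1) = l" "\<And>k. a (3 * k + r + 2) = - l"
    "FS (tl_seq ` {L. sign_sequence L}) (\<lambda>k. a (3 * k + r))"
    by (rule FS_decomp[OF Suc.prems(1)]) auto
  have l: "l = 1 \<or> l = -1" using rl(2) by (auto simp: sign_sequence_def)
  have F: "FS {L. sign_sequence L} (\<lambda>k. a (3 * k + r))"
    by (rule FS_mono[OF rl(5)]) (auto simp: sign_tl)
  from rl(1) consider "r = 0" | "r = 1" | "r = 2" by auto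
  then show ?case
  proof cases
    case 1
    then have "opposite y z" using rd rl(3,4) l by (intro reads_opposite) auto
    moreover have "legal n x" using Suc.IH[OF F] rd 1 by simp
    ultimately show ?thesis by (simp add: w)
  next
    case 2
    have "a (3 * k) = - l" for k using rl(4)[of "k - 1"] 2 by (simp add: algebra_simps)
    then have "opposite z x" using rd rl(3) 2 l
      by (intro reads_opposite[of "\<lambda>k. a (3 * k + 2)" z "\<lambda>k. a (3 * k)" x l]) (auto simp: add.commute add.left_commute)
    moreover have "legal n y" using Suc.IH[OF F] rd 2 by simp
    ultimately show ?thesis by (simp add: w)
  next
    case 3
    have "a (3 * k) = l" "a (3 * k + 1) = - l" for k
      using rl(3)[of "k - 1"] rl(4)[of "k - 1"] 3 by (simp_all add: algebra_simps)
    then have "opposite x y" using rd l by (intro reads_opposite) auto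
    moreover have "legal n z" using Suc.IH[OF F] rd 3 by simp
    ultimately show ?thesis by (simp add: w)
  qed
qed simp

section \<open>Sign functions on the triangular lattice\<close>

datatype dir = E0 | E1 | E2

fun rot :: "dir \<Rightarrow> dir" where
  "rot E0 = E1" | "rot E1 = E2" | "rot E2 = E0"

text \<open>The pair \<open>(a, b)\<close> stands for \<open>a + b * \<omega>\<close>, and the
  directions are the cube roots of unity, with \<open>- 1 - \<omega>\<close> as the third.\<close>

fun dvec :: "dir \<Rightarrow> int \<times> int" where
  "dvec E0 = (1, 0)" | "dvec E1 = (0, 1)" | "dvec E2 = (-1, -1)"

text \<open>Consecutive sides enclose the angle \<open>pi / 3\<close>, so a turn rotates the
  direction by a third of a full turn.\<close>

definition trn :: "int \<Rightarrow> dir \<Rightarrow> dir" where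
  "trn \<sigma> d = (if \<sigma> = 1 then rot d else rot (rot d))"

lemma rot3 [simp]: "rot (rot (rot d)) = d"
  by (cases d) auto

lemma dvec_rot2: "dvec (rot (rot d)) = - dvec d - dvec (rot d)"
  by (cases d) auto

lemma trn_inv [simp]: "\<sigma> = 1 \<or> \<sigma> = -1 \<Longrightarrow> trn (- \<sigma>) (trn \<sigma> d) = d"
  "\<sigma> = 1 \<or> \<sigma> = -1 \<Longrightarrow> trn \<sigma> (trn (- \<sigma>) d) = d"
  by (auto simp: trn_def)

lemma dir_cases: "d' = d \<or> d' = rot d \<or> d' = rot (rot d)"
  by (cases d; cases d') auto

text \<open>Modulo 3 this is the class modulo \<open>1 - \<omega>\<close>, as
  \<open>\<omega>\<close> is congruent to 1; every side leads from a class to the next one.\<close>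

definition csum :: "int \<times> int \<Rightarrow> int" where
  "csum x = fst x + snd x"

lemma csum_simps [simp]:
  "csum (x + y) = csum x + csum y" "csum (x - y) = csum x - csum y" "csum (- x) = - csum x"
  "csum (a, b) = a + b" "csum 0 = 0"
  by (auto simp: csum_def)

lemma csum_dvec: "csum (dvec d) mod 3 = 1"
  by (cases d) (auto simp: csum_def)

lemma csum_step:
  "csum x mod 3 = c mod 3 \<Longrightarrow> csum (x + dvec d) mod 3 = (c + 1) mod 3"
  "csum x mod 3 = c mod 3 \<Longrightarrow> csum (x - dvec d) mod 3 = (c + 2) mod 3"
proof -
  have d: "csum (dvec d) mod 3 = 1 mod 3" using csum_dvec by simp
  assume x: "csum x mod 3 = c mod 3"
  show "csum (x + dvec d) mod 3 = (c + 1) mod 3" using mod_add_cong[OF x d] by simp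
  have "(csum x - csum (dvec d)) mod 3 = (c - 1) mod 3" using mod_diff_cong[OF x d] by simp
  moreover have "c + 2 = c - 1 + 3" by simp
  then have "(c + 2) mod 3 = (c - 1) mod 3" by (simp only: mod_add_self2)
  ultimately show "csum (x - dvec d) mod 3 = (c + 2) mod 3" by simp
qed

lemma mod3_shift: "(a - b) mod 3 = (a + k) mod 3 \<Longrightarrow> 3 dvd b + k" for a :: int
proof -
  assume "(a - b) mod 3 = (a + k) mod 3"
  then have "3 dvd a - b - (a + k)" by (simp only: mod_eq_dvd_iff)
  then have "3 dvd - (b + k)" by simp
  then show ?thesis by (simp only: dvd_minus_iff)
qed

section \<open>Strands as orbits of a permutation of the sides\<close>

definition signs :: "(int \<times> int \<Rightarrow> int) \<Rightarrow> bool" where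
  "signs s \<longleftrightarrow> (\<forall>x. s x = 1 \<or> s x = -1)"

lemma signsD: "signs s \<Longrightarrow> s x = 1 \<or> s x = -1"
  unfolding signs_def by blast

text \<open>A vertex \<open>x\<close> and a direction \<open>d\<close> stand for the side from \<open>x\<close> to \<open>x + dvec d\<close>.\<close>

definition nx :: "(int \<times> int \<Rightarrow> int) \<Rightarrow> (int \<times> int) \<times> dir \<Rightarrow> (int \<times> int) \<times> dir" where
  "nx s e = (fst e + dvec (snd e), trn (s (fst e + dvec (snd e))) (snd e))"

definition pv :: "(int \<times> int \<Rightarrow> int) \<Rightarrow> (int \<times> int) \<times> dir \<Rightarrow> (int \<times> int) \<times> dir" where
  "pv s e = (fst e - dvec (trn (- s (fst e)) (snd e)), trn (- s (fst e)) (snd e))"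

lemma nx_pv [simp]: "signs s \<Longrightarrow> nx s (pv s e) = e"
  by (simp add: nx_def pv_def signsD)

lemma pv_nx [simp]: "signs s \<Longrightarrow> pv s (nx s e) = e"
  by (simp add: nx_def pv_def signsD)

lemma inj_nx: "signs s \<Longrightarrow> inj (nx s)"
  by (metis injI pv_nx)

text \<open>Forwards \<open>f\<close> is iterated; backwards its right inverse \<open>g\<close>
  chooses the values. The steps may depend on the index because \<open>associated_positive\<close>
  unfolds a curve with prescribed turns.\<close>

lemma int_recursion:
  fixes f g :: "int \<Rightarrow> 'a \<Rightarrow> 'a"
  assumes "\<And>k x. f k (g k x) = x"
  obtains E where "E m = e" "\<And>k. E (k + 1) = f k (E k)"
proof -
  define F where "F = rec_nat e (\<lambda>n. f (m + int n))"
  define G where "G = rec_nat e (\<lambda>n. g (m - int n - 1))"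
  define E where "E k = (if m \<le> k then F (nat (k - m)) else G (nat (m - k)))" for k
  have "E (k + 1) = f k (E k)" for k
  proof (cases "m \<le> k")
    case True
    then have "nat (k + 1 - m) = Suc (nat (k - m))" by simp
    with True show ?thesis by (simp add: E_def F_def)
  next
    case False
    then have n: "nat (m - k) = Suc (nat (m - k - 1))" by simp
    have "E k = g k (G (nat (m - k - 1)))" using False unfolding E_def n by (simp add: G_def)
    moreover have "E (k + 1) = G (nat (m - k - 1))"
    proof (cases "k + 1 = m")
      case True then show ?thesis by (simp add: E_def F_def G_def)
    next
      case False
      moreover have "m - (k + 1) = m - k - 1" by simp
      ultimately show ?thesis using \<open>\<not> m \<le> k\<close> by (simp add: E_def algebra_simps)
    qed
    ultimately show ?thesis using assms by simp
  qed
  moreover have "E m = e" by (simp add: E_def F_def)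
  ultimately show ?thesis using that by blast
qed

lemma int_recursion_unique:
  fixes E E' :: "int \<Rightarrow> 'a"
  assumes "\<And>k. E (k + 1) = f (E k)" "\<And>k. E' (k + 1) = f (E' k)" "inj f" "E m = E' m"
  shows "E k = E' k"
proof (induction k rule: int_induct[of _ m])
  case (step2 i)
  have "f (E (i - 1)) = f (E' (i - 1))"
    using assms(1)[of "i - 1"] assms(2)[of "i - 1"] step2 by simp
  then show ?case by (rule injD[OF assms(3)])
qed (use assms in auto)

definition orbit :: "(int \<times> int \<Rightarrow> int) \<Rightarrow> (int \<Rightarrow> (int \<times> int) \<times> dir) \<Rightarrow> bool" where
  "orbit s E \<longleftrightarrow> (\<forall>k. E (k + 1) = nx s (E k))"

lemma orbitD: "orbit s E \<Longrightarrow> E (k + 1) = nx s (E k)"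
  by (simp add: orbit_def)

lemma orbit_shift: "orbit s E \<Longrightarrow> orbit s (\<lambda>k. E (k + m))"
  unfolding orbit_def by (metis add.assoc add.commute)

lemma orbit_exists:
  assumes "signs s"
  obtains E where "orbit s E" "E m = e"
  using int_recursion[of "\<lambda>_. nx s" "\<lambda>_. pv s" m e] assms unfolding orbit_def by auto

lemma orbit_unique: "signs s \<Longrightarrow> orbit s E \<Longrightarrow> orbit s E' \<Longrightarrow> E m = E' m \<Longrightarrow> E = E'"
  using int_recursion_unique[of E "nx s" E' m] inj_nx unfolding orbit_def by blast

text \<open>Each side raises the class by one, so the class of a vertex determines its index along
  the strand modulo 3.\<close>

lemma orbit_csum:
  assumes "orbit s E"
  shows "csum (fst (E (m + k))) mod 3 = (csum (fst (E m)) + k) mod 3"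
proof (induction k rule: int_induct[of _ 0])
  case (step1 i)
  have "fst (E (m + (i + 1))) = fst (E (m + i)) + dvec (snd (E (m + i)))"
    using orbitD[OF assms, of "m + i"] by (simp add: nx_def add.assoc)
  then show ?case using csum_step(1)[OF step1(2)] by (simp add: add.assoc)
next
  case (step2 i)
  have "fst (E (m + i)) = fst (E (m + (i - 1))) + dvec (snd (E (m + (i - 1))))"
    using orbitD[OF assms, of "m + (i - 1)"] by (simp add: nx_def)
  then have "fst (E (m + (i - 1))) = fst (E (m + i)) - dvec (snd (E (m + (i - 1))))" by simp
  moreover have "(csum (fst (E m)) + i + 2) mod 3 = (csum (fst (E m)) + (i - 1)) mod 3"
    using mod_add_self2[of "csum (fst (E m)) + (i - 1)" 3] by (simp add: algebra_simps)
  ultimately show ?case using csum_step(2)[OF step2(2)] by metis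
qed simp

definition folding :: "(nat \<Rightarrow> int) set \<Rightarrow> (int \<times> int \<Rightarrow> int) \<Rightarrow> bool" where
  "folding \<S> s \<longleftrightarrow> signs s \<and> (\<forall>E. orbit s E \<longrightarrow> FS \<S> (\<lambda>k. s (fst (E k))))"

section \<open>Types of strands\<close>

text \<open>The type \<open>(r, \<lambda>)\<close> of a strand: on the vertices of class \<open>r\<close> one reads a word with the shifted
  sequence, on the two other classes the signs \<open>\<lambda>\<close> and \<open>-\<lambda>\<close>.\<close>

definition has_type where
  "has_type \<S> s t e \<longleftrightarrow> fst t \<in> {0, 1, 2} \<and> snd t \<in> (\<lambda>L. L 1) ` \<S> \<and> (\<exists>E m. orbit s E \<and> E 0 = e \<and>
     csum (fst (E m)) mod 3 = fst t \<and>
     (\<forall>k. s (fst (E (3 * k + m + 1))) = snd t) \<and> (\<forall>k. s (fst (E (3 * k + m + 2))) = - snd t) \<and>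
     FS (tl_seq ` \<S>) (\<lambda>k. s (fst (E (3 * k + m)))))"

lemma has_type_exists:
  assumes "folding \<S> s" "\<And>L. L \<in> \<S> \<Longrightarrow> sign_sequence L"
  shows "\<exists>t. has_type \<S> s t e"
proof -
  have s: "signs s" using assms(1) by (simp add: folding_def)
  obtain E where E: "orbit s E" "E 0 = e" by (rule orbit_exists[OF s])
  have FS: "FS \<S> (\<lambda>k. s (fst (E k)))" using assms(1) E(1) by (simp add: folding_def)
  obtain r l where *: "r \<in> {0, 1, 2}" "l \<in> (\<lambda>L. L 1) ` \<S>"
    "\<And>k. s (fst (E (3 * k + r + 1))) = l" "\<And>k. s (fst (E (3 * k + r + 2))) = - l"
    "FS (tl_seq ` \<S>) (\<lambda>k. s (fst (E (3 * k + r))))"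
    by (rule FS_decomp[OF FS assms(2)]) auto
  have "csum (fst (E r)) mod 3 \<in> {0, 1, 2}" by auto
  with * E show ?thesis
    unfolding has_type_def by (intro exI[of _ "(csum (fst (E r)) mod 3, l)"]) auto
qed

text \<open>Passing to the next side only shifts the parametrisation, which the free offset
  \<open>m\<close> absorbs; hence a type belongs to a whole strand.\<close>

lemma has_type_nx:
  assumes "signs s"
  shows "has_type \<S> s t (nx s e) \<longleftrightarrow> has_type \<S> s t e"
proof
  assume "has_type \<S> s t e"
  then obtain E m where *: "fst t \<in> {0, 1, 2}" "snd t \<in> (\<lambda>L. L 1) ` \<S>" "orbit s E" "E 0 = e"
     "csum (fst (E m)) mod 3 = fst t"
     "\<forall>k. s (fst (E (3 * k + m + 1))) = snd t" "\<forall>k. s (fst (E (3 * k + m + 2))) = - snd t"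
     "FS (tl_seq ` \<S>) (\<lambda>k. s (fst (E (3 * k + m))))" unfolding has_type_def by auto
  have "E 1 = nx s e" using orbitD[OF *(3), of 0] *(4) by simp
  then show "has_type \<S> s t (nx s e)" unfolding has_type_def
    using * orbit_shift[OF *(3), of 1]
    by (intro conjI exI[of _ "\<lambda>k. E (k + 1)"] exI[of _ "m - 1"]) (simp_all add: algebra_simps)
next
  assume "has_type \<S> s t (nx s e)"
  then obtain E m where *: "fst t \<in> {0, 1, 2}" "snd t \<in> (\<lambda>L. L 1) ` \<S>" "orbit s E" "E 0 = nx s e"
     "csum (fst (E m)) mod 3 = fst t"
     "\<forall>k. s (fst (E (3 * k + m + 1))) = snd t" "\<forall>k. s (fst (E (3 * k + m + 2))) = - snd t"
     "FS (tl_seq ` \<S>) (\<lambda>k. s (fst (E (3 * k + m))))" unfolding has_type_def by auto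
  have "nx s (E (- 1)) = nx s e" using orbitD[OF *(3), of "- 1"] *(4) by simp
  then have "E (- 1) = e" using inj_nx[OF assms] by (auto dest: injD)
  then show "has_type \<S> s t e" unfolding has_type_def
    using * orbit_shift[OF *(3), of "- 1"]
    by (intro conjI exI[of _ "\<lambda>k. E (k + - 1)"] exI[of _ "m + 1"]) (simp_all add: algebra_simps)
qed

definition sat :: "int \<times> int \<Rightarrow> int \<Rightarrow> int \<Rightarrow> bool" where
  "sat t c \<sigma> \<longleftrightarrow> (c mod 3 = (fst t + 1) mod 3 \<longrightarrow> \<sigma> = snd t) \<and> (c mod 3 = (fst t + 2) mod 3 \<longrightarrow> \<sigma> = - snd t)"

lemma has_type_sat:
  assumes "has_type \<S> s t e"
  shows "sat t (csum (fst e)) (s (fst e))"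
proof -
  from assms obtain E m where *: "orbit s E" "E 0 = e" "csum (fst (E m)) mod 3 = fst t"
     "\<forall>k. s (fst (E (3 * k + m + 1))) = snd t" "\<forall>k. s (fst (E (3 * k + m + 2))) = - snd t"
    unfolding has_type_def by auto
  have c: "csum (fst e) mod 3 = (fst t - m) mod 3"
    using orbit_csum[OF *(1), of m "- m"] *(2,3) by (metis add.right_inverse mod_diff_left_eq uminus_add_conv_diff add.commute)
  show ?thesis unfolding sat_def
  proof (intro conjI impI)
    assume "csum (fst e) mod 3 = (fst t + 1) mod 3"
    with c have "3 dvd m + 1" using mod3_shift[of "fst t" m 1] by simp
    then obtain q where "m + 1 = 3 * q" by (rule dvdE)
    then have "3 * (- q) + m + 1 = 0" by simp
    with *(4)[rule_format, of "- q"] *(2) show "s (fst e) = snd t" by (simp only:)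
  next
    assume "csum (fst e) mod 3 = (fst t + 2) mod 3"
    with c have "3 dvd m + 2" using mod3_shift[of "fst t" m 2] by simp
    then obtain q where "m + 2 = 3 * q" by (rule dvdE)
    then have "3 * (- q) + m + 2 = 0" by simp
    with *(5)[rule_format, of "- q"] *(2) show "s (fst e) = - snd t" by (simp only:)
  qed
qed

text \<open>Two offsets that lead to vertices of the same class differ by a multiple of 3, which
  only shifts the derived sequence.\<close>

lemma has_type_FS:
  assumes "signs s" "has_type \<S> s t (E 0)" "orbit s E" "csum (fst (E m)) mod 3 = fst t"
  shows "FS (tl_seq ` \<S>) (\<lambda>k. s (fst (E (3 * k + m))))"
proof -
  from assms(2) obtain E' m' where *: "orbit s E'" "E' 0 = E 0" "csum (fst (E' m')) mod 3 = fst t"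
     "FS (tl_seq ` \<S>) (\<lambda>k. s (fst (E' (3 * k + m'))))"
    unfolding has_type_def by auto
  have E: "E' = E" by (rule orbit_unique[OF assms(1) *(1) assms(3) *(2)])
  have "(csum (fst (E m)) + (m' - m)) mod 3 = csum (fst (E m)) mod 3"
    using orbit_csum[OF assms(3), of m "m' - m"] *(3) assms(4) E by simp
  then have "(m' - m) mod 3 = 0" by (metis add_diff_cancel_left' mod_eq_dvd_iff mod_0_imp_dvd dvd_imp_mod_0)
  then obtain q where q: "m' = m + 3 * q" by (metis add.commute diff_add_cancel mod_0_imp_dvd dvdE)
  from FS_shift[OF *(4), of "- q"] show ?thesis by (simp add: E q algebra_simps)
qed

text \<open>What the comparison of types needs, in a form stable under the symmetries of the
  lattice: the sequences range over all sign sequences, a set closed under negation.\<close>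

definition typed :: "(int \<times> int \<Rightarrow> int) \<Rightarrow> ((int \<times> int) \<times> dir \<Rightarrow> int \<times> int) \<Rightarrow> bool" where
  "typed s ty \<longleftrightarrow> signs s \<and> (\<forall>e. ty (nx s e) = ty e) \<and>
     (\<forall>e. fst (ty e) \<in> {0, 1, 2} \<and> snd (ty e) \<in> {1, -1}) \<and>
     (\<forall>e. sat (ty e) (csum (fst e)) (s (fst e))) \<and>
     (\<forall>E m. orbit s E \<longrightarrow> csum (fst (E m)) mod 3 = fst (ty (E 0)) \<longrightarrow>
        FS {L. sign_sequence L} (\<lambda>k. s (fst (E (3 * k + m)))))"

lemma folding_typed:
  assumes "folding \<S> s" and sg: "\<And>L. L \<in> \<S> \<Longrightarrow> sign_sequence L"
  obtains ty where "typed s ty" "\<And>e. has_type \<S> s (ty e) e"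
proof -
  define ty where "ty e = (SOME t. has_type \<S> s t e)" for e
  have s: "signs s" using assms by (simp add: folding_def)
  have ht: "has_type \<S> s (ty e) e" for e
    unfolding ty_def by (rule someI_ex) (rule has_type_exists[OF assms])
  have "ty (nx s e) = ty e" for e unfolding ty_def by (simp add: has_type_nx[OF s])
  moreover have "fst (ty e) \<in> {0, 1, 2} \<and> snd (ty e) \<in> {1, -1}" for e
    using ht[of e] sg unfolding has_type_def by (force simp: sign_sequence_def)
  moreover have "FS {L. sign_sequence L} (\<lambda>k. s (fst (E (3 * k + m))))"
    if "orbit s E" "csum (fst (E m)) mod 3 = fst (ty (E 0))" for E m
    by (rule FS_mono[OF has_type_FS[OF s ht that]]) (auto simp: sg sign_tl)
  ultimately have "typed s ty" using s has_type_sat[OF ht] unfolding typed_def by blast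
  then show ?thesis using that ht by blast
qed

section \<open>Types of the strands around one vertex\<close>

lemma dvec_turn:
  "\<sigma> = 1 \<or> \<sigma> = -1 \<Longrightarrow> x + dvec d + dvec (trn \<sigma> d) = x - dvec (trn (- \<sigma>) d)"
  "\<sigma> = 1 \<or> \<sigma> = -1 \<Longrightarrow> x - dvec d - dvec (trn (- \<sigma>) d) = x + dvec (trn \<sigma> d)"
  by (auto simp: trn_def dvec_rot2)

lemma sat_cong: "c mod 3 = c' mod 3 \<Longrightarrow> sat t c \<sigma> = sat t c' \<sigma>"
  by (simp add: sat_def)

text \<open>Up to exchanging the two roles, this is the only type other than \<open>t\<close> whose
  demands clash with those of \<open>t\<close> on no class.\<close>

definition plus_type :: "int \<times> int \<Rightarrow> int \<times> int" where
  "plus_type t = ((fst t + 1) mod 3, - snd t)"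

definition meets :: "int \<Rightarrow> int \<Rightarrow> int \<times> int \<Rightarrow> int \<times> int \<Rightarrow> bool" where
  "meets c \<sigma> t t' \<longleftrightarrow> t' = plus_type t \<and> \<sigma> = snd t \<and> (c mod 3 = fst t \<or> c mod 3 = (fst t + 1) mod 3)"

definition compatible :: "int \<Rightarrow> int \<Rightarrow> int \<times> int \<Rightarrow> int \<times> int \<Rightarrow> bool" where
  "compatible c \<sigma> t t' \<longleftrightarrow> t = t' \<or> meets c \<sigma> t t' \<or> meets c \<sigma> t' t"

definition all_types :: "(int \<times> int) list" where
  "all_types = [(0, 1), (0, -1), (1, 1), (1, -1), (2, 1), (2, -1)]"

text \<open>The strand entering the vertex in direction \<open>d\<close> also meets four of the six neighbours of
  that vertex: \<open>n\<close> lists the signs of the neighbours ahead, \<open>m\<close> of those behind.\<close>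

definition strand_ok :: "int \<Rightarrow> int \<Rightarrow> (dir \<Rightarrow> int) \<Rightarrow> (dir \<Rightarrow> int) \<Rightarrow> dir \<Rightarrow> int \<times> int \<Rightarrow> bool" where
  "strand_ok c \<sigma> n m d t \<longleftrightarrow> (let j = trn \<sigma> d in
     sat t c \<sigma> \<and> sat t (c + 1) (n j) \<and> sat t (c + 2) (m d) \<and>
     sat t (c + 2) (m (trn (- n j) j)) \<and> sat t (c + 1) (n (trn (m d) d)))"

text \<open>If the next two vertices of the strand carry the same sign, it runs around a triangle
  and re-enters the centre in direction \<open>k\<close>, so two of the three strands at the centre
  are one.\<close>

definition merge_ok :: "int \<Rightarrow> (dir \<Rightarrow> int) \<Rightarrow> (dir \<Rightarrow> int) \<Rightarrow> (dir \<Rightarrow> int \<times> int) \<Rightarrow> dir \<Rightarrow> bool" where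
  "merge_ok \<sigma> n m t d \<longleftrightarrow> (let j = trn \<sigma> d; k = trn (- n j) j in m k = n j \<longrightarrow> t d = t k)"

definition triples :: "(dir \<Rightarrow> int) list" where
  "triples = map (\<lambda>(a, b, c). case_dir a b c) (List.product [1, -1] (List.product [1, -1] [1, -1]))"

lemma triples: "(\<And>d. f d = 1 \<or> f d = -1) \<Longrightarrow> f \<in> set triples"
proof -
  assume f: "\<And>d. f d = 1 \<or> f d = -1"
  have "f = (\<lambda>(a, b, c). case_dir a b c) (f E0, f E1, f E2)"
    by (rule ext) (simp split: dir.split)
  moreover have "(f E0, f E1, f E2) \<in> set (List.product [1, -1] (List.product [1, -1] [1, -1]))"
    using f[of E0] f[of E1] f[of E2] by auto
  ultimately show ?thesis unfolding triples_def set_map by (rule image_eqI)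
qed

text \<open>The enumeration runs over the class of the centre and the signs at it and its six
  neighbours. The types are filtered per direction before they are combined, which keeps the
  evaluation small. Only one pair of strands is examined; the others follow by rotation.\<close>

lemma hexagon_enum:
  "list_all (\<lambda>c. list_all (\<lambda>\<sigma>. list_all (\<lambda>n. list_all (\<lambda>m.
     (let F = (\<lambda>d. filter (strand_ok c \<sigma> n m d) all_types) in
      list_all (\<lambda>t0. list_all (\<lambda>t1. list_all (\<lambda>t2.
        (let t = case_dir t0 t1 t2 in
         merge_ok \<sigma> n m t E0 \<longrightarrow> merge_ok \<sigma> n m t E1 \<longrightarrow> merge_ok \<sigma> n m t E2 \<longrightarrow> compatible c \<sigma> t0 t1))
      (F E2)) (F E1)) (F E0))) triples) triples) [1, -1]) [0, 1, 2]"
  by code_simp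

lemma hexagon:
  assumes "c \<in> {0, 1, 2}" "\<sigma> = 1 \<or> \<sigma> = -1" "\<And>d. n d = 1 \<or> n d = -1" "\<And>d. m d = 1 \<or> m d = -1"
    "\<And>d. fst (t d) \<in> {0, 1, 2} \<and> snd (t d) \<in> {1, -1}"
    "\<And>d. strand_ok c \<sigma> n m d (t d)" "\<And>d. merge_ok \<sigma> n m t d"
  shows "compatible c \<sigma> (t E0) (t E1)"
proof -
  have c: "c \<in> set [0, 1, 2]" and s: "\<sigma> \<in> set [1, -1]" using assms(1,2) by auto
  have n: "n \<in> set triples" and m: "m \<in> set triples" using assms(3,4) by (auto intro: triples)
  have "t d \<in> set all_types" for d
    using assms(5)[of d] by (cases "t d") (auto simp: all_types_def)
  then have F: "t d \<in> set (filter (strand_ok c \<sigma> n m d) all_types)" for d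
    using assms(6) by auto
  have t: "case_dir (t E0) (t E1) (t E2) = t" by (rule ext) (simp split: dir.split)
  show ?thesis
    using hexagon_enum[unfolded list_all_iff Let_def, rule_format, OF c s n m F F F] assms(7)
    unfolding t by blast
qed

lemma typedD:
  assumes "typed s ty"
  shows "signs s" "ty (nx s e) = ty e" "fst (ty e) \<in> {0, 1, 2}" "snd (ty e) = 1 \<or> snd (ty e) = -1"
    "csum (fst e) mod 3 = c mod 3 \<Longrightarrow> sat (ty e) c (s (fst e))"
    "orbit s E \<Longrightarrow> csum (fst (E m)) mod 3 = fst (ty (E 0)) \<Longrightarrow>
       FS {L. sign_sequence L} (\<lambda>k. s (fst (E (3 * k + m))))"
proof -
  show "signs s" using assms unfolding typed_def by blast
  show "ty (nx s e) = ty e" using assms unfolding typed_def by blast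
  have "fst (ty e) \<in> {0, 1, 2} \<and> snd (ty e) \<in> {1, -1}" using assms unfolding typed_def by blast
  then show "fst (ty e) \<in> {0, 1, 2}" "snd (ty e) = 1 \<or> snd (ty e) = -1" by blast+
  have "sat (ty e) (csum (fst e)) (s (fst e))" using assms unfolding typed_def by blast
  then show "sat (ty e) c (s (fst e))" if "csum (fst e) mod 3 = c mod 3"
    using sat_cong[OF that] by simp
  show "FS {L. sign_sequence L} (\<lambda>k. s (fst (E (3 * k + m))))"
    if "orbit s E" "csum (fst (E m)) mod 3 = fst (ty (E 0))"
    using assms that unfolding typed_def by blast
qed

lemma typed_pv: "typed s ty \<Longrightarrow> ty (pv s e) = ty e"
  using typedD(1,2)[of s ty] nx_pv by metis

definition strand_in :: "int \<times> int \<Rightarrow> dir \<Rightarrow> (int \<times> int) \<times> dir" where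
  "strand_in v d = (v - dvec d, d)"

lemma compatible_rot:
  assumes "typed s ty"
  shows "compatible (csum v) (s v) (ty (strand_in v d)) (ty (strand_in v (rot d)))"
proof -
  note ty = typedD[OF assms]
  \<comment> \<open>Relabelling the directions by this rotation turns the pair \<open>d\<close>,
    \<open>rot d\<close> into \<open>E0\<close>, \<open>E1\<close>, the pair treated by
    \<open>hexagon\<close>.\<close>
  define sh where "sh e = (case e of E0 \<Rightarrow> d | E1 \<Rightarrow> rot d | E2 \<Rightarrow> rot (rot d))" for e
  have sh_rot: "sh (rot e) = rot (sh e)" for e by (cases e) (auto simp: sh_def)
  have sh_trn: "sh (trn \<sigma> e) = trn \<sigma> (sh e)" for \<sigma> e by (simp add: trn_def sh_rot)
  define c where "c = csum v mod 3"
  have c: "c \<in> {0, 1, 2}" "csum v mod 3 = c mod 3" unfolding c_def by auto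
  have sg: "s x = 1 \<or> s x = -1" for x using signsD[OF ty(1)] .
  define n m t where "n e = s (v + dvec (sh e))" "m e = s (v - dvec (sh e))"
    "t e = ty (strand_in v (sh e))" for e
  note nmt = this
  have ok: "strand_ok c (s v) n m e (t e) \<and> merge_ok (s v) n m t e" for e
  proof -
    define e' j where "e' = sh e" "j = trn (s v) e'"
    define k where "k = trn (- s (v + dvec j)) j"
    let ?e = "strand_in v e'"
    have e1: "nx s ?e = (v, j)" by (simp add: strand_in_def nx_def e'_j_def)
    have e2: "nx s (nx s ?e) = (v + dvec j, trn (s (v + dvec j)) j)" by (subst e1) (simp add: nx_def)
    \<comment> \<open>Two consecutive sides complete to a triangle, so the vertex after next is
      again a neighbour of \<open>v\<close>, now one behind it.\<close>
    have jk: "v + dvec j + dvec (trn (s (v + dvec j)) j) = v - dvec k"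
      unfolding k_def by (rule dvec_turn(1)[OF sg])
    have e3: "nx s (nx s (nx s ?e)) = (v - dvec k, trn (s (v - dvec k)) (trn (s (v + dvec j)) j))"
      by (subst e2) (simp add: nx_def jk)
    have e0: "fst (pv s ?e) = v + dvec (trn (s (v - dvec e')) e')"
      using dvec_turn(2)[OF sg] by (simp add: strand_in_def pv_def)
    note cs = csum_step[OF c(2)]
    have y: "ty (v, j) = ty ?e" "ty (v + dvec j, trn (s (v + dvec j)) j) = ty ?e"
      "ty (v - dvec k, trn (s (v - dvec k)) (trn (s (v + dvec j)) j)) = ty ?e"
      using ty(2) e1 e2 e3 by metis+
    have "sat (ty ?e) c (s v)" using ty(5)[of "(v, j)" c] y(1) c by simp
    moreover have "sat (ty ?e) (c + 1) (s (v + dvec j))"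
      using ty(5)[of "(v + dvec j, trn (s (v + dvec j)) j)" "c + 1"] y(2) cs(1) by simp
    moreover have "sat (ty ?e) (c + 2) (s (v - dvec e'))"
      using ty(5)[of ?e "c + 2"] cs(2) by (simp add: strand_in_def)
    moreover have "sat (ty ?e) (c + 2) (s (v - dvec k))"
      using ty(5)[of "(v - dvec k, trn (s (v - dvec k)) (trn (s (v + dvec j)) j))" "c + 2"] y(3) cs(2) by simp
    moreover have "sat (ty ?e) (c + 1) (s (v + dvec (trn (s (v - dvec e')) e')))"
      using ty(5)[of "pv s ?e" "c + 1"] typed_pv[OF assms] cs(1) e0 by simp
    moreover have "ty ?e = ty (strand_in v k)" if "s (v - dvec k) = s (v + dvec j)"
    proof -
      have "trn (s (v - dvec k)) (trn (s (v + dvec j)) j) = k"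
        unfolding that using sg[of "v + dvec j"] by (auto simp: k_def trn_def)
      then have "nx s (nx s (nx s ?e)) = strand_in v k" unfolding e3 by (simp add: strand_in_def)
      then show ?thesis using ty(2) by metis
    qed
    ultimately show ?thesis
      by (simp add: strand_ok_def merge_ok_def Let_def nmt sh_trn e'_j_def k_def)
  qed
  have "compatible c (s v) (t E0) (t E1)"
  proof (rule hexagon[where n = n and m = m and t = t])
    show "c \<in> {0, 1, 2}" by (rule c(1))
    show "s v = 1 \<or> s v = -1" by (rule sg)
    show "n e = 1 \<or> n e = -1" "m e = 1 \<or> m e = -1" for e unfolding nmt by (rule sg)+
    show "fst (t e) \<in> {0, 1, 2} \<and> snd (t e) \<in> {1, -1}" for e
      using ty(3,4)[of "strand_in v (sh e)"] unfolding nmt by blast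
    show "strand_ok c (s v) n m e (t e)" "merge_ok (s v) n m t e" for e using ok by blast+
  qed
  then show ?thesis using c by (simp add: nmt sh_def compatible_def meets_def)
qed

lemma compatible_all:
  assumes "typed s ty"
  shows "compatible (csum v) (s v) (ty (strand_in v d)) (ty (strand_in v d'))"
  using dir_cases[of d' d] compatible_rot[OF assms, of v d] compatible_rot[OF assms, of v "rot (rot d)"]
  by (auto simp: compatible_def)

section \<open>Strands of different types do not meet\<close>

text \<open>Up to symmetry, only the types \<open>(1, 1)\<close> and \<open>(2, -1)\<close> remain to be separated. Their strands are
  followed through the hexagons around the vertices \<open>y\<close> of class 0, where \<open>(y, d)\<close> stands for the strand
  entering \<open>y\<close> in direction \<open>rot d\<close>. The derived word of the strand is read at its \<open>own\<close> vertices, and at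
  a \<open>foreign\<close> corner of the hexagon the type forces the sign to be positive.\<close>

definition end_type :: "bool \<Rightarrow> int \<times> int" where
  "end_type t = (if t then (1, 1) else (2, -1))"

text \<open>\<open>(2, -1)\<close> is \<open>plus_type (1, 1)\<close>. The other types that these
  two may meet are \<open>(0, -1)\<close> and \<open>(0, 1)\<close>, and such a meeting takes place
  only at a negative vertex.\<close>

lemma hot_vertex:
  assumes "typed s ty" "s v = 1" "csum v mod 3 = 1 \<or> csum v mod 3 = 2"
    "ty (strand_in v d) = end_type b"
  shows "\<exists>b'. ty (strand_in v d') = end_type b'"
proof -
  have "ty (strand_in v d') = end_type True \<or> ty (strand_in v d') = end_type False"
    using compatible_all[OF assms(1), of v d d'] assms(2-4) typedD(3,4)[OF assms(1), of "strand_in v d'"]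
    by (cases "ty (strand_in v d')") (auto simp: compatible_def meets_def plus_type_def end_type_def split: if_splits)
  then show ?thesis by blast
qed

text \<open>Both types demand the sign -1 at class 0, so the strand turns right there: entering
  along \<open>rot d\<close>, it leaves along \<open>d\<close>.\<close>

definition edge :: "(int \<times> int) \<times> dir \<Rightarrow> (int \<times> int) \<times> dir" where
  "edge q = (fst q - dvec (rot (snd q)), rot (snd q))"

definition strand where
  "strand ty q t \<longleftrightarrow> csum (fst q) mod 3 = 0 \<and> ty (edge q) = end_type t"

definition own :: "bool \<Rightarrow> (int \<times> int) \<times> dir \<Rightarrow> int \<times> int" where
  "own t q = (if t then fst q + dvec (snd q) else fst q - dvec (rot (rot (snd q))))"

definition own_before :: "bool \<Rightarrow> (int \<times> int) \<times> dir \<Rightarrow> int \<times> int" where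
  "own_before t q = (if t then fst q + dvec (rot (rot (snd q))) else fst q - dvec (rot (snd q)))"

definition foreign :: "bool \<Rightarrow> int \<times> int \<Rightarrow> dir \<Rightarrow> int \<times> int" where
  "foreign t x d = (if t then x - dvec d else x + dvec d)"

text \<open>Three sides lead from one class 0 vertex to the next, past one own vertex and one vertex
  forced to be positive. If the own sign \<open>b\<close> is positive too, the strand turns left
  twice, closes a triangle and is back where it started.\<close>

definition strand_next :: "bool \<Rightarrow> bool \<Rightarrow> (int \<times> int) \<times> dir \<Rightarrow> (int \<times> int) \<times> dir" where
  "strand_next t b q = (let d = snd q; f = rot (rot d) in
     if b then (fst q, rot d) else if t then (own t q - dvec (rot d), f) else (own t q + dvec d, f))"

definition strand_prev :: "bool \<Rightarrow> bool \<Rightarrow> (int \<times> int) \<times> dir \<Rightarrow> (int \<times> int) \<times> dir" where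
  "strand_prev t b q = (let d = snd q; e = rot d in
     if b then (fst q, rot e) else if t then (own_before t q - dvec e, e) else (own_before t q + dvec d, e))"

context
  fixes s :: "int \<times> int \<Rightarrow> int" and ty
  assumes ty: "typed s ty"
begin

lemma type_sign:
  assumes "ty e = end_type t" "csum (fst e) mod 3 = c"
  shows "t \<Longrightarrow> c = 2 \<Longrightarrow> s (fst e) = 1" "\<not> t \<Longrightarrow> c = 1 \<Longrightarrow> s (fst e) = 1" "c = 0 \<Longrightarrow> s (fst e) = -1"
  using typedD(5)[OF ty, of e c] assms by (auto simp: end_type_def sat_def split: if_splits)

text \<open>Two of the three signs on the way are forced by the type (\<open>sx\<close>, and
  \<open>A\<close> or \<open>B\<close>), so the own sign alone decides where the strand
  arrives.\<close>

lemma strand_forward: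
  assumes "strand ty q t"
  shows "nx s (nx s (nx s (edge q))) = edge (strand_next t (s (own t q) = 1) q)"
    "fst (nx s (nx s (edge q))) = fst q + dvec (snd q)" "t \<or> fst (nx s (nx s (nx s (edge q)))) = own t q"
    "csum (own t q) mod 3 = (if t then 1 else 2)"
proof -
  obtain x d where q: "q = (x, d)" by (cases q)
  have t: "ty (edge q) = end_type t" and x: "csum x mod 3 = 0 mod 3"
    using assms by (auto simp: strand_def q)
  have tn: "ty (nx s (edge q)) = end_type t" "ty (nx s (nx s (edge q))) = end_type t"
    "ty (nx s (nx s (nx s (edge q)))) = end_type t"
    using t typedD(2)[OF ty] by simp_all
  have e1': "fst (nx s (edge q)) = x" by (simp add: nx_def edge_def q)
  have sx: "s x = -1" using type_sign(3)[OF tn(1)] x e1' by simp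
  have e1: "nx s (edge q) = (x, d)" by (simp add: nx_def edge_def q sx trn_def)
  define v where "v = x + dvec d"
  have v: "csum v mod 3 = 1" using csum_step(1)[OF x] by (simp add: v_def)
  have e2: "nx s (nx s (edge q)) = (v, trn (s v) d)" by (subst e1) (simp add: nx_def v_def)
  have w: "csum (x - dvec d') mod 3 = 2" for d' using csum_step(2)[OF x, of d'] by simp
  have e3': "fst (nx s (nx s (nx s (edge q)))) = v + dvec (trn (s v) d)" by (subst e2) (simp add: nx_def)
  have sv: "s v = 1 \<or> s v = -1" using typedD(1)[OF ty] by (rule signsD)
  have vt: "v + dvec (trn (s v) d) = x - dvec (trn (- s v) d)"
    unfolding v_def using dvec_turn(1)[OF sv] v_def by simp
  have e3: "nx s (nx s (nx s (edge q))) = (x - dvec (trn (- s v) d), trn (s (x - dvec (trn (- s v) d))) (trn (s v) d))"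
    unfolding e2 by (simp add: nx_def vt)
  have A: "s (x - dvec (trn (- s v) d)) = 1" if t
    using type_sign(1)[OF tn(3)] that w e3 by simp
  have B: "s v = 1" if "\<not> t" using type_sign(2)[OF tn(2)] that v e2 by simp
  show "nx s (nx s (nx s (edge q))) = edge (strand_next t (s (own t q) = 1) q)"
  proof (cases t)
    case True
    with sv A show ?thesis unfolding e3
      by (auto simp: strand_next_def own_def edge_def Let_def q v_def trn_def dvec_rot2)
  next
    case False
    have "s (x - dvec (rot (rot d))) = 1 \<or> s (x - dvec (rot (rot d))) = - 1"
      using typedD(1)[OF ty] by (rule signsD)
    with False B show ?thesis unfolding e3
      by (auto simp: strand_next_def own_def edge_def Let_def q trn_def)
  qed
  show "fst (nx s (nx s (edge q))) = fst q + dvec (snd q)" unfolding e2 by (simp add: q v_def)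
  show "t \<or> fst (nx s (nx s (nx s (edge q)))) = own t q"
    unfolding e3 using B by (auto simp: own_def q trn_def)
  show "csum (own t q) mod 3 = (if t then 1 else 2)" using v w by (auto simp: own_def q v_def)
qed

lemma strand_next:
  assumes "strand ty q t"
  shows "strand ty (strand_next t (s (own t q) = 1) q) t"
proof -
  have "csum (fst (strand_next t (s (own t q) = 1) q)) mod 3 = 0"
    using assms csum_step(2)[of "own t q" 1 "rot (snd q)"] csum_step(1)[of "own t q" 2 "snd q"] strand_forward(4)[OF assms]
    by (auto simp: strand_next_def Let_def strand_def split: if_splits)
  then show ?thesis using assms strand_forward(1)[OF assms] typedD(2)[OF ty] unfolding strand_def by metis
qed

lemma strand_prev:
  assumes "strand ty q t"
  shows "strand ty (strand_prev t (s (own_before t q) = 1) q) t"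
proof -
  obtain x d where q: "q = (x, d)" by (cases q)
  have t: "ty (edge q) = end_type t" and x: "csum x mod 3 = 0 mod 3"
    using assms by (auto simp: strand_def q)
  have sg: "s y = 1 \<or> s y = -1" for y using typedD(1)[OF ty] by (rule signsD)
  define w where "w = x - dvec (rot d)"
  define f where "f = trn (- s w) (rot d)"
  define v where "v = w - dvec f"
  define g where "g = trn (- s v) f"
  define z where "z = v - dvec g"
  define h where "h = trn (- s z) g"
  have e0: "edge q = (w, rot d)" by (simp add: edge_def q w_def)
  have e1: "pv s (edge q) = (v, f)" by (subst e0) (simp add: pv_def f_def v_def)
  have e2: "pv s (pv s (edge q)) = (z, g)" by (subst e1) (simp add: pv_def g_def z_def)
  have e3: "pv s (pv s (pv s (edge q))) = (z - dvec h, h)" by (subst e2) (simp add: pv_def h_def)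
  have tp: "ty (v, f) = end_type t" "ty (z, g) = end_type t" "ty (z - dvec h, h) = end_type t"
    using t typed_pv[OF ty] e1 e2 e3 by metis+
  have cw: "csum w mod 3 = 2 mod 3" using csum_step(2)[OF x] by (simp add: w_def)
  have cv: "csum v mod 3 = 1 mod 3" using csum_step(2)[OF cw, of f] by (simp add: v_def)
  have cz: "csum z mod 3 = 0" using csum_step(2)[OF cv, of g] by (simp add: z_def)
  have sz: "s z = -1" using type_sign(3)[OF tp(2)] cz by simp
  have A: "s w = 1" if t using type_sign(1)[OF t] that cw e0 by simp
  have B: "s v = 1" if "\<not> t" using type_sign(2)[OF tp(1)] that cv by simp
  have "(z - dvec h, h) = edge (z, g)" by (simp add: edge_def h_def sz trn_def)
  also have "(z, g) = strand_prev t (s (own_before t q) = 1) q"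
  proof (cases t)
    case True
    have f: "f = d" using A True by (simp add: f_def trn_def)
    have "own_before t q = v" using True by (simp add: own_before_def q v_def w_def f dvec_rot2)
    then show ?thesis using sg[of v] True
      by (auto simp: strand_prev_def q g_def z_def trn_def f Let_def v_def w_def dvec_rot2)
  next
    case False
    have "own_before t q = w" using False by (simp add: own_before_def q w_def)
    then show ?thesis using sg[of w] False B[OF False]
      by (auto simp: strand_prev_def q g_def z_def trn_def f_def Let_def v_def w_def dvec_rot2)
  qed
  finally have "edge (strand_prev t (s (own_before t q) = 1) q) = (z - dvec h, h)" by simp
  moreover have "fst (strand_prev t (s (own_before t q) = 1) q) = z"
    using \<open>(z, g) = _\<close> by (metis fst_conv)
  ultimately show ?thesis using tp(3) cz unfolding strand_def by simp
qed

lemma strand_enter: "strand ty q t \<Longrightarrow> ty (strand_in (fst q) (rot (snd q))) = end_type t"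
  by (simp add: strand_def edge_def strand_in_def)

lemma strand_centre:
  assumes "strand ty q t"
  shows "s (fst q) = -1"
proof -
  have "ty (nx s (edge q)) = end_type t" using assms typedD(2)[OF ty] by (simp only: strand_def)
  moreover have "fst (nx s (edge q)) = fst q" by (simp add: nx_def edge_def)
  ultimately show ?thesis using type_sign(3)[of "nx s (edge q)" t 0] assms by (simp add: strand_def)
qed

lemma strand_leave: "strand ty (x, d) t \<Longrightarrow> ty (strand_in (x + dvec d) d) = end_type t"
proof -
  assume *: "strand ty (x, d) t"
  have "s x = -1" using strand_centre[OF *] by simp
  then have "nx s (edge (x, d)) = strand_in (x + dvec d) d"
    by (simp add: nx_def edge_def strand_in_def trn_def)
  then show ?thesis using * typedD(2)[OF ty] unfolding strand_def by metis
qed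

text \<open>At the negative centre a strand of type \<open>(1, 1)\<close> can only meet type
  \<open>(0, -1)\<close>, and one of type \<open>(2, -1)\<close> only \<open>(0, 1)\<close>. The
  partner demands the same positive sign at the foreign class, so all three foreign corners are
  positive, not only the one that the strand visits.\<close>

lemma strand_foreign:
  assumes "strand ty q t"
  shows "s (foreign t (fst q) d) = 1"
proof -
  obtain x e where q: "q = (x, e)" by (cases q)
  have x: "csum x mod 3 = 0 mod 3" using assms by (simp add: strand_def q)
  have t: "ty (strand_in x (rot e)) = end_type t" using strand_enter[OF assms] by (simp add: q)
  have sx: "s x = -1" using strand_centre[OF assms] by (simp add: q)
  note cp = compatible_all[OF ty, of x "rot e"]
  show ?thesis
  proof (cases t)
    case True
    have "sat (ty (strand_in x d)) 2 (s (x - dvec d))"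
      using typedD(5)[OF ty, of "strand_in x d" 2] csum_step(2)[OF x, of d] by (simp add: strand_in_def)
    then show ?thesis using cp[of d] t True sx x typedD(3,4)[OF ty, of "strand_in x d"]
      by (cases "ty (strand_in x d)")
        (auto simp: compatible_def meets_def plus_type_def end_type_def foreign_def q sat_def)
  next
    case False
    define d' where "d' = trn (- s x) d"
    have "nx s (nx s (strand_in x d')) = (x + dvec d, trn (s (x + dvec d)) d)"
      using sx by (simp add: nx_def strand_in_def d'_def trn_def)
    then have "ty (x + dvec d, trn (s (x + dvec d)) d) = ty (strand_in x d')"
      using typedD(2)[OF ty] by metis
    then have "sat (ty (strand_in x d')) 1 (s (x + dvec d))"
      using typedD(5)[OF ty, of "(x + dvec d, trn (s (x + dvec d)) d)" 1] csum_step(1)[OF x, of d] by simp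
    then show ?thesis using cp[of d'] t False sx x typedD(3,4)[OF ty, of "strand_in x d'"]
      by (cases "ty (strand_in x d')")
        (auto simp: compatible_def meets_def plus_type_def end_type_def foreign_def q sat_def)
  qed
qed

text \<open>The types \<open>(1, 1)\<close> and \<open>(2, -1)\<close> can only meet at class 1 or
  2, whereas the centre \<open>x\<close> has class 0.\<close>

lemma strand_exclusive: "strand ty (x, d) True \<Longrightarrow> strand ty (x, d') False \<Longrightarrow> False"
  using compatible_all[OF ty, of x "rot d" "rot d'"] strand_enter[of "(x, d)" True] strand_enter[of "(x, d')" False]
  by (auto simp: compatible_def meets_def plus_type_def end_type_def strand_def)

lemma strand_of_leave:
  assumes "csum x mod 3 = 0" "ty (strand_in (x + dvec d) d) = end_type t"
  shows "strand ty (x, d) t"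
proof -
  have "s x = -1" using type_sign(3)[OF assms(2)] assms(1) by (simp add: strand_in_def)
  then have "nx s (edge (x, d)) = strand_in (x + dvec d) d"
    by (simp add: nx_def edge_def strand_in_def trn_def)
  then have "ty (edge (x, d)) = end_type t" using assms(2) typedD(2)[OF ty] by metis
  then show ?thesis using assms(1) unfolding strand_def by simp
qed

lemma strand_before:
  "s w = 1 \<Longrightarrow> ty (edge (w + dvec (rot d), d)) = ty (strand_in w d)"
proof -
  assume "s w = 1"
  then have "nx s (strand_in w d) = edge (w + dvec (rot d), d)"
    by (simp add: nx_def edge_def strand_in_def trn_def)
  then show ?thesis using typedD(2)[OF ty] by metis
qed

text \<open>By \<open>hot_vertex\<close> all strands through \<open>v\<close> have one of the two
  types; they are named by the class 0 vertices from which they arrive. In \<open>hot_before\<close>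
  the strands through a vertex of class 2 are named by the class 0 vertices that they reach.\<close>

lemma hot_after:
  assumes "s v = 1" "csum v mod 3 = 1" "strand ty (v - dvec d, d) t"
  shows "\<exists>t'. strand ty (v - dvec d', d') t'"
proof -
  have "ty (strand_in v d) = end_type t" using strand_leave[OF assms(3)] by simp
  then obtain t' where t': "ty (strand_in v d') = end_type t'" using hot_vertex[OF ty assms(1)] assms(2) by blast
  have "csum (v - dvec d') mod 3 = 0" using csum_step(2)[of v 1 d'] assms(2) by simp
  then show ?thesis using strand_of_leave[of "v - dvec d'" d' t'] t' by auto
qed

lemma hot_before:
  assumes "s w = 1" "csum w mod 3 = 2" "strand ty (w + dvec (rot d), d) t"
  shows "\<exists>t'. strand ty (w + dvec (rot d'), d') t'"
proof -
  have "ty (strand_in w d) = end_type t" using assms(3) strand_before[OF assms(1)] by (simp add: strand_def)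
  then obtain t' where t': "ty (strand_in w d') = end_type t'" using hot_vertex[OF ty assms(1)] assms(2) by blast
  have "csum (w + dvec (rot d')) mod 3 = 0" using csum_step(1)[of w 2 "rot d'"] assms(2) by simp
  then show ?thesis using strand_before[OF assms(1), of d'] t' unfolding strand_def by auto
qed

end

text \<open>Refutation trees, found by a computer search. \<open>SB\<close> branches on the sign of a vertex, and \<open>TB\<close> on the
  type of a strand through a positive vertex that already lies on a strand of one of the two types,
  which leaves only these types; \<open>NX\<close> and \<open>PV\<close> follow a strand forwards and backwards. A branch is
  closed by a negative foreign corner (\<open>FO\<close>), or (\<open>WD\<close>) by \<open>n\<close> signs along a strand that do not occur
  in a folding sequence.\<close>

datatype cert =
    SB int int cert cert
  | TB int int dir cert cert
  | NX int int dir cert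
  | PV int int dir cert
  | FO int int dir dir
  | WD int int dir nat

type_synonym known_signs = "((int \<times> int) \<times> bool) list"
type_synonym known_strands = "(((int \<times> int) \<times> dir) \<times> bool) list"

text \<open>Reading ends with \<open>None\<close> at a vertex whose sign is not recorded, so only
  recorded signs enter a contradiction.\<close>

primrec word :: "known_signs \<Rightarrow> bool \<Rightarrow> nat \<Rightarrow> (int \<times> int) \<times> dir \<Rightarrow> bool list option" where
  "word S t 0 q = Some []"
| "word S t (Suc n) q = (case map_of S (own t q) of None \<Rightarrow> None
     | Some b \<Rightarrow> map_option ((#) b) (word S t n (strand_next t b q)))"

definition hot :: "known_signs \<Rightarrow> known_strands \<Rightarrow> int \<times> int \<Rightarrow> dir \<Rightarrow> bool" where
  "hot S Q x d \<longleftrightarrow>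
     (let v = x + dvec d in map_of S v = Some True \<and> list_ex (\<lambda>e. map_of Q (v - dvec e, e) \<noteq> None) [E0, E1, E2]) \<or>
     (let w = x - dvec (rot d) in map_of S w = Some True \<and> list_ex (\<lambda>e. map_of Q (w + dvec (rot e), e) \<noteq> None) [E0, E1, E2])"

lemma list_ex_dir: "list_ex p [E0, E1, E2] \<longleftrightarrow> (\<exists>e. p e)"
  by (simp, metis dir.exhaust)

lemma hotE:
  assumes "hot S Q x d"
  obtains e t where "map_of S (x + dvec d) = Some True" "map_of Q (x + dvec d - dvec e, e) = Some t"
  | e t where "map_of S (x - dvec (rot d)) = Some True" "map_of Q (x - dvec (rot d) + dvec (rot e), e) = Some t"
  using assms unfolding hot_def Let_def list_ex_dir by blast

text \<open>Success means that no typing agrees with the recorded signs \<open>S\<close> and strands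
  \<open>Q\<close>; this is \<open>check_sound\<close>.\<close>

primrec check :: "cert \<Rightarrow> known_signs \<Rightarrow> known_strands \<Rightarrow> bool" where
  "check (SB x y c c') S Q \<longleftrightarrow> check c (((x, y), True) # S) Q \<and> check c' (((x, y), False) # S) Q"
| "check (TB x y d c c') S Q \<longleftrightarrow> hot S Q (x, y) d \<and>
     check c S ((((x, y), d), True) # Q) \<and> check c' S ((((x, y), d), False) # Q)"
| "check (NX x y d c) S Q \<longleftrightarrow> (let q = ((x, y), d) in case map_of Q q of None \<Rightarrow> False
     | Some t \<Rightarrow> (case map_of S (own t q) of None \<Rightarrow> False | Some b \<Rightarrow> check c S ((strand_next t b q, t) # Q)))"
| "check (PV x y d c) S Q \<longleftrightarrow> (let q = ((x, y), d) in case map_of Q q of None \<Rightarrow> False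
     | Some t \<Rightarrow> (case map_of S (own_before t q) of None \<Rightarrow> False | Some b \<Rightarrow> check c S ((strand_prev t b q, t) # Q)))"
| "check (FO x y d e) S Q \<longleftrightarrow> (case map_of Q ((x, y), d) of None \<Rightarrow> False
     | Some t \<Rightarrow> map_of S (foreign t (x, y) e) = Some False)"
| "check (WD x y d n) S Q \<longleftrightarrow> (case map_of Q ((x, y), d) of None \<Rightarrow> False
     | Some t \<Rightarrow> (case word S t n ((x, y), d) of None \<Rightarrow> False | Some w \<Rightarrow> \<not> legal 3 w))"

context
  fixes s :: "int \<times> int \<Rightarrow> int" and ty
  assumes ty: "typed s ty"
begin

text \<open>\<open>E 0\<close> is the side entering the class 0 vertex, so this vertex starts
  \<open>E 1\<close>. The own vertex starts \<open>E 2\<close> or, for the type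
  \<open>(2, -1)\<close>, \<open>E 3\<close>, and then every third side.\<close>

lemma word_reads:
  assumes "\<And>x b. (x, b) \<in> set S \<Longrightarrow> b = (s x = 1)" "strand ty q t" "orbit s E" "E 0 = edge q" "word S t n q = Some w"
  shows "reads (\<lambda>k. s (fst (E (3 * k + (if t then 2 else 3))))) w"
  using assms(2-)
proof (induction n arbitrary: q E w)
  case (Suc n)
  obtain b w' where b: "map_of S (own t q) = Some b" and w': "word S t n (strand_next t b q) = Some w'"
    and w: "w = b # w'" using Suc.prems(4) by (auto split: option.splits)
  have bs: "b = (s (own t q) = 1)" using assms(1) map_of_SomeD[OF b] by blast
  note f = strand_forward[OF ty Suc.prems(1)]
  have e1: "E 1 = nx s (edge q)" using orbitD[OF Suc.prems(2), of 0] Suc.prems(3) by simp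
  have e2: "E 2 = nx s (nx s (edge q))" using orbitD[OF Suc.prems(2), of 1] e1 by simp
  have e3: "E 3 = nx s (nx s (nx s (edge q)))" using orbitD[OF Suc.prems(2), of 2] e2 by simp
  have "reads (\<lambda>k. s (fst (E (3 * k + (if t then 2 else 3) + 3)))) w'"
    using Suc.IH[OF strand_next[OF ty Suc.prems(1)] orbit_shift[OF Suc.prems(2), of 3]] w' f(1) e3 bs
    by simp
  moreover have "fst (E (if t then 2 else 3)) = own t q"
    using f(2,3) e2 e3 by (auto simp: own_def)
  ultimately show ?case using bs unfolding w reads_Cons by (simp add: algebra_simps)
qed simp

text \<open>The own vertices are those of class \<open>fst (end_type t)\<close>, on which a typing
  promises a folding sequence.\<close>

lemma word_legal:
  assumes "\<And>x b. (x, b) \<in> set S \<Longrightarrow> b = (s x = 1)" "strand ty q t" "word S t n q = Some w"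
  shows "legal m w"
proof -
  obtain E where E: "orbit s E" "E 0 = edge q" by (rule orbit_exists[OF typedD(1)[OF ty]])
  have "csum (fst (E 0)) mod 3 = 2 mod 3"
    using E(2) assms(2) csum_step(2)[of "fst q" 0 "rot (snd q)"] by (simp add: edge_def strand_def)
  from mod_add_cong[OF this refl, of "if t then 2 else 3"]
  have "csum (fst (E (if t then 2 else 3))) mod 3 = fst (end_type t)"
    using orbit_csum[OF E(1), of 0 "if t then 2 else 3"] by (cases t) (simp_all add: end_type_def)
  moreover have "ty (E 0) = end_type t" using assms(2) E(2) by (simp add: strand_def)
  ultimately have "FS {L. sign_sequence L} (\<lambda>k. s (fst (E (3 * k + (if t then 2 else 3)))))"
    using typedD(6)[OF ty E(1)] by metis
  then show ?thesis using word_reads[OF assms(1,2) E assms(3)] by (rule FS_legal)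
qed

lemma check_sound:
  assumes "check c S Q" "\<And>x b. (x, b) \<in> set S \<Longrightarrow> b = (s x = 1)" "\<And>q t. (q, t) \<in> set Q \<Longrightarrow> strand ty q t"
  shows False
  using assms
proof (induction c arbitrary: S Q)
  case (SB x y c c')
  show ?case
  proof (cases "s (x, y) = 1")
    case True
    show ?thesis by (rule SB.IH(1)[of "((x, y), True) # S" Q]) (use SB.prems True in auto)
  next
    case False
    show ?thesis by (rule SB.IH(2)[of "((x, y), False) # S" Q]) (use SB.prems False in auto)
  qed
next
  case (TB x y d c c')
  have hot: "hot S Q (x, y) d" using TB.prems(1) by simp
  have S: "s v = 1" if "map_of S v = Some True" for v using TB.prems(2) map_of_SomeD[OF that] by auto
  have Q: "strand ty q t" if "map_of Q q = Some t" for q t using TB.prems(3) map_of_SomeD[OF that] by auto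
  from hot have "\<exists>t. strand ty ((x, y), d) t"
  proof (cases rule: hotE)
    case (1 e t)
    note * = S[OF 1(1)] Q[OF 1(2)]
    have "csum ((x, y) + dvec d) mod 3 = 1"
      using csum_step(1)[of "(x, y) + dvec d - dvec e" 0 e] *(2)
      unfolding strand_def by (simp add: diff_add_cancel)
    from hot_after[OF ty *(1) this *(2), of d] show ?thesis by simp
  next
    case (2 e t)
    note * = S[OF 2(1)] Q[OF 2(2)]
    have "csum ((x, y) - dvec (rot d)) mod 3 = 2"
      using csum_step(2)[of "(x, y) - dvec (rot d) + dvec (rot e)" 0 "rot e"] *(2)
      unfolding strand_def by simp
    from hot_before[OF ty *(1) this *(2), of d] show ?thesis by simp
  qed
  then obtain t where t: "strand ty ((x, y), d) t" by blast
  show ?case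
  proof (cases t)
    case True
    show ?thesis by (rule TB.IH(1)[of S "(((x, y), d), True) # Q"]) (use TB.prems t True in auto)
  next
    case False
    show ?thesis by (rule TB.IH(2)[of S "(((x, y), d), False) # Q"]) (use TB.prems t False in auto)
  qed
next
  case (NX x y d c)
  let ?q = "((x, y), d)"
  obtain t b where *: "map_of Q ?q = Some t" "map_of S (own t ?q) = Some b" "check c S ((strand_next t b ?q, t) # Q)"
    using NX.prems(1) unfolding check.simps Let_def by (auto simp del: check.simps split: option.splits)
  have b: "b = (s (own t ?q) = 1)" by (rule NX.prems(2)[OF map_of_SomeD[OF *(2)]])
  have "strand ty ?q t" by (rule NX.prems(3)[OF map_of_SomeD[OF *(1)]])
  then have "strand ty (strand_next t b ?q) t" unfolding b by (rule strand_next[OF ty])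
  with NX.prems(3) have "strand ty q' t'" if "(q', t') \<in> set ((strand_next t b ?q, t) # Q)" for q' t'
    using that unfolding set_simps insert_iff prod.inject by blast
  with NX.prems(2) show ?case by (rule NX.IH[OF *(3)])
next
  case (PV x y d c)
  let ?q = "((x, y), d)"
  obtain t b where *: "map_of Q ?q = Some t" "map_of S (own_before t ?q) = Some b" "check c S ((strand_prev t b ?q, t) # Q)"
    using PV.prems(1) unfolding check.simps Let_def by (auto simp del: check.simps split: option.splits)
  have b: "b = (s (own_before t ?q) = 1)" by (rule PV.prems(2)[OF map_of_SomeD[OF *(2)]])
  have "strand ty ?q t" by (rule PV.prems(3)[OF map_of_SomeD[OF *(1)]])
  then have "strand ty (strand_prev t b ?q) t" unfolding b by (rule strand_prev[OF ty])
  with PV.prems(3) have "strand ty q' t'" if "(q', t') \<in> set ((strand_prev t b ?q, t) # Q)" for q' t'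
    using that unfolding set_simps insert_iff prod.inject by blast
  with PV.prems(2) show ?case by (rule PV.IH[OF *(3)])
next
  case (FO x y d e)
  obtain t where *: "map_of Q ((x, y), d) = Some t" "map_of S (foreign t (x, y) e) = Some False"
    using FO.prems(1) by (auto split: option.splits)
  have "strand ty ((x, y), d) t" using FO.prems(3) map_of_SomeD[OF *(1)] by blast
  from strand_foreign[OF ty this, of e] show ?case using FO.prems(2) map_of_SomeD[OF *(2)] by fastforce
next
  case (WD x y d n)
  obtain t w where *: "map_of Q ((x, y), d) = Some t" "word S t n ((x, y), d) = Some w" "\<not> legal 3 w"
    using WD.prems(1) by (auto split: option.splits)
  have "strand ty ((x, y), d) t" using WD.prems(3) map_of_SomeD[OF *(1)] by blast
  from word_legal[OF WD.prems(2) this *(2)] *(3) show ?case by blast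
qed

end

text \<open>One tree with root \<open>cert_15\<close>, cut into sixteen constants. The coordinates
  are absolute, in the frame where the mixed positive vertex is \<open>(1, 0)\<close>.\<close>

definition cert_0 :: cert where
  "cert_0 = SB (-2) (-5) (PV (-2) (-4) E0 (WD (-2) (-4) E2 6)) (SB (-5) (-5) (WD (-2) (-1) E1 5) (SB 0 (-4)
    (NX 0 (-3) E2 (NX 0 (-3) E0 (PV (-1) (-5) E1 (SB 2 (-3) (WD 1 (-1) E0 8) (PV 2 (-2) E0 (NX 2 (-2) E2 (NX 1
    (-4) E1 (TB 4 (-1) E1 (SB 4 (-2) (PV 3 (-3) E1 (WD 3 (-3) E0 5)) (FO 4 (-1) E1 E1)) (SB 4 (-2) (PV 3 (-3)
    E1 (WD 3 (-3) E0 5)) (SB (-1) (-6) (PV (-1) (-5) E0 (PV (-1) (-5) E2 (SB 1 (-5) (WD 0 (-3) E1 6) (NX 1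
    (-4) E2 (NX 0 (-6) E1 (SB 5 0 (PV 4 (-1) E1 (PV 4 (-1) E0 (SB 0 (-7) (NX 0 (-6) E2 (NX 0 (-6) E0 (SB 6
    (-1) (PV 5 (-2) E1 (SB 5 (-3) (PV 5 (-2) E0 (SB 2 (-6) (WD 5 (-2) E2 22) (NX 2 (-5) E2 (NX 1 (-7) E1 (SB 1
    (-8) (WD 0 (-6) E1 6) (NX 1 (-7) E2 (SB (-1) (-9) (WD 0 (-3) E1 13) (SB (-2) (-8) (WD 0 (-6) E1 9) (SB
    (-3) (-7) (PV (-3) (-6) E0 (SB (-4) (-6) (PV (-3) (-6) E2 (PV (-3) (-6) E1 (PV (-2) (-4) E2 (PV (-4) (-5)
    E0 (PV (-4) (-5) E2 (SB (-7) (-7) (TB (-4) (-2) E0 (SB (-5) (-2) (NX (-4) (-2) E0 (PV (-4) (-2) E0 (SB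
    (-4) (-1) (WD (-4) (-2) E1 3) (PV (-4) (-2) E2 (SB (-6) (-4) (NX (-5) (-4) E1 (NX (-5) (-4) E2 (SB (-6)
    (-7) (PV (-6) (-6) E0 (WD (-6) (-6) E2 25)) (SB (-7) (-6) (NX (-6) (-6) E1 (TB (-8) (-7) E0 (SB (-8) (-8)
    (WD (-5) (-4) E1 5) (FO (-8) (-7) E0 E1)) (NX (-8) (-7) E0 (SB (-8) (-8) (WD (-5) (-4) E1 5) (SB (-9) (-7)
    (WD (-2) (-1) E1 13) (TB (-7) (-5) E0 (SB (-8) (-5) (WD (-5) (-4) E1 8) (FO (-7) (-5) E0 E0)) (SB (-7)
    (-4) (NX (-7) (-5) E0 (SB (-8) (-5) (WD (-7) (-5) E1 3) (SB (-6) (-2) (SB (-7) (-3) (TB (-6) (-3) E1 (NX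
    (-6) (-3) E1 (NX (-6) (-3) E2 (WD (-6) (-3) E0 3))) (NX (-6) (-3) E1 (NX (-6) (-3) E2 (WD (-6) (-3) E0
    3)))) (WD (-8) (-7) E1 6)) (PV (-5) (-1) E0 (PV (-6) (-3) E1 (PV (-6) (-3) E0 (WD (-6) (-3) E2 6)))))))
    (FO (-7) (-5) E0 E1)))))))) (WD (-3) (-3) E2 6))))) (WD (-2) (-1) E1 8)))))) (FO (-4) (-2) E0 E0)) (SB
    (-4) (-1) (NX (-4) (-2) E0 (PV (-4) (-2) E0 (SB (-5) (-2) (WD (-4) (-2) E1 3) (NX (-4) (-2) E1 (PV (-4)
    (-2) E2 (SB (-4) 0 (NX (-5) (-1) E0 (TB (-3) 0 E0 (NX (-3) 0 E0 (TB (-4) 1 E0 (SB (-5) 1 (SB (-6) (-1) (NX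
    (-5) (-1) E1 (NX (-5) (-1) E2 (SB (-6) (-4) (PV (-6) (-3) E0 (SB (-7) (-3) (WD (-6) (-3) E1 8) (PV (-6)
    (-3) E2 (SB (-6) (-7) (PV (-6) (-6) E0 (WD (-6) (-6) E2 25)) (TB (-7) (-5) E1 (SB (-8) (-5) (PV (-8) (-4)
    E0 (WD (-8) (-4) E2 5)) (FO (-7) (-5) E1 E0)) (PV (-7) (-5) E1 (SB (-7) (-6) (SB (-8) (-5) (WD (-7) (-5)
    E1 3) (TB (-8) (-7) E1 (SB (-8) (-8) (WD (-5) (-4) E1 5) (FO (-8) (-7) E1 E1)) (SB (-8) (-8) (WD (-5) (-4)
    E1 5) (SB (-9) (-7) (WD (-2) (-1) E1 13) (WD (-8) (-7) E1 6))))) (WD (-3) (-3) E2 6)))))))) (WD (-1) (-2)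
    E0 16)))) (WD (-4) (-2) E0 5)) (FO (-4) 1 E0 E0)) (SB (-3) 1 (WD (-3) 0 E1 3) (FO (-4) 1 E0 E0)))) (NX
    (-3) 0 E0 (NX (-3) 0 E1 (WD (-3) 0 E2 3))))) (WD (-4) (-2) E2 6))))))) (FO (-4) (-2) E0 E1))) (FO (-6)
    (-6) E0 E2))))))) (PV (-3) (-6) E2 (WD (-5) (-7) E0 8)))) (WD 0 (-9) E1 5)))))))))) (PV 5 (-2) E0 (TB 7
    (-1) E2 (SB 7 (-2) (PV 6 (-3) E1 (WD 6 (-3) E0 5)) (FO 7 (-1) E2 E1)) (SB 7 0 (PV 7 (-1) E2 (SB 7 (-2) (PV
    6 (-3) E1 (WD 6 (-3) E0 5)) (TB 8 1 E2 (SB 8 0 (PV 7 (-1) E1 (WD 7 (-1) E0 13)) (FO 8 1 E2 E1)) (SB 8 0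
    (PV 7 (-1) E1 (WD 7 (-1) E0 13)) (TB 6 0 E2 (SB 7 1 (PV 8 1 E2 (WD 8 1 E1 8)) (FO 6 0 E2 E2)) (SB 6 1 (SB
    7 1 (PV 8 1 E2 (WD 8 1 E1 8)) (SB 5 2 (TB 5 1 E2 (NX 5 1 E2 (NX 5 1 E0 (WD 5 1 E1 3))) (NX 5 1 E2 (PV 5 1
    E2 (SB 6 2 (WD 5 1 E0 3) (WD 5 1 E1 6))))) (WD 3 0 E2 6))) (FO 6 0 E2 E1))))))) (FO 7 (-1) E2 E1)))))) (PV
    5 (-2) E1 (WD 6 0 E2 6))))) (WD 2 (-2) E2 5)))) (PV 4 (-1) E1 (PV 5 1 E2 (WD 5 1 E1 8))))))))) (PV (-1)
    (-5) E0 (WD 0 (-6) E1 5)))))))))))) (WD 2 (-2) E0 16)))"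

definition cert_1 :: cert where
  "cert_1 = SB (-4) (-3) (NX (-3) (-3) E1 (SB (-1) (-3) (NX 0 (-3) E1 (PV (-1) (-2) E0 (TB (-2) (-4) E0 (SB
    (-3) (-4) (WD (-1) (-2) E2 8) (FO (-2) (-4) E0 E0)) (SB (-3) (-4) (WD (-1) (-2) E2 8) (TB (-1) (-5) E1 (SB
    (-2) (-5) (PV (-2) (-4) E0 (WD (-2) (-4) E2 6)) (FO (-1) (-5) E1 E0)) (TB (-5) (-4) E1 (SB (-5) (-5) (WD
    (-2) (-1) E1 5) (FO (-5) (-4) E1 E1)) (SB (-5) (-3) (SB (-6) (-5) cert_0 (FO (-5) (-4) E1 E2)) (FO (-5)
    (-4) E1 E1)))))))) (SB (-3) (-4) (NX (-3) (-3) E2 (NX (-3) (-3) E0 (NX (-1) (-2) E2 (NX (-2) (-4) E1 (SB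
    (-2) (-5) (WD (-3) (-3) E1 6) (NX (-2) (-4) E2 (SB 2 (-3) (PV 2 (-2) E0 (PV 2 (-2) E2 (SB 0 (-4) (PV 0
    (-3) E0 (PV 0 (-3) E2 (PV (-2) (-4) E0 (PV (-1) (-5) E1 (SB (-4) (-6) (SB (-1) (-6) (PV (-1) (-5) E0 (WD
    (-1) (-5) E2 25)) (PV (-1) (-5) E0 (TB 1 (-4) E2 (SB 1 (-5) (PV 0 (-6) E1 (WD 0 (-6) E0 8)) (FO 1 (-4) E2
    E1)) (SB 2 (-4) (PV 1 (-4) E2 (PV 1 (-4) E1 (SB 1 (-5) (WD 1 (-4) E0 3) (PV 1 (-4) E0 (SB 3 (-4) (PV 2
    (-5) E1 (SB 2 (-6) (PV 2 (-5) E0 (WD 2 (-5) E2 16)) (PV 2 (-5) E0 (TB 4 (-4) E2 (SB 4 (-5) (PV 3 (-6) E1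
    (WD 3 (-6) E0 5)) (FO 4 (-4) E2 E1)) (SB 4 (-3) (SB 4 (-5) (PV 3 (-6) E1 (WD 3 (-6) E0 5)) (TB 3 (-3) E2
    (NX 3 (-3) E2 (NX 3 (-3) E0 (WD 3 (-3) E1 3))) (NX 3 (-3) E2 (TB 4 (-1) E2 (SB 4 (-2) (WD 3 (-3) E0 3) (FO
    4 (-1) E2 E1)) (PV 4 (-1) E2 (SB 4 (-2) (WD 3 (-3) E0 3) (SB 5 0 (PV 4 (-1) E1 (SB 5 (-3) (TB 6 0 E2 (SB 6
    (-1) (WD 4 (-1) E0 8) (FO 6 0 E2 E1)) (SB 6 1 (PV 6 0 E2 (SB 6 (-1) (WD 4 (-1) E0 8) (SB 5 2 (TB 5 1 E2
    (NX 5 1 E2 (NX 5 1 E0 (WD 5 1 E1 3))) (NX 5 1 E2 (PV 5 1 E2 (SB 7 1 (PV 6 0 E1 (WD 6 0 E0 6)) (SB 6 2 (WD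
    5 1 E0 3) (WD 5 1 E1 9)))))) (WD 3 0 E2 6)))) (FO 6 0 E2 E1))) (WD 4 (-1) E0 25))) (PV 4 (-1) E1 (PV 5 1
    E2 (WD 5 1 E1 5)))))))))) (FO 4 (-4) E2 E1)))))) (PV 2 (-5) E1 (WD 3 (-3) E2 6))))))) (FO 1 (-4) E2
    E0))))) (TB (-5) (-4) E1 (SB (-5) (-5) (WD (-3) (-3) E1 9) (FO (-5) (-4) E1 E1)) (SB (-5) (-3) (SB (-6)
    (-5) (PV (-5) (-4) E1 (SB (-5) (-5) (WD (-3) (-3) E1 9) (SB (-6) (-4) (NX (-5) (-4) E1 (TB (-7) (-5) E0
    (SB (-7) (-6) (WD (-2) (-1) E0 16) (FO (-7) (-5) E0 E1)) (SB (-7) (-4) (SB (-7) (-6) (WD (-2) (-1) E0 16)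
    (SB (-8) (-5) (WD (-5) (-4) E0 6) (TB (-4) (-2) E2 (SB (-5) (-2) (NX (-4) (-2) E2 (NX (-4) (-2) E0 (SB
    (-4) (-1) (WD (-4) (-2) E1 3) (SB (-7) (-3) (TB (-6) (-3) E0 (NX (-6) (-3) E0 (PV (-6) (-3) E0 (SB (-6)
    (-2) (WD (-6) (-3) E1 3) (WD (-6) (-3) E2 6)))) (NX (-6) (-3) E0 (NX (-6) (-3) E1 (WD (-6) (-3) E2 3))))
    (WD (-5) (-4) E0 9))))) (FO (-4) (-2) E2 E0)) (SB (-4) (-1) (NX (-4) (-2) E2 (NX (-4) (-2) E0 (SB (-5)
    (-2) (WD (-4) (-2) E1 3) (NX (-4) (-2) E1 (SB (-5) 0 (PV (-4) (-2) E2 (PV (-6) (-3) E0 (SB (-4) 0 (NX (-5)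
    (-1) E0 (SB (-7) (-3) (PV (-6) (-3) E2 (TB (-3) 0 E2 (NX (-3) 0 E2 (NX (-3) 0 E0 (TB (-4) 1 E2 (SB (-5) 1
    (SB (-6) (-1) (WD (-6) (-3) E1 8) (WD (-4) (-2) E0 5)) (FO (-4) 1 E2 E0)) (SB (-3) 1 (WD (-3) 0 E1 3) (FO
    (-4) 1 E2 E0))))) (NX (-3) 0 E2 (NX (-3) 0 E0 (WD (-3) 0 E1 3))))) (WD (-2) (-1) E0 25))) (WD (-4) (-2) E2
    6)))) (FO (-5) (-1) E0 E1)))))) (FO (-4) (-2) E2 E1))))) (FO (-7) (-5) E0 E1)))) (WD (-3) (-6) E1 5))))
    (FO (-5) (-4) E1 E2)) (FO (-5) (-4) E1 E1)))))))) (PV 0 (-3) E0 (WD 1 (-4) E1 9))))) (PV 2 (-2) E0 (TB 4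
    (-1) E2 (SB 4 (-2) (PV 3 (-3) E1 (WD 3 (-3) E0 5)) (FO 4 (-1) E2 E1)) (PV 4 (-1) E2 (SB 4 (-2) (PV 3 (-3)
    E1 (WD 3 (-3) E0 5)) (TB 5 1 E2 (SB 5 0 (PV 4 (-1) E1 (WD 4 (-1) E0 13)) (FO 5 1 E2 E1)) (PV 5 1 E2 (SB 5
    0 (PV 4 (-1) E1 (WD 4 (-1) E0 13)) (WD 5 1 E1 8))))))))))))))) (WD 0 (-3) E1 8)))) (NX (-3) (-3) E1 (SB
    (-4) (-1) (NX (-4) (-2) E0 (SB (-5) (-2) (WD (-2) (-1) E0 6) (NX (-4) (-2) E1 (SB (-5) 0 (SB (-6) (-2) (SB
    (-4) 0 (NX (-5) (-1) E0 (SB (-1) (-3) (NX 0 (-3) E1 (PV (-1) (-2) E0 (PV (-1) (-2) E2 (TB (-3) 0 E0 (NX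
    (-3) 0 E0 (TB (-4) 1 E0 (SB (-5) 1 (SB (-6) (-1) (NX (-5) (-1) E1 (NX (-5) (-1) E2 (SB (-7) (-4) (SB (-3)
    (-4) (PV (-3) (-3) E0 (PV (-3) (-3) E2 (TB (-4) (-5) E1 (SB (-5) (-5) (PV (-5) (-4) E0 (WD (-5) (-4) E2
    5)) (FO (-4) (-5) E1 E0)) (SB (-3) (-5) (PV (-4) (-5) E1 (SB (-5) (-5) (PV (-5) (-4) E0 (WD (-5) (-4) E2
    5)) (TB (-2) (-4) E2 (NX (-2) (-4) E2 (NX (-2) (-4) E0 (WD (-2) (-4) E1 3))) (PV (-2) (-4) E2 (PV (-2)
    (-4) E1 (TB (-1) (-5) E1 (SB (-2) (-5) (WD (-2) (-4) E0 3) (FO (-1) (-5) E1 E0)) (SB (-2) (-5) (WD (-2)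
    (-4) E0 3) (SB (-7) (-3) (NX (-6) (-3) E1 (SB (-6) (-4) (NX (-6) (-3) E2 (NX (-6) (-3) E0 (NX (-4) (-2) E2
    (NX (-5) (-4) E1 (NX (-5) (-4) E2 (SB (-4) (-6) (PV (-4) (-5) E0 (SB (-7) (-6) (WD (-4) (-5) E2 25) (TB
    (-8) (-4) E0 (SB (-8) (-5) (WD (-6) (-3) E1 9) (FO (-8) (-4) E0 E1)) (SB (-8) (-3) (SB (-9) (-5) (NX (-8)
    (-4) E0 (SB (-8) (-5) (WD (-6) (-3) E1 9) (SB (-9) (-4) (NX (-8) (-4) E1 (TB (-10) (-5) E0 (SB (-10) (-6)
    (WD (-5) (-1) E0 16) (FO (-10) (-5) E0 E1)) (SB (-10) (-4) (NX (-10) (-5) E0 (SB (-10) (-6) (WD (-5) (-1)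
    E0 16) (SB (-11) (-5) (WD (-8) (-4) E0 6) (TB (-7) (-2) E2 (SB (-8) (-2) (NX (-7) (-2) E2 (NX (-7) (-2) E0
    (SB (-7) (-1) (WD (-7) (-2) E1 3) (SB (-10) (-3) (TB (-9) (-3) E2 (NX (-9) (-3) E2 (NX (-9) (-3) E0 (SB
    (-9) (-2) (WD (-9) (-3) E1 3) (WD (-9) (-3) E2 6)))) (NX (-9) (-3) E2 (NX (-9) (-3) E0 (WD (-9) (-3) E1
    3)))) (WD (-8) (-4) E0 9))))) (FO (-7) (-2) E2 E0)) (SB (-7) (-1) (NX (-7) (-2) E2 (NX (-7) (-2) E0 (SB
    (-8) (-2) (WD (-7) (-2) E1 3) (NX (-7) (-2) E1 (SB (-8) 0 (PV (-7) (-2) E2 (PV (-9) (-3) E0 (SB (-7) 0 (NX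
    (-8) (-1) E0 (SB (-10) (-3) (PV (-9) (-3) E2 (TB (-6) 0 E0 (NX (-6) 0 E0 (TB (-7) 1 E2 (SB (-8) 1 (SB (-9)
    (-1) (WD (-9) (-3) E1 8) (WD (-7) (-2) E0 5)) (FO (-7) 1 E2 E0)) (SB (-6) 1 (WD (-6) 0 E1 3) (FO (-7) 1 E2
    E0)))) (NX (-6) 0 E0 (NX (-6) 0 E1 (WD (-6) 0 E2 3))))) (WD (-5) (-1) E0 25))) (WD (-7) (-2) E2 6)))) (FO
    (-8) (-1) E0 E1)))))) (FO (-7) (-2) E2 E1)))))) (FO (-10) (-5) E0 E1)))) (WD (-6) (-6) E1 5)))) (FO (-8)
    (-4) E0 E2)) (FO (-8) (-4) E0 E1))))) (SB 0 (-4) (PV (-1) (-5) E1 (SB 2 (-3) (WD 1 (-1) E0 8) (SB 1 (-5)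
    (WD 0 (-3) E1 6) (SB (-1) (-6) (PV (-1) (-5) E0 (WD (-1) (-5) E2 16)) (WD 1 (-1) E0 25))))) (WD 0 (-3) E2
    6)))))))) (WD (-3) (-3) E1 8))) (SB (-8) (-2) (WD (-5) (-1) E0 6) (TB (-6) 0 E0 (SB (-7) 0 (WD (-2) (-1)
    E0 13) (FO (-6) 0 E0 E0)) (NX (-6) 0 E0 (SB (-7) 0 (WD (-6) 0 E1 3) (WD (-5) (-1) E0 9))))))))))))) (FO
    (-4) (-5) E1 E0))))) (PV (-3) (-3) E0 (WD (-2) (-4) E1 9))) (FO (-6) (-3) E1 E2)))) (WD (-3) (-3) E1 5))
    (FO (-4) 1 E0 E0)) (SB (-3) 1 (WD (-3) 0 E1 3) (FO (-4) 1 E0 E0)))) (NX (-3) 0 E0 (NX (-3) 0 E1 (WD (-3) 0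
    E2 3))))))) (WD 1 (-1) E0 13))) (WD (-2) (-1) E0 9)) (FO (-5) (-1) E0 E2)) (FO (-5) (-1) E0 E1))))) (FO
    (-4) (-2) E0 E1)))"

definition cert_2 :: cert where
  "cert_2 = SB (-2) (-2) (PV (-2) (-1) E0 (SB (-1) (-3) (NX 0 (-3) E1 (SB (-3) (-1) (WD (-2) (-1) E1 3) (PV
    (-2) (-1) E2 (SB (-5) (-3) (TB (-1) (-2) E1 (PV (-1) (-2) E1 (TB (-2) (-4) E1 (SB (-2) (-5) (PV (-2) (-4)
    E1 (SB 0 (-4) (NX 0 (-3) E2 (NX 0 (-3) E0 (SB 2 (-3) (WD 1 (-1) E0 8) (PV 2 (-2) E0 (NX 2 (-2) E2 (SB 0
    (-5) (NX 1 (-4) E1 (TB 4 (-1) E2 (SB 4 (-2) (PV 3 (-3) E1 (WD 3 (-3) E0 5)) (FO 4 (-1) E2 E1)) (SB 4 0 (NX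
    3 0 E0 (PV 4 (-1) E2 (SB 3 1 (WD 3 0 E1 3) (SB (-2) (-3) (WD (-1) (-2) E0 3) (SB (-4) (-4) (SB (-3) (-5)
    (WD (-1) (-2) E0 8) (PV (-2) (-4) E0 (TB (-1) (-5) E1 (SB (-1) (-6) (PV (-1) (-5) E1 (SB 4 (-2) (PV 3 (-3)
    E1 (WD 3 (-3) E0 5)) (SB 1 (-5) (WD 0 (-3) E1 6) (NX 1 (-4) E2 (SB 5 0 (PV 4 (-1) E1 (PV 4 (-1) E0 (SB
    (-2) (-6) (PV (-3) (-6) E1 (WD (-3) (-6) E0 5)) (PV (-1) (-5) E0 (SB (-2) (-8) (SB 0 (-7) (SB 6 (-1) (PV 5
    (-2) E1 (SB 5 (-3) (PV 5 (-2) E0 (SB 2 (-6) (WD 5 (-2) E2 22) (SB 1 (-8) (WD 0 (-6) E1 6) (SB (-1) (-9)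
    (WD 0 (-3) E1 13) (WD 0 (-6) E1 9))))) (PV 5 (-2) E0 (TB 7 (-1) E2 (SB 7 (-2) (PV 6 (-3) E1 (WD 6 (-3) E0
    5)) (FO 7 (-1) E2 E1)) (SB 7 0 (PV 7 (-1) E2 (SB 7 (-2) (PV 6 (-3) E1 (WD 6 (-3) E0 5)) (TB 8 1 E2 (SB 8 0
    (PV 7 (-1) E1 (WD 7 (-1) E0 13)) (FO 8 1 E2 E1)) (SB 8 0 (PV 7 (-1) E1 (WD 7 (-1) E0 13)) (TB 6 0 E2 (SB 7
    1 (PV 8 1 E2 (WD 8 1 E1 8)) (FO 6 0 E2 E2)) (SB 6 1 (SB 7 1 (PV 8 1 E2 (WD 8 1 E1 8)) (SB 5 2 (TB 5 1 E0
    (NX 5 1 E0 (NX 5 1 E1 (WD 5 1 E2 3))) (PV 5 1 E0 (PV 5 1 E2 (SB 6 2 (WD 5 1 E0 3) (WD 5 1 E1 6))))) (WD 3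
    0 E2 6))) (FO 6 0 E2 E1))))))) (FO 7 (-1) E2 E1)))))) (PV 5 (-2) E1 (WD 6 0 E2 6))) (WD 2 (-2) E2 5)) (FO
    (-2) (-7) E1 E1)))))) (PV 4 (-1) E1 (PV 5 1 E2 (WD 5 1 E1 8)))))))) (FO (-1) (-5) E1 E1)) (SB (-2) (-6)
    (PV (-3) (-6) E1 (WD (-3) (-6) E0 5)) (FO (-1) (-5) E1 E2))))) (WD (-1) (-2) E1 5)))))) (FO 4 (-1) E2
    E1)))) (FO 1 (-4) E1 E2))))))) (WD 1 (-1) E1 5))) (FO (-2) (-4) E1 E1)) (SB (-2) (-3) (WD (-1) (-2) E0 3)
    (FO (-2) (-4) E1 E1)))) (NX (-1) (-2) E1 (NX (-1) (-2) E2 (WD (-1) (-2) E0 3)))) (FO (-4) (-2) E0 E2)))))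
    (WD 1 (-1) E0 6))) (PV (-2) (-1) E0 (SB (-2) (-3) (PV (-1) (-2) E1 (SB (-3) (-1) (NX (-2) (-1) E1 (NX (-2)
    (-1) E2 (SB 3 1 (PV 3 0 E2 (SB 2 2 (NX 1 2 E0 (SB 4 0 (WD 3 0 E0 3) (PV 3 0 E1 (SB 6 2 (TB 2 1 E0 (NX 2 1
    E0 (NX 2 1 E1 (WD 2 1 E2 3))) (PV 2 1 E0 (TB 3 3 E2 (SB 3 2 (WD 2 1 E0 3) (FO 3 3 E2 E1)) (SB 3 4 (PV 3 3
    E2 (TB 4 2 E2 (SB 3 2 (WD 2 1 E0 3) (FO 4 2 E2 E0)) (NX 4 2 E2 (SB 3 2 (WD 2 1 E0 3) (SB 1 3 (NX 1 2 E1
    (NX 1 2 E2 (TB (-2) 2 E0 (SB 5 3 (NX 4 2 E0 (NX 4 2 E1 (TB 4 5 E2 (SB 4 4 (WD 3 3 E0 8) (FO 4 5 E2 E1))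
    (SB (-1) 2 (WD (-1) 1 E1 8) (NX (-1) 1 E1 (SB 1 4 (NX 0 3 E0 (TB (-3) 0 E0 (SB (-3) 1 (PV (-2) 2 E0 (WD
    (-2) 2 E2 5)) (SB 4 4 (WD 3 3 E0 8) (SB 3 5 (PV 4 5 E2 (WD 4 5 E1 5)) (PV 4 5 E2 (SB 2 5 (PV 2 4 E0 (PV 2
    4 E2 (PV 2 4 E1 (SB 3 7 (SB (-4) (-1) (PV (-3) 0 E0 (PV (-3) 0 E2 (SB (-5) 1 (SB 0 4 (WD 1 2 E0 6) (NX 0 3
    E1 (SB (-5) 0 (PV (-4) 1 E0 (SB 1 6 (SB (-4) 2 (PV (-4) 1 E2 (SB (-1) 5 (WD (-4) 1 E1 22) (SB 0 7 (WD 1 5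
    E0 6) (SB 2 8 (WD 1 2 E0 13) (WD 1 5 E0 9))))) (PV (-4) 1 E2 (TB (-6) 0 E1 (SB (-6) (-1) (PV (-6) 0 E1 (SB
    (-6) 1 (PV (-5) 2 E0 (WD (-5) 2 E2 5)) (TB (-7) (-2) E1 (SB (-7) (-1) (PV (-6) 0 E0 (WD (-6) 0 E2 13)) (TB
    (-5) (-1) E2 (SB (-5) (-2) (PV (-5) (-1) E2 (PV (-5) (-1) E1 (SB (-6) (-2) (PV (-7) (-2) E1 (WD (-7) (-2)
    E0 8)) (PV (-5) (-1) E0 (SB (-4) (-3) (SB (-5) (-3) (TB (-4) (-2) E0 (NX (-4) (-2) E0 (NX (-4) (-2) E1 (WD
    (-4) (-2) E2 3))) (NX (-4) (-2) E0 (NX (-4) (-2) E1 (WD (-4) (-2) E2 3)))) (PV (-6) (-3) E1 (PV (-4) (-2)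
    E2 (PV (-4) (-2) E1 (WD (-4) (-2) E0 6))))) (WD (-2) (-1) E0 6)))))) (FO (-5) (-1) E2 E1)) (SB (-6) (-2)
    (PV (-7) (-2) E1 (WD (-7) (-2) E0 8)) (FO (-5) (-1) E2 E2)))) (SB (-7) (-1) (PV (-6) 0 E0 (WD (-6) 0 E2
    13)) (FO (-7) (-2) E1 E1))))) (FO (-6) 0 E1 E1)) (SB (-6) 1 (PV (-5) 2 E0 (WD (-5) 2 E2 5)) (FO (-6) 0 E1
    E1))))) (WD (-1) 1 E1 5))) (PV (-4) 1 E0 (WD (-5) (-1) E1 6))))) (FO (-4) 1 E0 E0)))) (PV (-3) 0 E0 (PV
    (-4) (-2) E1 (WD (-4) (-2) E0 8)))) (FO 3 6 E2 E1))))) (FO 2 4 E0 E1)))))) (SB (-3) 1 (PV (-2) 2 E0 (WD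
    (-2) 2 E2 5)) (FO (-3) 0 E0 E1)))) (FO 0 3 E0 E2))))))) (WD 2 1 E2 5)) (SB (-1) 2 (WD (-1) 1 E1 8) (FO
    (-2) 2 E0 E0))))) (WD 0 0 E0 5)))))) (FO 3 3 E2 E1))))) (FO 5 1 E2 E2))))) (WD 0 0 E2 6))) (PV 3 0 E2 (PV
    2 1 E0 (SB 4 0 cert_1 (WD 2 1 E2 5))))))) (WD (-1) (-2) E0 5))) (FO (-1) (-2) E1 E2)))"

definition cert_3 :: cert where
  "cert_3 = SB (-3) 1 (PV (-2) 2 E0 (WD (-2) 2 E2 5)) (SB 0 4 (WD 1 2 E0 6) (NX 0 3 E1 (SB 2 5 (NX 1 5 E0 (PV
    2 4 E2 (PV 2 4 E1 (SB 4 6 (WD 2 4 E1 8) (PV 4 5 E2 (PV 3 6 E0 (TB 6 6 E0 (SB 1 6 (NX 1 5 E1 (NX 1 5 E2 (SB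
    3 7 (PV 3 6 E2 (WD 3 6 E1 6)) (PV 3 6 E2 (SB 1 7 (PV 2 7 E0 (SB 6 7 (WD 3 3 E0 5) (SB 7 6 (NX 6 6 E0 (NX 6
    6 E1 (SB 2 8 (PV 2 7 E2 (PV 2 7 E1 (SB 8 8 (SB 4 9 (PV 4 8 E2 (SB 7 9 (WD 4 8 E1 22) (TB 9 9 E2 (NX 9 9 E2
    (SB 9 10 (WD 6 6 E0 5) (SB 10 9 (WD 3 3 E0 13) (TB 8 7 E2 (SB 8 6 (NX 8 7 E2 (SB 9 7 (WD 8 7 E0 3) (SB 7 4
    (TB 7 5 E1 (NX 7 5 E1 (NX 7 5 E2 (SB 8 5 (WD 7 5 E0 3) (WD 9 9 E0 6)))) (NX 7 5 E1 (NX 7 5 E2 (WD 7 5 E0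
    3)))) (PV 6 3 E1 (PV 7 5 E2 (PV 7 5 E1 (WD 7 5 E0 6))))))) (FO 8 7 E2 E1)) (SB 9 7 (WD 6 6 E0 8) (FO 8 7
    E2 E0)))))) (SB 9 10 (WD 6 6 E0 5) (FO 9 9 E2 E1))))) (PV 4 8 E2 (PV 3 9 E0 (SB 3 10 (PV 3 9 E2 (WD 3 9 E1
    6)) (PV 3 9 E2 (TB 1 8 E0 (SB 1 9 (PV 2 10 E0 (WD 2 10 E2 13)) (SB 0 7 (PV 1 8 E0 (WD 1 8 E2 9)) (SB (-1)
    5 (NX (-1) 4 E1 (SB (-2) 3 (NX (-1) 4 E2 (NX (-1) 4 E0 (NX 0 3 E2 (NX (-2) 2 E1 (NX (-2) 2 E2 (SB (-5) 1
    (TB (-2) (-1) E0 (SB (-2) (-2) (NX (-2) (-1) E0 (NX (-2) (-1) E1 (SB (-3) (-2) (WD (-2) (-1) E0 3) (PV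
    (-2) (-1) E0 (SB (-3) (-4) (NX (-2) (-1) E2 (SB (-2) (-3) (PV (-3) (-3) E1 (TB (-1) (-2) E0 (NX (-1) (-2)
    E0 (NX (-1) (-2) E1 (WD (-1) (-2) E2 3))) (TB (-2) (-4) E2 (SB (-1) (-3) (WD (-1) (-2) E0 3) (FO (-2) (-4)
    E2 E2)) (SB (-3) (-5) (SB (-4) (-4) (PV (-3) (-3) E0 (SB (-4) (-1) (NX (-4) (-2) E1 (PV (-3) 0 E0 (PV (-3)
    0 E2 (SB (-5) (-3) (WD (-3) (-3) E2 8) (SB (-4) 2 (WD (-3) 0 E2 25) (TB (-5) (-1) E0 (NX (-5) (-1) E0 (SB
    (-5) 0 (PV (-4) 1 E0 (PV (-4) 1 E2 (SB (-6) (-2) (WD (-2) (-1) E1 5) (TB (-6) 0 E0 (SB (-6) 1 (PV (-5) 2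
    E0 (WD (-5) 2 E2 5)) (SB (-7) (-1) (PV (-6) 0 E0 (WD (-6) 0 E2 13)) (WD (-4) (-2) E2 6))) (SB (-6) 1 (PV
    (-5) 2 E0 (WD (-5) 2 E2 5)) (FO (-6) 0 E0 E1)))))) (WD (-5) (-1) E1 6))) (SB (-6) (-2) (WD (-2) (-1) E1 5)
    (FO (-5) (-1) E0 E2)))))))) (WD (-3) (-3) E2 16))) (PV (-3) (-3) E0 (PV (-4) (-5) E1 (WD (-4) (-5) E0
    5)))) (FO (-2) (-4) E2 E2))))) (PV (-3) (-3) E1 (PV (-1) (-2) E2 (PV (-1) (-2) E1 (WD (-1) (-2) E0 6))))))
    (FO (-3) (-3) E1 E1)))))) (FO (-2) (-1) E0 E1)) (SB (-3) (-2) (SB (-2) (-2) (WD (-2) (-1) E0 3) (SB (-4)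
    (-1) (PV (-3) 0 E0 (PV (-3) 0 E2 (SB (-4) 2 (WD (-3) 0 E2 25) (SB (-5) 0 (PV (-4) 1 E0 (PV (-4) 1 E2 (TB
    (-6) 0 E1 (SB (-6) (-1) (PV (-6) 0 E1 (SB (-6) 1 (PV (-5) 2 E0 (WD (-5) 2 E2 5)) (TB (-7) (-2) E1 (SB (-7)
    (-1) (PV (-6) 0 E0 (WD (-6) 0 E2 13)) (TB (-5) (-1) E2 (SB (-5) (-2) (PV (-5) (-1) E2 (PV (-5) (-1) E1 (SB
    (-6) (-2) (PV (-7) (-2) E1 (WD (-7) (-2) E0 8)) (PV (-5) (-1) E0 (SB (-4) (-3) (SB (-5) (-3) (TB (-4) (-2)
    E2 (NX (-4) (-2) E2 (NX (-4) (-2) E0 (WD (-4) (-2) E1 3))) (NX (-4) (-2) E2 (NX (-4) (-2) E0 (WD (-4) (-2)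
    E1 3)))) (PV (-6) (-3) E1 (PV (-4) (-2) E2 (PV (-4) (-2) E1 (WD (-4) (-2) E0 6))))) (WD (-2) (-1) E0
    6)))))) (FO (-5) (-1) E2 E1)) (SB (-6) (-2) (PV (-7) (-2) E1 (WD (-7) (-2) E0 8)) (FO (-5) (-1) E2 E2))))
    (SB (-7) (-1) (PV (-6) 0 E0 (WD (-6) 0 E2 13)) (FO (-7) (-2) E1 E1))))) (FO (-6) 0 E1 E1)) (SB (-6) 1 (PV
    (-5) 2 E0 (WD (-5) 2 E2 5)) (FO (-6) 0 E1 E1))))) (PV (-4) 1 E0 (WD (-5) (-1) E1 6)))))) (PV (-3) 0 E0 (PV
    (-4) (-2) E1 (WD (-4) (-2) E0 8))))) (FO (-2) (-1) E0 E2))) (FO (-4) 1 E1 E0))))))) (WD (-1) 1 E1 8))) (WD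
    (-1) 4 E1 5)))) (SB 1 9 (PV 2 10 E0 (WD 2 10 E2 13)) (FO 1 8 E0 E1)))))))) (WD 4 5 E1 6)))) (PV 2 7 E2 (WD
    1 8 E0 5))))) (WD 3 3 E0 8)))) (FO 2 7 E0 E0)))))) (WD (-1) 1 E1 5)) (SB 6 7 (WD 3 3 E0 5) (FO 6 6 E0
    E1))))))))) (WD 0 0 E2 16))))"

definition cert_4 :: cert where
  "cert_4 = SB 5 3 (NX 5 4 E2 (SB 4 1 (PV 3 0 E1 (SB 6 5 (WD 5 4 E0 3) (NX 5 4 E0 (SB 8 5 (TB 4 2 E1 (NX 4 2
    E1 (NX 4 2 E2 (TB 5 1 E2 (SB 5 0 (TB 6 3 E1 (SB 3 (-1) (PV 3 0 E0 (PV 3 0 E2 (SB 5 2 (WD 4 2 E0 3) (SB 7 3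
    (PV 6 3 E1 (SB 1 (-2) (WD 3 0 E2 8) (PV 1 (-1) E0 (SB 3 (-2) (PV 2 (-2) E1 (SB 6 1 (WD 6 3 E0 8) (TB (-1)
    (-2) E0 (SB (-1) (-3) (WD 2 1 E1 5) (FO (-1) (-2) E0 E1)) (NX (-1) (-2) E0 (SB (-1) (-3) (WD 2 1 E1 5) (SB
    2 (-3) (PV 2 (-2) E0 (WD 2 (-2) E2 6)) (PV 2 (-2) E0 (SB 4 (-3) (TB 4 (-1) E1 (SB 4 (-2) (PV 3 (-3) E1 (NX
    4 (-1) E1 (NX 4 (-1) E2 (SB 5 (-1) (WD 4 (-1) E0 3) (NX 4 (-1) E0 (SB 5 (-3) (SB (-2) (-2) (NX (-1) (-2)
    E1 (NX (-1) (-2) E2 (SB 3 (-4) (PV 3 (-3) E0 (PV 3 (-3) E2 (SB (-3) (-4) (NX (-2) (-4) E1 (SB (-2) (-5)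
    (SB 0 (-4) (SB 1 (-5) (WD 3 0 E0 22) (PV 1 (-4) E0 (PV 2 (-5) E1 (SB 2 (-6) (PV 2 (-5) E0 (WD 2 (-5) E2
    6)) (PV 2 (-5) E0 (TB 4 (-4) E1 (SB 4 (-5) (PV 3 (-6) E1 (WD 3 (-6) E0 13)) (FO 4 (-4) E1 E1)) (PV 4 (-4)
    E1 (SB 4 (-5) (WD 4 (-4) E0 3) (WD 4 (-4) E0 9))))))))) (WD 1 (-1) E2 9)) (TB (-4) (-5) E1 (SB (-4) (-6)
    (WD (-1) (-2) E1 5) (FO (-4) (-5) E1 E1)) (SB (-4) (-4) (SB (-4) (-6) (WD (-1) (-2) E1 5) (SB (-5) (-5)
    (WD 2 1 E1 13) (TB (-3) (-3) E2 (SB (-4) (-3) (WD (-1) (-2) E1 8) (FO (-3) (-3) E2 E0)) (SB (-3) (-2) (NX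
    (-3) (-3) E2 (NX (-3) (-3) E0 (SB (-4) (-3) (WD (-3) (-3) E1 3) (TB (-2) (-1) E1 (NX (-2) (-1) E1 (NX (-2)
    (-1) E2 (WD (-2) (-1) E0 3))) (SB (-3) (-1) (WD (-2) (-1) E1 3) (WD (-4) (-5) E1 6)))))) (FO (-3) (-3) E2
    E1))))) (FO (-4) (-5) E1 E1))))) (WD 1 (-1) E2 6)))) (PV 3 (-3) E0 (PV 4 (-4) E1 (WD 4 (-4) E0 5)))))) (WD
    2 1 E1 8)) (FO 5 (-2) E2 E1))))))) (FO 4 (-1) E1 E1)) (SB 5 (-1) (WD 4 2 E2 5) (FO 4 (-1) E1 E0))) (FO 3
    (-3) E1 E0))))))))) (FO 2 (-2) E1 E0))))) (PV 6 3 E1 (PV 8 4 E2 (WD 8 4 E1 5))))))) (PV 3 0 E0 (PV 4 (-1)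
    E1 (WD 4 (-1) E0 5)))) (SB 5 2 (WD 4 2 E0 3) (FO 6 3 E1 E2))) (FO 5 1 E2 E1)) (SB 5 2 (WD 4 2 E0 3) (FO 5
    1 E2 E1))))) (NX 4 2 E1 (NX 4 2 E2 (WD 4 2 E0 3)))) (FO 7 5 E2 E0))))) (PV 3 0 E1 (PV 4 2 E2 (PV 4 2 E1
    (WD 4 2 E0 6)))))) (SB 6 5 (PV 5 4 E1 (PV 5 4 E0 (SB (-1) 2 (PV (-1) 1 E2 (PV (-1) 1 E1 (SB 1 3 (WD (-1) 1
    E1 8) (PV 1 2 E2 (PV 0 3 E0 (SB 0 4 (PV 0 3 E2 (WD 0 3 E1 6)) (PV 0 3 E2 (SB 4 6 (NX 4 5 E1 (NX 4 5 E2 (SB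
    2 5 (NX 2 4 E1 (NX 2 4 E2 (NX 0 3 E1 (NX 1 5 E0 (SB (-2) 3 (PV (-1) 4 E0 (SB 1 6 (WD (-1) 4 E2 25) (TB 3 6
    E2 (SB 4 7 (NX 3 6 E2 (NX 3 6 E0 (SB 3 7 (WD 4 5 E1 8) (NX 3 6 E1 (SB 5 8 (SB 4 9 (WD 3 3 E0 16) (TB 6 9
    E2 (SB 6 8 (TB 5 7 E0 (PV 5 7 E0 (SB 6 10 (WD 3 6 E0 5) (TB 6 6 E2 (NX 6 6 E2 (SB 6 7 (WD 5 7 E0 3) (SB 7
    6 (NX 6 6 E0 (NX 6 6 E1 (SB 7 9 (TB 8 7 E2 (SB 8 6 (SB 8 8 (WD 7 8 E0 8) (SB 7 4 (TB 7 5 E1 (NX 7 5 E1 (NX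
    7 5 E2 (SB 9 7 (WD 6 6 E2 6) (SB 8 5 (WD 7 5 E0 3) (WD 6 6 E2 9))))) (NX 7 5 E1 (NX 7 5 E2 (WD 7 5 E0
    3)))) (PV 6 3 E1 (PV 7 5 E2 (PV 7 5 E1 (WD 7 5 E0 6)))))) (FO 8 7 E2 E1)) (SB 8 8 (WD 7 8 E0 8) (FO 8 7 E2
    E1))) (WD 3 3 E0 25)))) (WD 5 7 E2 5)))) (SB 6 7 (WD 5 7 E0 3) (FO 6 6 E2 E1))))) (NX 5 7 E0 (NX 5 7 E1
    (WD 5 7 E2 3)))) (FO 6 9 E2 E1)) (SB 6 10 (WD 3 6 E0 5) (FO 6 9 E2 E1)))) (WD 1 5 E1 6)))))) (FO 3 6 E2
    E2)) (SB 3 7 (WD 4 5 E1 8) (FO 3 6 E2 E1))))) (PV (-1) 4 E0 (PV (-2) 2 E1 (TB (-3) 0 E0 (SB (-4) 0 (SB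
    (-3) (-1) (SB (-3) 1 (PV (-2) 2 E0 (WD (-2) 2 E2 9)) (SB (-4) (-1) (PV (-3) 0 E0 (PV (-3) 0 E2 (TB (-5)
    (-1) E1 (SB (-5) (-2) (PV (-5) (-1) E1 (SB (-5) 0 (PV (-4) 1 E0 (WD (-4) 1 E2 16)) (TB (-6) (-3) E1 (SB
    (-6) (-2) (PV (-5) (-1) E0 (WD (-5) (-1) E2 6)) (TB (-2) (-1) E0 (SB (-2) (-2) (SB (-3) (-2) (WD (-2) (-1)
    E0 3) (PV (-2) (-1) E0 (SB (-3) (-4) (SB (-2) (-3) (PV (-3) (-3) E1 (SB (-5) (-3) (TB (-1) (-2) E2 (NX
    (-1) (-2) E2 (NX (-1) (-2) E0 (WD (-1) (-2) E1 3))) (PV (-1) (-2) E2 (PV (-1) (-2) E1 (TB (-2) (-4) E2 (SB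
    (-1) (-3) (WD (-1) (-2) E0 3) (FO (-2) (-4) E2 E2)) (SB (-3) (-5) (SB (-4) (-4) (WD (-2) (-1) E0 8) (PV
    (-3) (-3) E0 (PV (-4) (-5) E1 (WD (-4) (-5) E0 5)))) (FO (-2) (-4) E2 E2)))))) (WD (-3) (-3) E0 25))) (PV
    (-3) (-3) E1 (PV (-1) (-2) E2 (PV (-1) (-2) E1 (WD (-1) (-2) E0 6))))) (FO (-3) (-3) E1 E1)))) (FO (-2)
    (-1) E0 E1)) (SB (-3) (-2) (SB (-2) (-2) (WD (-2) (-1) E0 3) (SB (-5) (-3) (TB (-4) (-2) E1 (NX (-4) (-2)
    E1 (NX (-4) (-2) E2 (WD (-4) (-2) E0 3))) (PV (-4) (-2) E1 (SB (-4) (-3) (WD (-4) (-2) E0 3) (WD (-2) (-1)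
    E0 6)))) (PV (-6) (-3) E1 (PV (-4) (-2) E2 (PV (-4) (-2) E1 (WD (-4) (-2) E0 9)))))) (FO (-2) (-1) E0
    E2)))) (SB (-6) (-2) (PV (-5) (-1) E0 (WD (-5) (-1) E2 6)) (FO (-6) (-3) E1 E1))))) (FO (-5) (-1) E1 E1))
    (SB (-5) 0 (PV (-4) 1 E0 (WD (-4) 1 E2 16)) (FO (-5) (-1) E1 E1))))) (PV (-3) 0 E0 (WD (-4) (-2) E1 5))))
    (FO (-3) 0 E0 E1)) (FO (-3) 0 E0 E0)) (SB (-3) 1 (PV (-2) 2 E0 (WD (-2) 2 E2 9)) (FO (-3) 0 E0
    E1)))))))))) (WD 1 2 E1 9)))) (SB 6 7 (WD 3 3 E0 5) (SB 7 6 (WD 0 0 E0 13) (WD 3 3 E0 8))))))))))) (PV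
    (-1) 1 E2 (SB 1 3 (NX 1 2 E1 (NX 1 2 E2 (NX (-1) 1 E1 (NX 0 3 E0 (PV 2 4 E0 (TB (-3) 0 E0 (SB (-3) (-1)
    cert_3 (FO (-3) 0 E0 E1)) (SB (-3) 1 (PV (-2) 2 E0 (WD (-2) 2 E2 5)) (FO (-3) 0 E0 E1)))))))) (WD (-2) 2
    E0 8)))))) (PV 5 4 E1 (PV 6 6 E2 (WD 6 6 E1 5))))"

definition cert_5 :: cert where
  "cert_5 = SB (-2) (-3) (PV (-3) (-3) E1 (TB (-1) (-2) E1 (NX (-1) (-2) E1 (NX (-1) (-2) E2 (WD (-1) (-2) E0
    3))) (PV (-1) (-2) E1 (TB (-2) (-4) E1 (SB (-1) (-3) (WD (-1) (-2) E0 3) (FO (-2) (-4) E1 E2)) (SB (-3)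
    (-5) (SB (-4) (-4) (PV (-3) (-3) E0 (PV (-3) (-3) E2 (SB 1 3 (NX 1 2 E1 (NX 1 2 E2 (SB (-1) 2 (NX (-1) 1
    E1 (NX (-1) 1 E2 (SB (-4) 0 (TB (-2) 2 E0 (NX (-2) 2 E0 (SB (-3) 1 (WD 1 2 E1 5) (SB (-5) (-3) (PV (-4)
    (-2) E0 (SB (-4) (-1) (PV (-4) (-2) E2 (PV (-4) (-2) E1 (PV (-2) (-1) E2 (PV (-3) 0 E0 (PV (-3) 0 E2 (SB
    (-2) 3 (TB (-5) (-1) E1 (PV (-5) (-1) E1 (SB (-5) 0 (PV (-4) 1 E0 (WD (-4) 1 E2 25)) (TB (-6) (-3) E0 (SB
    (-6) (-4) (SB (-6) (-2) (PV (-5) (-1) E0 (WD (-5) (-1) E2 9)) (SB (-7) (-4) (PV (-6) (-3) E0 (PV (-6) (-3)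
    E2 (TB (-8) (-4) E0 (SB (-8) (-5) (SB (-8) (-3) (PV (-7) (-2) E0 (WD (-7) (-2) E2 16)) (SB (-9) (-5) (PV
    (-8) (-4) E0 (WD (-8) (-4) E2 6)) (PV (-8) (-4) E0 (TB (-5) (-4) E1 (SB (-5) (-5) (PV (-5) (-4) E1 (SB
    (-6) (-5) (WD (-5) (-4) E0 3) (PV (-5) (-4) E0 (SB (-5) (-6) (PV (-6) (-6) E1 (SB (-8) (-6) (TB (-4) (-5)
    E2 (NX (-4) (-5) E2 (NX (-4) (-5) E0 (WD (-4) (-5) E1 3))) (PV (-4) (-5) E2 (PV (-4) (-5) E1 (TB (-5) (-7)
    E1 (SB (-4) (-6) (WD (-4) (-5) E0 3) (FO (-5) (-7) E1 E2)) (SB (-6) (-8) (SB (-7) (-7) (WD (-5) (-4) E0 8)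
    (PV (-6) (-6) E0 (PV (-7) (-8) E1 (WD (-7) (-8) E0 5)))) (FO (-5) (-7) E1 E2)))))) (WD (-6) (-6) E0 25)))
    (PV (-6) (-6) E1 (PV (-4) (-5) E2 (PV (-4) (-5) E1 (WD (-4) (-5) E0 6)))))))) (FO (-5) (-4) E1 E1)) (SB
    (-6) (-5) (PV (-5) (-4) E1 (SB (-5) (-5) (WD (-5) (-4) E0 3) (SB (-8) (-6) (TB (-7) (-5) E1 (NX (-7) (-5)
    E1 (NX (-7) (-5) E2 (WD (-7) (-5) E0 3))) (PV (-7) (-5) E1 (SB (-7) (-6) (WD (-7) (-5) E0 3) (WD (-5) (-4)
    E0 6)))) (PV (-9) (-6) E1 (PV (-7) (-5) E2 (PV (-7) (-5) E1 (WD (-7) (-5) E0 9))))))) (FO (-5) (-4) E1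
    E2)))))) (FO (-8) (-4) E0 E1)) (SB (-8) (-3) (PV (-7) (-2) E0 (WD (-7) (-2) E2 16)) (FO (-8) (-4) E0
    E1))))) (PV (-6) (-3) E0 (WD (-7) (-5) E1 5)))) (FO (-6) (-3) E0 E1)) (SB (-6) (-2) (PV (-5) (-1) E0 (WD
    (-5) (-1) E2 9)) (FO (-6) (-3) E0 E1))))) (SB (-5) 0 (PV (-4) 1 E0 (WD (-4) 1 E2 25)) (FO (-5) (-1) E1
    E1))) (TB 0 3 E0 (SB 1 4 (NX 0 3 E0 (SB 0 4 (WD 1 2 E1 8) (NX 0 3 E1 (SB 2 5 (SB 1 6 (WD 0 0 E0 16) (TB 3
    6 E2 (SB 3 5 (SB 3 7 (WD 0 3 E0 5) (TB 2 4 E2 (NX 2 4 E2 (TB 3 3 E2 (NX 3 3 E2 (SB 3 4 (WD 2 4 E0 3) (SB 4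
    3 (NX 3 3 E0 (NX 3 3 E1 (SB 4 6 (TB 5 4 E2 (SB 5 3 (SB 5 5 (WD 4 5 E0 8) (SB 4 1 (SB 6 4 (WD 3 3 E2 6) (TB
    4 2 E2 (NX 4 2 E2 (SB 5 2 (WD 4 2 E0 3) (WD 3 3 E2 9))) (NX 4 2 E2 (NX 4 2 E0 (WD 4 2 E1 3))))) (PV 3 0 E1
    (PV 4 2 E2 (PV 4 2 E1 (WD 4 2 E0 6)))))) (FO 5 4 E2 E1)) (SB 5 5 (WD 4 5 E0 8) (FO 5 4 E2 E1))) (WD 0 0 E0
    25)))) (WD 2 4 E2 5)))) (SB 3 4 (WD 2 4 E0 3) (FO 3 3 E2 E1)))) (NX 2 4 E2 (NX 2 4 E0 (WD 2 4 E1 3)))))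
    (FO 3 6 E2 E1)) (SB 3 7 (WD 0 3 E0 5) (FO 3 6 E2 E1)))) (WD (-2) 2 E1 6))))) (FO 0 3 E0 E2)) (SB 0 4 (WD 1
    2 E1 8) (FO 0 3 E0 E1))))))))) (PV (-4) (-2) E2 (WD (-5) (-1) E0 8)))) (PV (-4) (-2) E0 (PV (-5) (-4) E1
    (SB (-6) (-5) (PV (-5) (-4) E0 (WD (-5) (-4) E2 6)) (PV (-5) (-4) E0 (TB (-4) (-5) E1 (PV (-4) (-5) E1 (SB
    (-5) (-6) (PV (-6) (-6) E1 (WD (-6) (-6) E0 13)) (WD (-4) (-5) E0 9))) (SB (-5) (-6) (PV (-6) (-6) E1 (WD
    (-6) (-6) E0 13)) (FO (-4) (-5) E1 E2)))))))))) (SB (-3) 1 (WD 1 2 E1 5) (FO (-2) 2 E0 E2))) (FO (-3) 0 E1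
    E0)))) (WD (-2) (-1) E1 9)))) (SB 3 4 (WD 0 0 E0 5) (SB 4 3 (WD (-3) (-3) E0 13) (WD 0 0 E0 8)))))) (PV
    (-3) (-3) E0 (PV (-4) (-5) E1 (WD (-4) (-5) E0 5)))) (FO (-2) (-4) E1 E2)))))) (PV (-3) (-3) E1 (PV (-1)
    (-2) E2 (PV (-1) (-2) E1 (WD (-1) (-2) E0 9))))"

definition cert_6 :: cert where
  "cert_6 = SB 2 0 (PV 1 (-1) E1 (SB 1 (-2) (WD 1 (-1) E0 3) (PV 1 (-1) E0 (SB 3 (-2) (NX 1 (-1) E2 (SB (-1)
    (-4) (SB (-2) 0 (PV (-1) 1 E0 (TB (-2) (-1) E0 (SB (-2) (-2) (SB (-1) (-3) (SB (-3) (-2) (WD (-2) (-1) E0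
    3) (TB (-1) (-2) E1 (PV (-1) (-2) E1 (SB (-2) (-3) (WD (-1) (-2) E0 3) (WD (-1) (-2) E0 6))) (NX (-1) (-2)
    E1 (NX (-1) (-2) E2 (WD (-1) (-2) E0 3))))) (WD 1 (-1) E0 6)) (FO (-2) (-1) E0 E1)) (SB (-3) (-2) (NX (-2)
    (-1) E0 (SB 3 (-1) (PV 2 (-2) E1 (TB 3 0 E0 (SB 4 1 (PV 3 0 E0 cert_2) (FO 3 0 E0 E2)) (SB 3 1 (SB 2 2 (SB
    4 1 (WD 3 0 E0 3) (TB 2 1 E0 (NX 2 1 E0 (NX 2 1 E1 (WD 2 1 E2 3))) (PV 2 1 E0 (PV 2 1 E2 (SB 3 2 (WD 2 1
    E0 3) (WD 2 1 E1 6)))))) (WD 0 0 E2 6)) (FO 3 0 E0 E1)))) (PV 2 (-2) E1 (SB 3 1 (PV 3 0 E2 (SB 2 2 (SB 4 1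
    (PV 3 0 E1 (WD 3 0 E0 6)) (TB 2 1 E0 (NX 2 1 E0 (NX 2 1 E1 (WD 2 1 E2 3))) (PV 2 1 E0 (PV 2 1 E2 (SB 3 2
    (WD 2 1 E0 3) (WD 2 1 E1 9)))))) (WD 0 0 E2 6))) (FO 3 0 E2 E1))))) (FO (-2) (-1) E0 E2)))) (PV (-1) 1 E0
    (SB (-2) (-2) (PV (-2) (-1) E1 (SB (-1) (-3) (SB (-3) (-2) (PV (-2) (-1) E0 (WD (-2) (-1) E2 6)) (TB (-1)
    (-2) E1 (PV (-1) (-2) E1 (SB (-2) (-3) (WD (-1) (-2) E0 3) (WD (-1) (-2) E0 9))) (NX (-1) (-2) E1 (NX (-1)
    (-2) E2 (WD (-1) (-2) E0 3))))) (WD 1 (-1) E0 6))) (FO (-2) (-1) E1 E1)))) (FO 0 (-3) E1 E2))) (FO 2 (-2)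
    E1 E0))))) (PV 1 (-1) E1 (SB 3 1 (SB 2 2 (NX 1 2 E0 (PV 2 1 E2 (SB 3 2 (PV 2 1 E1 (PV 2 1 E0 (SB 4 0 (SB
    (-2) 0 (PV (-1) 1 E0 (TB 3 3 E2 (SB 4 4 (NX 3 3 E2 (SB 3 4 (PV 3 3 E2 (SB 1 3 (NX 1 2 E1 (NX 1 2 E2 (SB
    (-1) 2 (WD (-1) 1 E1 8) (NX (-1) 1 E1 (SB 1 4 (NX 0 3 E0 (TB 4 2 E2 (SB 4 1 (NX 4 2 E2 (SB 4 3 (WD 3 3 E0
    3) (PV 3 3 E1 (SB 0 4 (WD 1 2 E0 6) (NX 0 3 E1 (SB 2 6 (SB 5 2 (NX 4 2 E0 (NX 4 2 E1 (SB 2 5 (TB 2 4 E0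
    (NX 2 4 E0 (NX 2 4 E1 (WD 2 4 E2 3))) (TB 4 5 E0 (SB 3 5 (WD 2 4 E0 3) (FO 4 5 E0 E0)) (SB 5 5 (PV 5 4 E2
    (PV 4 5 E0 (TB 6 3 E2 (SB 6 2 (NX 6 3 E2 (SB 6 4 (WD 5 4 E0 8) (PV 5 4 E1 (SB 3 5 (WD 2 4 E0 3) (SB 5 6
    (NX 4 5 E0 (NX 4 5 E1 (TB 6 6 E2 (NX 6 6 E2 (SB 7 3 (WD 4 2 E2 6) (NX 6 3 E0 (SB 4 7 (WD 3 6 E0 8) (NX 3 6
    E0 (SB 6 7 (PV 6 6 E2 (NX 5 7 E2 (SB 7 6 (WD 6 6 E0 3) (PV 6 6 E1 (SB 9 8 (SB 6 1 (NX 7 2 E2 (SB 6 8 (WD 4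
    5 E2 6) (NX 5 7 E0 (SB 8 8 (PV 8 7 E2 (SB 7 9 (TB 5 1 E1 (NX 5 1 E1 (NX 5 1 E2 (WD 5 1 E0 3))) (PV 5 1 E1
    (TB 6 0 E1 (SB 5 0 (WD 5 1 E0 3) (FO 6 0 E1 E0)) (SB 7 0 (SB 8 2 (NX 7 2 E0 (NX 7 2 E1 (SB 9 4 (NX 8 4 E0
    (SB 8 5 (NX 8 4 E1 (NX 8 4 E2 (NX 6 3 E1 (NX 7 5 E0 (NX 7 5 E1 (SB 9 7 (WD 8 7 E0 22) (PV 8 7 E1 (TB 9 9
    E0 (PV 9 9 E0 (SB 10 9 (PV 10 8 E2 (WD 10 8 E1 5)) (SB 9 10 (PV 9 9 E2 (WD 9 9 E1 13)) (PV 9 9 E2 (PV 8 10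
    E0 (WD 8 10 E2 8)))))) (SB 10 9 (PV 10 8 E2 (WD 10 8 E1 5)) (FO 9 9 E0 E0)))))))))) (WD 5 4 E0 8))) (SB 10
    3 (WD 7 2 E2 6) (TB 8 1 E1 (NX 8 1 E1 (NX 8 1 E2 (SB 9 1 (WD 8 1 E0 3) (WD 7 2 E2 9)))) (SB 9 1 (WD 4 2 E2
    13) (FO 8 1 E1 E0))))))) (WD 5 4 E0 5)) (FO 6 0 E1 E0))))) (FO 7 8 E2 E1))) (FO 7 8 E2 E0))))) (WD 4 2 E2
    9)) (FO 8 7 E2 E2)))))) (FO 5 7 E2 E0))))))) (SB 7 6 (PV 7 5 E2 (WD 7 5 E1 5)) (FO 6 6 E2 E0))))) (NX 4 5
    E0 (SB 7 6 (PV 7 5 E2 (WD 7 5 E1 5)) (FO 6 6 E2 E0)))))))) (FO 6 3 E2 E1)) (SB 6 4 (WD 5 4 E0 8) (FO 6 3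
    E2 E1))))) (FO 4 5 E0 E0)))) (WD 1 2 E0 9)))) (WD 3 3 E2 5)) (FO 1 5 E0 E2))))))) (FO 4 2 E2 E1)) (SB 4 3
    (WD 3 3 E0 3) (FO 4 2 E2 E1)))) (FO 0 3 E0 E2)))))) (WD 0 0 E0 5))) (PV 3 3 E2 (SB 4 3 (NX 3 3 E0 (NX 3 3
    E1 (SB 5 6 (SB 5 5 (NX 4 5 E0 (TB 5 4 E2 (SB 5 3 (NX 5 4 E2 (PV 5 4 E2 (SB 4 1 (SB 6 4 (WD 5 4 E0 3) (TB 4
    2 E0 (SB 5 2 (WD 4 2 E0 3) (WD 5 4 E1 6)) (NX 4 2 E0 (NX 4 2 E1 (WD 4 2 E2 3))))) (PV 3 0 E1 (PV 4 2 E2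
    (PV 4 2 E1 (WD 4 2 E0 6))))))) (FO 5 4 E2 E1)) (SB 6 4 (PV 5 4 E2 cert_4) (FO 5 4 E2 E0)))) (NX 4 5 E0 (SB
    5 3 (SB 4 1 (SB 6 4 (WD 3 3 E2 6) (TB 4 2 E2 (NX 4 2 E2 (SB 5 2 (WD 4 2 E0 3) (WD 3 3 E2 9))) (NX 4 2 E2
    (NX 4 2 E0 (WD 4 2 E1 3))))) (PV 3 0 E1 (PV 4 2 E2 (PV 4 2 E1 (WD 4 2 E0 6))))) (FO 5 4 E2 E1)))) (FO 4 5
    E0 E2)))) (SB 1 3 (PV 2 4 E0 (WD 2 4 E2 5)) (WD 0 0 E0 8)))))) (FO 3 3 E2 E2)) (SB 3 4 (NX 3 3 E2 (PV 3 3
    E2 (SB 1 3 (NX 1 2 E1 (NX 1 2 E2 (SB (-1) 2 (WD (-1) 1 E1 8) (NX (-1) 1 E1 (SB 1 4 (SB 4 4 (WD 3 3 E0 3)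
    (PV 3 3 E1 (SB 0 4 (WD 1 2 E0 6) (SB 3 5 (TB 2 4 E1 (SB 2 5 (WD 2 4 E1 3) (WD 1 2 E0 9)) (NX 2 4 E1 (NX 2
    4 E2 (WD 2 4 E0 3)))) (PV 4 5 E2 (PV 2 4 E0 (PV 2 4 E2 (WD 2 4 E1 6)))))))) (FO 0 3 E0 E2)))))) (WD 0 0 E0
    5)))) (FO 3 3 E2 E1)))) (PV (-1) 1 E0 (SB (-2) (-2) (PV (-2) (-1) E1 (SB (-3) (-2) (PV (-2) (-1) E0 (WD
    (-2) (-1) E2 6)) (PV (-2) (-1) E0 (SB (-4) (-3) (SB (-3) (-4) cert_5 (FO (-3) (-3) E1 E1)) (FO (-3) (-3)
    E1 E0))))) (FO (-2) (-1) E1 E1)))) (FO 3 0 E1 E0)))) (PV 2 1 E1 (PV 3 3 E2 (WD 3 3 E1 5)))))) (FO 2 1 E2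
    E1)) (FO 2 1 E2 E0)))"

definition cert_7 :: cert where
  "cert_7 = PV 2 4 E0 (SB (-4) (-1) (PV (-3) 0 E0 (WD (-3) 0 E2 5)) (TB 5 4 E0 (SB 0 4 (NX 0 3 E1 (NX 0 3 E2
    (SB 2 5 (PV 2 4 E2 (WD 2 4 E1 6)) (PV 2 4 E2 (SB 0 5 (PV 1 5 E0 (SB 5 5 (WD 2 1 E0 5) (SB 6 4 (NX 5 4 E0
    (NX 5 4 E1 (SB 1 6 (PV 1 5 E2 (PV 1 5 E1 (SB 7 6 (SB 3 7 (PV 3 6 E2 (SB 6 7 (WD 3 6 E1 22) (TB 8 7 E2 (NX
    8 7 E2 (SB 8 8 (WD 5 4 E0 5) (SB 9 7 (WD 2 1 E0 13) (TB 7 5 E2 (SB 7 4 (NX 7 5 E2 (SB 8 5 (WD 7 5 E0 3)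
    (SB 6 2 (SB 7 3 (TB 6 3 E1 (NX 6 3 E1 (NX 6 3 E2 (WD 6 3 E0 3))) (NX 6 3 E1 (NX 6 3 E2 (WD 6 3 E0 3))))
    (WD 8 7 E0 6)) (PV 5 1 E1 (PV 6 3 E2 (PV 6 3 E1 (WD 6 3 E0 6))))))) (FO 7 5 E2 E1)) (SB 8 5 (WD 5 4 E0 8)
    (FO 7 5 E2 E0)))))) (SB 8 8 (WD 5 4 E0 5) (FO 8 7 E2 E1))))) (PV 3 6 E2 (PV 2 7 E0 (SB 2 8 (PV 2 7 E2 (WD
    2 7 E1 6)) (PV 2 7 E2 (TB 0 6 E0 (SB 0 7 (PV 1 8 E0 (WD 1 8 E2 13)) (SB (-1) 5 (PV 0 6 E0 (WD 0 6 E2 9))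
    (SB (-2) 3 (NX (-2) 2 E1 (SB (-3) 1 (NX (-2) 2 E2 (NX (-2) 2 E0 (NX (-1) 1 E2 (NX (-3) 0 E1 (NX (-3) 0 E2
    (SB (-6) (-1) (TB (-3) (-3) E1 (SB (-3) (-4) (NX (-3) (-3) E1 (PV (-3) (-3) E1 (SB (-4) (-4) (WD (-3) (-3)
    E0 3) (PV (-3) (-3) E0 (SB (-4) (-6) (NX (-3) (-3) E2 (SB (-3) (-5) (PV (-4) (-5) E1 (TB (-2) (-4) E0 (NX
    (-2) (-4) E0 (NX (-2) (-4) E1 (WD (-2) (-4) E2 3))) (TB (-3) (-6) E2 (SB (-2) (-5) (WD (-2) (-4) E0 3) (FO
    (-3) (-6) E2 E2)) (SB (-4) (-7) (SB (-5) (-6) (PV (-4) (-5) E0 (SB (-5) (-3) (NX (-5) (-4) E1 (PV (-4)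
    (-2) E0 (PV (-4) (-2) E2 (SB (-5) 0 (WD (-4) (-2) E2 25) (SB (-6) (-5) (WD (-4) (-5) E2 8) (TB (-6) (-3)
    E0 (NX (-6) (-3) E0 (SB (-6) (-2) (PV (-5) (-1) E0 (PV (-5) (-1) E2 (SB (-7) (-4) (WD (-3) (-3) E1 5) (TB
    (-7) (-2) E1 (PV (-7) (-2) E1 (SB (-7) (-1) (PV (-6) 0 E0 (WD (-6) 0 E2 5)) (SB (-8) (-3) (PV (-7) (-2) E0
    (WD (-7) (-2) E2 13)) (WD (-5) (-4) E2 6)))) (SB (-7) (-1) (PV (-6) 0 E0 (WD (-6) 0 E2 5)) (FO (-7) (-2)
    E1 E1)))))) (WD (-6) (-3) E1 6))) (SB (-7) (-4) (WD (-3) (-3) E1 5) (FO (-6) (-3) E0 E2)))))))) (WD (-4)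
    (-5) E2 16))) (PV (-4) (-5) E0 (PV (-5) (-7) E1 (WD (-5) (-7) E0 5)))) (FO (-3) (-6) E2 E2))))) (PV (-4)
    (-5) E1 (PV (-2) (-4) E2 (PV (-2) (-4) E1 (WD (-2) (-4) E0 6)))))) (FO (-4) (-5) E1 E1)))))) (FO (-3) (-3)
    E1 E1)) (SB (-4) (-4) (PV (-3) (-3) E1 (SB (-3) (-4) (WD (-3) (-3) E0 3) (SB (-5) (-3) (PV (-4) (-2) E0
    (PV (-4) (-2) E2 (SB (-5) 0 (WD (-4) (-2) E2 25) (SB (-6) (-2) (PV (-5) (-1) E0 (PV (-5) (-1) E2 (TB (-7)
    (-2) E0 (SB (-7) (-3) (SB (-7) (-1) (PV (-6) 0 E0 (WD (-6) 0 E2 5)) (TB (-8) (-4) E1 (SB (-8) (-3) (PV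
    (-7) (-2) E0 (WD (-7) (-2) E2 13)) (TB (-6) (-3) E2 (SB (-6) (-4) (PV (-6) (-3) E2 (PV (-6) (-3) E1 (SB
    (-7) (-4) (PV (-8) (-4) E1 (WD (-8) (-4) E0 8)) (PV (-6) (-3) E0 (SB (-5) (-5) (SB (-6) (-5) (TB (-5) (-4)
    E2 (NX (-5) (-4) E2 (NX (-5) (-4) E0 (WD (-5) (-4) E1 3))) (NX (-5) (-4) E2 (NX (-5) (-4) E0 (WD (-5) (-4)
    E1 3)))) (PV (-7) (-5) E1 (PV (-5) (-4) E2 (PV (-5) (-4) E1 (WD (-5) (-4) E0 6))))) (WD (-3) (-3) E0
    6)))))) (FO (-6) (-3) E2 E1)) (SB (-7) (-4) (PV (-8) (-4) E1 (WD (-8) (-4) E0 8)) (FO (-6) (-3) E2 E2))))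
    (SB (-8) (-3) (PV (-7) (-2) E0 (WD (-7) (-2) E2 13)) (FO (-8) (-4) E1 E1)))) (FO (-7) (-2) E0 E1)) (SB
    (-7) (-1) (PV (-6) 0 E0 (WD (-6) 0 E2 5)) (FO (-7) (-2) E0 E1))))) (PV (-5) (-1) E0 (WD (-6) (-3) E1
    6)))))) (PV (-4) (-2) E0 (PV (-5) (-4) E1 (WD (-5) (-4) E0 8)))))) (FO (-3) (-3) E1 E2))) (FO (-5) (-1) E1
    E0))))))) (WD (-2) (-1) E1 8))) (WD (-2) 2 E1 5)))) (SB 0 7 (PV 1 8 E0 (WD 1 8 E2 13)) (FO 0 6 E0
    E1)))))))) (WD 3 3 E1 6)))) (PV 1 5 E2 (WD 0 6 E0 5))))) (WD 2 1 E0 8)))) (FO 1 5 E0 E0)))))) (WD (-2)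
    (-1) E1 5)) (SB 5 5 (WD 2 1 E0 5) (FO 5 4 E0 E1))))"

definition cert_8 :: cert where
  "cert_8 = SB 4 1 (NX 4 2 E2 (SB 3 (-1) (PV 2 (-2) E1 (SB 5 3 (WD 4 2 E0 3) (NX 4 2 E0 (SB 7 3 (TB 3 0 E2 (NX
    3 0 E2 (TB 4 (-1) E2 (SB 4 (-2) (NX 4 (-1) E2 (TB 5 1 E1 (SB 4 0 (WD 3 0 E0 3) (SB 2 (-3) (PV 2 (-2) E0
    (PV 2 (-2) E2 (TB (-1) (-5) E1 (SB 0 (-4) (WD 2 (-2) E2 8) (FO (-1) (-5) E1 E2)) (SB 6 1 (PV 5 1 E1 (TB 5
    (-2) E2 (SB 0 (-4) (WD 2 (-2) E2 8) (PV 0 (-3) E0 (SB 2 (-4) (PV 1 (-4) E1 (SB (-2) (-5) (WD 1 (-1) E1 5)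
    (NX (-1) (-5) E1 (NX (-2) (-4) E0 (SB 5 (-1) (WD 5 1 E0 8) (SB 4 (-3) (WD 3 0 E2 5) (NX 5 (-2) E2 (SB 3
    (-4) (NX 3 (-3) E1 (NX 3 (-3) E2 (NX 3 (-3) E0 (SB 4 (-5) (SB (-3) (-4) (NX (-2) (-4) E1 (NX (-2) (-4) E2
    (SB (-4) (-7) (SB 1 (-5) (PV 1 (-4) E0 (WD 1 (-4) E2 6)) (PV 1 (-4) E0 (PV 2 (-5) E1 (SB (-4) (-6) (NX
    (-3) (-6) E1 (SB 2 (-6) (PV 2 (-5) E0 (PV 2 (-5) E2 (SB (-3) (-7) (SB (-1) (-6) (SB 0 (-7) (WD 2 (-2) E0
    22) (PV 0 (-6) E0 (PV 1 (-7) E1 (SB 1 (-8) (PV 1 (-7) E0 (WD 1 (-7) E2 6)) (PV 1 (-7) E0 (TB 3 (-6) E2 (SB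
    3 (-7) (PV 2 (-8) E1 (WD 2 (-8) E0 13)) (FO 3 (-6) E2 E1)) (PV 3 (-6) E2 (PV 3 (-6) E1 (SB 3 (-7) (WD 3
    (-6) E0 3) (WD 3 (-6) E0 9)))))))))) (WD 0 (-3) E2 9)) (TB (-5) (-7) E0 (SB (-5) (-8) (WD (-2) (-4) E1 5)
    (FO (-5) (-7) E0 E1)) (NX (-5) (-7) E0 (SB (-5) (-8) (WD (-2) (-4) E1 5) (SB (-6) (-7) (WD 1 (-1) E1 13)
    (TB (-4) (-5) E1 (SB (-5) (-5) (WD (-2) (-4) E1 8) (FO (-4) (-5) E1 E0)) (SB (-4) (-4) (SB (-5) (-5) (WD
    (-4) (-5) E1 3) (TB (-3) (-3) E0 (NX (-3) (-3) E0 (NX (-3) (-3) E1 (WD (-3) (-3) E2 3))) (NX (-3) (-3) E0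
    (SB (-4) (-3) (WD (-3) (-3) E1 3) (WD (-5) (-7) E1 6))))) (FO (-4) (-5) E1 E1)))))))))) (PV 2 (-5) E0 (PV
    3 (-6) E1 (WD 3 (-6) E0 5))))) (WD 0 (-3) E2 6))))) (FO (-3) (-6) E1 E2)))) (WD 1 (-1) E1 8)) (FO 4 (-4)
    E2 E1))))) (FO 3 (-3) E1 E1))))))))) (FO 1 (-4) E1 E0)))) (SB 5 (-1) (WD 5 1 E0 8) (FO 5 (-2) E2 E1))))
    (PV 5 1 E1 (PV 7 2 E2 (WD 7 2 E1 5))))))) (PV 2 (-2) E0 (PV 3 (-3) E1 (WD 3 (-3) E0 5))))) (SB 4 0 (WD 3 0
    E0 3) (FO 5 1 E1 E2)))) (FO 4 (-1) E2 E1)) (SB 4 0 (WD 3 0 E0 3) (FO 4 (-1) E2 E1)))) (NX 3 0 E2 (NX 3 0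
    E0 (WD 3 0 E1 3)))) (FO 6 3 E2 E0))))) (PV 2 (-2) E1 (PV 3 0 E2 (PV 3 0 E1 (WD 3 0 E0 6)))))) (SB 5 3 (PV
    4 2 E1 (PV 4 2 E0 (SB 0 1 (NX 0 0 E1 (NX 0 0 E2 (PV 1 2 E0 (SB (-2) 0 (WD (-2) (-1) E1 8) (PV (-2) (-1) E2
    (TB 0 3 E0 (TB (-4) (-2) E0 (SB (-4) (-3) (SB (-1) 2 (WD 0 0 E0 6) (SB 1 3 (NX 0 3 E0 (PV 1 2 E2 (PV 1 2
    E1 (SB 3 4 (WD 1 2 E1 8) (PV 3 3 E2 cert_7))))) (WD (-1) (-2) E2 16))) (FO (-4) (-2) E0 E1)) (SB (-4) (-1)
    (PV (-3) 0 E0 (WD (-3) 0 E2 5)) (FO (-4) (-2) E0 E1))) (SB (-1) 2 (WD 0 0 E0 6) (FO 0 3 E0 E2)))))))) (SB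
    (-2) 0 (PV (-2) (-1) E2 (PV (-2) (-1) E1 (PV 0 0 E2 (PV (-1) 1 E0 (SB (-1) 2 (PV (-1) 1 E2 (WD (-1) 1 E1
    6)) (PV (-1) 1 E2 (SB 3 4 (NX 3 3 E1 (NX 3 3 E2 (SB 1 3 (NX 1 2 E1 (NX 1 2 E2 (NX (-1) 1 E1 (NX 0 3 E0 (SB
    (-3) 1 (PV (-2) 2 E0 (SB 0 4 (WD (-2) 2 E2 25) (TB 2 4 E0 (SB 3 5 (NX 2 4 E0 (SB 2 5 (WD 3 3 E1 8) (NX 2 4
    E1 (SB 4 6 (SB 3 7 (WD 2 1 E0 16) (TB 5 7 E2 (SB 5 6 (TB 4 5 E0 (PV 4 5 E0 (TB 5 4 E0 (PV 5 4 E0 (SB 5 8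
    (WD 2 4 E0 5) (SB 5 5 (WD 4 5 E0 3) (SB 6 4 (NX 5 4 E0 (NX 5 4 E1 (SB 6 7 (TB 7 5 E2 (SB 7 4 (SB 7 6 (WD 6
    6 E0 8) (SB 6 2 (SB 8 5 (WD 5 4 E2 6) (TB 6 3 E1 (NX 6 3 E1 (NX 6 3 E2 (SB 7 3 (WD 6 3 E0 3) (WD 5 4 E2
    9)))) (NX 6 3 E1 (NX 6 3 E2 (WD 6 3 E0 3))))) (PV 5 1 E1 (PV 6 3 E2 (PV 6 3 E1 (WD 6 3 E0 6)))))) (FO 7 5
    E2 E1)) (SB 7 6 (WD 6 6 E0 8) (FO 7 5 E2 E1))) (WD 2 1 E0 25)))) (WD 4 5 E2 5))))) (SB 5 5 (WD 4 5 E0 3)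
    (FO 5 4 E0 E1)))) (NX 4 5 E0 (NX 4 5 E1 (WD 4 5 E2 3)))) (FO 5 7 E2 E1)) (SB 5 8 (WD 2 4 E0 5) (FO 5 7 E2
    E1)))) (WD 0 3 E1 6))))) (FO 2 4 E0 E2)) (SB 2 5 (WD 3 3 E1 8) (FO 2 4 E0 E1))))) (PV (-2) 2 E0 (PV (-3) 0
    E1 (TB (-4) (-2) E0 (SB (-5) (-2) (SB (-4) (-3) (SB (-4) (-1) (PV (-3) 0 E0 (WD (-3) 0 E2 9)) (SB (-5)
    (-3) (PV (-4) (-2) E0 (PV (-4) (-2) E2 (TB (-6) (-3) E1 (SB (-6) (-4) (PV (-6) (-3) E1 (SB (-6) (-2) (PV
    (-5) (-1) E0 (WD (-5) (-1) E2 16)) (SB (-7) (-4) (PV (-6) (-3) E0 (WD (-6) (-3) E2 6)) (PV (-6) (-3) E0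
    (TB (-3) (-3) E1 (SB (-3) (-4) (PV (-3) (-3) E1 (SB (-4) (-4) (WD (-3) (-3) E0 3) (PV (-3) (-3) E0 (SB
    (-4) (-6) (SB (-3) (-5) (PV (-4) (-5) E1 (SB (-6) (-5) (TB (-2) (-4) E0 (NX (-2) (-4) E0 (NX (-2) (-4) E1
    (WD (-2) (-4) E2 3))) (TB (-3) (-6) E2 (SB (-2) (-5) (WD (-2) (-4) E0 3) (FO (-3) (-6) E2 E2)) (SB (-4)
    (-7) (SB (-5) (-6) (WD (-3) (-3) E0 8) (PV (-4) (-5) E0 (PV (-5) (-7) E1 (WD (-5) (-7) E0 5)))) (FO (-3)
    (-6) E2 E2)))) (WD (-4) (-5) E0 25))) (PV (-4) (-5) E1 (PV (-2) (-4) E2 (PV (-2) (-4) E1 (WD (-2) (-4) E0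
    6))))) (FO (-4) (-5) E1 E1))))) (FO (-3) (-3) E1 E1)) (SB (-4) (-4) (PV (-3) (-3) E1 (SB (-3) (-4) (WD
    (-3) (-3) E0 3) (SB (-6) (-5) (TB (-5) (-4) E1 (NX (-5) (-4) E1 (NX (-5) (-4) E2 (WD (-5) (-4) E0 3))) (PV
    (-5) (-4) E1 (SB (-5) (-5) (WD (-5) (-4) E0 3) (WD (-3) (-3) E0 6)))) (PV (-7) (-5) E1 (PV (-5) (-4) E2
    (PV (-5) (-4) E1 (WD (-5) (-4) E0 9))))))) (FO (-3) (-3) E1 E2))))))) (FO (-6) (-3) E1 E1)) (SB (-6) (-2)
    (PV (-5) (-1) E0 (WD (-5) (-1) E2 16)) (FO (-6) (-3) E1 E1))))) (PV (-4) (-2) E0 (WD (-5) (-4) E1 5))))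
    (FO (-4) (-2) E0 E1)) (FO (-4) (-2) E0 E0)) (SB (-4) (-1) (PV (-3) 0 E0 (WD (-3) 0 E2 9)) (FO (-4) (-2) E0
    E1)))))))))) (WD 0 0 E1 9)))) (SB 5 5 (WD 2 1 E0 5) (SB 6 4 (WD (-1) (-2) E0 13) (WD 2 1 E0 8))))))))))
    (PV (-2) (-1) E2 (WD (-3) 0 E0 8)))))) (PV 4 2 E1 (PV 5 4 E2 (WD 5 4 E1 5))))"

definition cert_9 :: cert where
  "cert_9 = SB (-4) (-4) (PV (-3) (-3) E0 (WD (-3) (-3) E2 6)) (PV (-3) (-3) E0 (SB (-5) (-5) (SB (-4) (-6)
    (SB (-3) (-5) (PV (-4) (-5) E1 (TB (-2) (-4) E1 (NX (-2) (-4) E1 (NX (-2) (-4) E2 (WD (-2) (-4) E0 3)))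
    (PV (-2) (-4) E1 (TB (-3) (-6) E1 (SB (-2) (-5) (WD (-2) (-4) E0 3) (FO (-3) (-6) E1 E2)) (SB (-4) (-7)
    (NX (-3) (-6) E1 (SB (-5) (-6) (PV (-4) (-5) E0 (PV (-4) (-5) E2 (SB (-6) (-4) (SB 0 1 (NX 0 0 E1 (NX 0 0
    E2 (SB (-2) 0 (NX (-2) (-1) E1 (TB (-3) 0 E0 (NX (-3) 0 E0 (SB (-4) (-1) (WD 0 0 E1 5) (SB (-6) (-5) (PV
    (-5) (-4) E0 (SB (-5) (-3) (SB (-3) 1 (SB (-5) 0 (TB (-6) (-3) E0 (SB (-6) (-2) (WD (-5) (-4) E2 22) (TB
    (-7) (-5) E0 (SB (-7) (-6) (SB (-7) (-4) (PV (-6) (-3) E0 (WD (-6) (-3) E2 9)) (SB (-8) (-6) (PV (-7) (-5)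
    E0 (PV (-7) (-5) E2 (SB (-9) (-5) (PV (-8) (-4) E0 (WD (-8) (-4) E2 16)) (PV (-8) (-4) E0 (SB (-9) (-7)
    (PV (-9) (-6) E1 (SB (-10) (-7) (PV (-9) (-6) E0 (WD (-9) (-6) E2 6)) (PV (-9) (-6) E0 (TB (-6) (-6) E0
    (SB (-6) (-7) (SB (-7) (-7) (WD (-6) (-6) E0 3) (PV (-6) (-6) E0 (SB (-6) (-8) (PV (-7) (-8) E1 (SB (-9)
    (-8) (TB (-5) (-7) E0 (NX (-5) (-7) E0 (NX (-5) (-7) E1 (WD (-5) (-7) E2 3))) (TB (-6) (-9) E1 (SB (-5)
    (-8) (WD (-5) (-7) E0 3) (FO (-6) (-9) E1 E2)) (SB (-7) (-10) (SB (-8) (-9) (WD (-6) (-6) E0 8) (PV (-7)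
    (-8) E0 (PV (-8) (-10) E1 (WD (-8) (-10) E0 5)))) (FO (-6) (-9) E1 E2)))) (WD (-7) (-8) E0 25))) (PV (-7)
    (-8) E1 (PV (-5) (-7) E2 (PV (-5) (-7) E1 (WD (-5) (-7) E0 6))))))) (FO (-6) (-6) E0 E1)) (SB (-7) (-7)
    (SB (-6) (-7) (WD (-6) (-6) E0 3) (SB (-9) (-8) (TB (-8) (-7) E1 (NX (-8) (-7) E1 (NX (-8) (-7) E2 (WD
    (-8) (-7) E0 3))) (PV (-8) (-7) E1 (SB (-8) (-8) (WD (-8) (-7) E0 3) (WD (-6) (-6) E0 6)))) (PV (-10) (-8)
    E1 (PV (-8) (-7) E2 (PV (-8) (-7) E1 (WD (-8) (-7) E0 9)))))) (FO (-6) (-6) E0 E2)))))) (FO (-9) (-6) E1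
    E1)))))) (PV (-7) (-5) E0 (WD (-8) (-7) E1 5)))) (FO (-7) (-5) E0 E1)) (SB (-7) (-4) (PV (-6) (-3) E0 (WD
    (-6) (-3) E2 9)) (FO (-7) (-5) E0 E1)))) (SB (-6) (-2) (WD (-5) (-4) E2 22) (FO (-6) (-3) E0 E1))) (WD
    (-2) (-1) E2 6)) (TB (-1) 1 E0 (SB 0 2 (NX (-1) 1 E0 (SB (-1) 2 (WD 0 0 E1 8) (NX (-1) 1 E1 (SB 1 3 (SB 0
    4 (WD (-1) (-2) E0 16) (TB 2 4 E2 (SB 2 3 (SB 2 5 (WD (-1) 1 E0 5) (TB 1 2 E2 (NX 1 2 E2 (TB 2 1 E0 (PV 2
    1 E0 (SB 2 2 (WD 1 2 E0 3) (SB 3 1 (NX 2 1 E0 (NX 2 1 E1 (SB 3 4 (TB 4 2 E2 (SB 4 1 (SB 3 (-1) (SB 4 3 (WD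
    3 3 E0 8) (TB 3 0 E0 (SB 5 2 (WD 2 1 E2 6) (SB 4 0 (WD 3 0 E0 3) (WD 2 1 E2 9))) (NX 3 0 E0 (NX 3 0 E1 (WD
    3 0 E2 3))))) (PV 2 (-2) E1 (PV 3 0 E2 (PV 3 0 E1 (WD 3 0 E0 6))))) (FO 4 2 E2 E1)) (SB 4 3 (WD 3 3 E0 8)
    (FO 4 2 E2 E1))) (WD (-1) (-2) E0 25)))) (WD 1 2 E2 5)))) (SB 2 2 (WD 1 2 E0 3) (FO 2 1 E0 E1)))) (NX 1 2
    E2 (NX 1 2 E0 (WD 1 2 E1 3))))) (FO 2 4 E2 E1)) (SB 2 5 (WD (-1) 1 E0 5) (FO 2 4 E2 E1)))) (WD (-3) 0 E1
    6))))) (FO (-1) 1 E0 E2)) (SB (-1) 2 (WD 0 0 E1 8) (FO (-1) 1 E0 E1)))) (PV (-5) (-4) E2 (WD (-6) (-3) E0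
    8)))) (PV (-5) (-4) E0 (PV (-6) (-6) E1 (SB (-7) (-7) (PV (-6) (-6) E0 (WD (-6) (-6) E2 6)) (PV (-6) (-6)
    E0 (TB (-5) (-7) E1 (PV (-5) (-7) E1 (SB (-6) (-8) (PV (-7) (-8) E1 (WD (-7) (-8) E0 13)) (WD (-5) (-7) E0
    9))) (SB (-6) (-8) (PV (-7) (-8) E1 (WD (-7) (-8) E0 13)) (FO (-5) (-7) E1 E2)))))))))) (SB (-4) (-1) (WD
    0 0 E1 5) (FO (-3) 0 E0 E2)))) (WD (-3) (-3) E1 9)))) (SB 2 2 (WD (-1) (-2) E0 5) (SB 3 1 (WD (-4) (-5) E0
    13) (WD (-1) (-2) E0 8)))) (FO (-5) (-4) E0 E0)))) (PV (-4) (-5) E0 (PV (-5) (-7) E1 (WD (-5) (-7) E0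
    5))))) (FO (-3) (-6) E1 E2)))))) (PV (-4) (-5) E1 (PV (-2) (-4) E2 (PV (-2) (-4) E1 (WD (-2) (-4) E0
    9))))) (FO (-4) (-5) E1 E1)) (FO (-4) (-5) E1 E0)))"

definition cert_10 :: cert where
  "cert_10 = PV 1 (-1) E1 (SB 1 (-2) (WD 1 (-1) E0 3) (PV 1 (-1) E0 (SB 3 (-2) (NX 1 (-1) E2 (SB (-1) (-4) (NX
    0 (-3) E1 (SB (-2) (-3) (PV (-1) (-2) E0 (PV (-1) (-2) E2 (SB (-3) (-2) (PV (-2) (-1) E0 (TB 2 1 E2 (SB 3
    2 (NX 2 1 E2 (SB 2 2 (PV 2 1 E2 (SB 0 1 (NX 0 0 E1 (NX 0 0 E2 (SB (-2) 0 (WD (-2) (-1) E1 8) (NX (-2) (-1)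
    E1 (SB 0 2 (NX (-1) 1 E0 (SB 3 1 (WD 2 1 E0 3) (NX 2 1 E0 (NX 3 0 E2 (PV 2 1 E1 (SB 5 3 (SB (-1) 2 (WD 0 0
    E0 6) (NX (-1) 1 E1 (SB (-1) 3 (SB 1 4 (SB 4 0 (NX 3 0 E0 (NX 3 0 E1 (SB 1 3 (NX 0 3 E0 (TB 1 2 E0 (NX 1 2
    E0 (NX 1 2 E1 (WD 1 2 E2 3))) (TB 3 3 E0 (SB 2 3 (WD 1 2 E0 3) (FO 3 3 E0 E0)) (SB 4 3 (PV 4 2 E2 (PV 3 3
    E0 (TB 2 4 E2 (SB 2 3 (WD 1 2 E0 3) (FO 2 4 E2 E1)) (PV 2 4 E2 (SB 0 4 (SB 5 2 (WD 4 2 E0 8) (PV 4 2 E1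
    (SB 2 3 (WD 1 2 E0 3) (SB 4 4 (NX 3 3 E0 (NX 3 3 E1 (SB 3 5 (WD 2 4 E0 8) (NX 2 4 E0 (SB 5 5 (NX 4 5 E2
    (PV 2 4 E1 (TB 5 4 E0 (SB 6 5 (PV 5 4 E0 (PV 5 4 E2 (TB 1 5 E0 (SB 2 6 (PV 3 6 E2 (WD 3 6 E1 5)) (FO 1 5
    E0 E2)) (PV 1 5 E0 (SB 6 4 (WD 5 4 E0 3) (PV 5 4 E1 (SB 8 6 (SB 2 6 (PV 3 6 E2 (WD 3 6 E1 5)) (SB 5 6 (WD
    3 3 E2 6) (NX 4 5 E0 (SB 0 5 (PV 1 5 E2 (PV 1 5 E1 (SB 7 7 (SB 1 7 (PV 2 7 E2 (SB 3 8 (PV 2 7 E1 (SB 6 8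
    (WD 2 7 E0 22) (SB 8 9 (WD 6 6 E2 6) (SB 9 8 (WD 3 3 E2 13) (WD 6 6 E2 9))))) (PV 2 7 E1 (TB 1 8 E0 (SB 2
    9 (PV 3 9 E2 (WD 3 9 E1 5)) (FO 1 8 E0 E2)) (SB 0 7 (PV 1 8 E0 (SB 2 9 (PV 3 9 E2 (WD 3 9 E1 5)) (TB (-1)
    7 E0 (SB 0 8 (PV 1 8 E2 (WD 1 8 E1 13)) (FO (-1) 7 E0 E2)) (SB 0 8 (PV 1 8 E2 (WD 1 8 E1 13)) (TB 0 6 E0
    (SB (-1) 6 (PV (-1) 7 E0 (WD (-1) 7 E2 8)) (FO 0 6 E0 E0)) (SB (-1) 5 (NX 0 6 E0 (SB (-1) 6 (WD 0 6 E1 3)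
    (SB (-2) 3 (TB (-1) 4 E0 (NX (-1) 4 E0 (NX (-1) 4 E1 (WD (-1) 4 E2 3))) (NX (-1) 4 E0 (PV (-1) 4 E0 (SB
    (-2) 4 (WD (-1) 4 E1 3) (WD (-1) 4 E2 6))))) (WD 0 3 E0 6)))) (FO 0 6 E0 E2))))))) (FO 1 8 E0 E2)))))) (PV
    2 7 E2 (WD 0 6 E0 6))) (WD 2 4 E0 5)))) (PV 1 5 E2 (PV (-1) 4 E0 (WD (-1) 4 E2 8))))))) (FO 7 5 E2
    E2)))))))) (FO 5 4 E0 E2)) (SB 6 4 (PV 6 3 E2 (WD 6 3 E1 5)) (FO 5 4 E0 E0))))) (FO 4 5 E2 E0)))))) (NX 3
    3 E0 (SB 6 4 (PV 6 3 E2 (WD 6 3 E1 5)) (FO 5 4 E2 E0))))))) (WD (-2) (-1) E1 5)))))) (FO 3 3 E0 E0)))))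
    (WD 0 0 E0 9)))) (WD 2 1 E2 5)) (FO 0 3 E0 E2)) (FO 0 3 E0 E0)))) (FO 4 2 E2 E2))))))) (FO (-1) 1 E0
    E2)))))) (WD (-1) (-2) E0 5))) (PV 2 1 E2 (SB 0 2 (SB 3 1 (NX 2 1 E0 (NX 2 1 E1 (SB 4 4 (SB 4 3 (NX 3 3 E0
    (TB 4 2 E2 (SB 4 1 (NX 4 2 E2 (PV 4 2 E2 (SB 3 (-1) (SB 5 2 (WD 4 2 E0 3) (TB 3 0 E2 (NX 3 0 E2 (SB 4 0
    (WD 3 0 E0 3) (WD 4 2 E1 6))) (NX 3 0 E2 (NX 3 0 E0 (WD 3 0 E1 3))))) (PV 2 (-2) E1 (PV 3 0 E2 (PV 3 0 E1
    (WD 3 0 E0 6))))))) (FO 4 2 E2 E1)) (SB 5 2 (PV 4 2 E2 cert_8) (FO 4 2 E2 E0)))) (NX 3 3 E0 (SB 4 1 (SB 3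
    (-1) (SB 5 2 (WD 2 1 E2 6) (TB 3 0 E2 (NX 3 0 E2 (SB 4 0 (WD 3 0 E0 3) (WD 2 1 E2 9))) (NX 3 0 E2 (NX 3 0
    E0 (WD 3 0 E1 3))))) (PV 2 (-2) E1 (PV 3 0 E2 (PV 3 0 E1 (WD 3 0 E0 6))))) (FO 4 2 E2 E1)))) (FO 3 3 E0
    E2)))) (SB 0 1 (PV 1 2 E0 (WD 1 2 E2 5)) (WD (-1) (-2) E0 8))) (FO 1 2 E0 E0))))) (FO 2 1 E2 E2)) (SB 2 2
    (NX 2 1 E2 (PV 2 1 E2 (SB 0 1 (NX 0 0 E1 (NX 0 0 E2 (SB (-2) 0 (WD (-2) (-1) E1 8) (NX (-2) (-1) E1 (SB 0
    2 (SB 3 2 (WD 2 1 E0 3) (PV 2 1 E1 (SB 2 3 (SB (-1) 2 (WD 0 0 E0 6) (TB 1 2 E0 (NX 1 2 E0 (SB 1 3 (WD 1 2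
    E1 3) (WD 0 0 E0 9))) (NX 1 2 E0 (NX 1 2 E1 (WD 1 2 E2 3))))) (PV 3 3 E2 (PV 1 2 E0 (PV 1 2 E2 (WD 1 2 E1
    6))))))) (FO (-1) 1 E0 E2)))))) (WD (-1) (-2) E0 5)))) (FO 2 1 E2 E1)))) (PV (-2) (-1) E0 (SB (-3) (-4)
    (PV (-3) (-3) E1 cert_9) (FO (-3) (-3) E1 E1)))))) (PV (-1) (-2) E0 (PV (-2) (-4) E1 (WD (-2) (-4) E0
    5))))) (FO 0 (-3) E1 E2))) (FO 2 (-2) E1 E0))))"

definition cert_11 :: cert where
  "cert_11 = PV (-1) (-2) E0 (PV (-1) (-2) E2 (PV (-2) (-1) E0 (PV (-3) (-3) E1 (TB (-3) 0 E0 (SB (-2) 1 (NX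
    (-3) 0 E0 (SB (-4) (-1) (WD 0 0 E1 5) (SB (-4) (-4) (PV (-3) (-3) E0 (WD (-3) (-3) E2 6)) (PV (-3) (-3) E0
    (SB (-3) (-5) (PV (-4) (-5) E1 (NX (-2) (-4) E2 (NX (-2) (-4) E0 (SB (-2) (-6) (WD 0 (-3) E0 8) (PV (-1)
    (-5) E0 (NX (-1) (-5) E2 (NX (-3) (-6) E1 (TB 0 (-6) E1 (SB (-5) (-6) (PV (-4) (-5) E0 (PV (-4) (-5) E2
    (SB (-4) (-7) (WD (-2) (-4) E1 6) (NX (-3) (-6) E2 (NX (-5) (-7) E1 (SB (-1) (-7) (PV (-2) (-7) E1 (WD
    (-2) (-7) E0 5)) (SB 1 (-6) (PV 0 (-6) E1 (PV 0 (-6) E0 (SB (-6) (-8) (NX (-5) (-7) E2 (NX (-5) (-7) E0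
    (SB 0 (-8) (PV (-1) (-8) E1 (SB (-5) (-9) (SB (-3) (-8) (SB (-2) (-9) (WD 0 (-3) E0 22) (PV (-1) (-8) E0
    (TB 0 (-9) E1 (SB (-1) (-10) (PV (-2) (-10) E1 (WD (-2) (-10) E0 5)) (SB 1 (-9) (PV 0 (-9) E1 (WD 0 (-9)
    E0 13)) (PV 0 (-9) E1 (TB 1 (-7) E1 (SB 2 (-6) (NX 1 (-7) E1 (NX 1 (-7) E2 (SB 2 (-7) (WD 1 (-7) E0 3) (SB
    3 (-4) (TB 2 (-5) E2 (NX 2 (-5) E2 (PV 2 (-5) E2 (SB 3 (-5) (WD 2 (-5) E0 3) (WD 2 (-5) E1 6)))) (NX 2
    (-5) E2 (NX 2 (-5) E0 (WD 2 (-5) E1 3)))) (WD 1 (-4) E1 6))))) (FO 1 (-7) E1 E2)) (SB 2 (-7) (PV 2 (-8) E2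
    (WD 2 (-8) E1 8)) (FO 1 (-7) E1 E0)))))) (SB (-1) (-10) (PV (-2) (-10) E1 (WD (-2) (-10) E0 5)) (FO 0 (-9)
    E1 E2))))) (WD (-1) (-5) E2 8)) (NX (-4) (-8) E2 (NX (-6) (-9) E1 (SB (-7) (-10) (WD (-5) (-7) E1 6) (NX
    (-6) (-9) E2 (SB (-8) (-9) (WD (-2) (-4) E1 13) (SB (-7) (-7) (WD (-5) (-7) E1 9) (SB (-6) (-5) (PV (-5)
    (-4) E0 (SB (-5) (-3) (PV (-5) (-4) E2 (PV (-5) (-4) E1 (PV (-3) (-3) E2 (PV (-4) (-2) E0 (PV (-4) (-2) E2
    (TB (-1) 1 E2 (SB 0 2 (NX (-1) 1 E2 (NX (-1) 1 E0 (SB (-1) 2 (WD (-1) 1 E1 3) (NX (-1) 1 E1 (PV (-1) 1 E2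
    (SB 1 3 (NX 0 3 E0 (TB 1 2 E0 (NX 1 2 E0 (NX 1 2 E1 (WD 1 2 E2 3))) (TB 2 4 E2 (SB 2 3 (WD 1 2 E0 3) (FO 2
    4 E2 E1)) (SB 2 5 (SB 0 4 (NX 0 3 E1 (NX 0 3 E2 (SB (-3) 1 (PV (-2) 2 E0 (SB (-2) 3 (WD (-2) 2 E1 8) (PV
    (-2) 2 E2 (SB (-6) (-2) (PV (-5) (-1) E0 (WD (-5) (-1) E2 25)) (TB (-4) 1 E0 (SB (-5) 1 (NX (-4) 1 E0 (SB
    (-5) 0 (PV (-4) 1 E0 (SB (-4) 2 (WD (-4) 1 E1 3) (TB (-6) 0 E1 (SB (-6) 1 (SB (-7) (-1) (WD (-3) 0 E1 5)
    (WD 0 0 E1 13)) (WD (-6) 0 E1 6)) (SB (-7) (-1) (WD (-3) 0 E1 5) (FO (-6) 0 E1 E2))))) (WD (-2) (-1) E2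
    6))) (FO (-4) 1 E0 E0)) (SB (-4) 2 (PV (-3) 3 E0 (WD (-3) 3 E2 5)) (FO (-4) 1 E0 E1))))))) (WD (-1) (-2)
    E0 16)))) (WD (-1) 1 E0 5)) (FO 2 4 E2 E1))))) (WD (-1) 1 E2 6))))))) (FO (-1) 1 E2 E2)) (SB (-1) 2 (NX
    (-1) 1 E2 (PV (-1) 1 E2 (SB 0 2 (WD (-1) 1 E0 3) (PV (-1) 1 E1 (SB (-3) 1 (NX (-3) 0 E1 (NX (-3) 0 E2 (SB
    (-6) (-2) (PV (-5) (-1) E0 (WD (-5) (-1) E2 25)) (SB (-5) 0 (TB (-6) 0 E0 (NX (-6) 0 E0 (SB (-7) (-1) (WD
    (-3) 0 E1 5) (SB (-6) 1 (WD 0 0 E1 13) (TB (-4) 1 E2 (SB (-3) 2 (SB (-4) 2 (WD (-3) 0 E1 8) (SB (-1) 3 (SB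
    (-2) 3 (TB (-2) 2 E1 (NX (-2) 2 E1 (NX (-2) 2 E2 (WD (-2) 2 E0 3))) (NX (-2) 2 E1 (NX (-2) 2 E2 (WD (-2) 2
    E0 3)))) (WD (-6) 0 E1 6)) (PV 0 3 E2 (PV (-2) 2 E0 (PV (-2) 2 E2 (WD (-2) 2 E1 6)))))) (FO (-4) 1 E2 E2))
    (SB (-4) 2 (WD (-3) 0 E1 8) (FO (-4) 1 E2 E1)))))) (SB (-7) (-1) (WD (-3) 0 E1 5) (FO (-6) 0 E0 E2))) (WD
    (-2) (-1) E2 6))))) (WD 0 0 E1 8)))))) (FO (-1) 1 E2 E1)))))))) (PV (-5) (-4) E2 (WD (-6) (-3) E0 8))))
    (WD (-8) (-10) E1 5)))))))))) (PV (-1) (-8) E1 (WD 1 (-7) E2 6))))) (WD (-1) (-5) E2 5)))) (PV 0 (-6) E1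
    (PV 2 (-5) E2 (WD 2 (-5) E1 8)))))))))) (PV (-4) (-5) E0 (WD (-5) (-7) E1 5))) (SB (-1) (-7) (PV (-2) (-7)
    E1 (WD (-2) (-7) E0 5)) (FO 0 (-6) E1 E2)))))))))) (WD (-1) (-5) E0 16)))))) (FO (-3) 0 E0 E2)) (SB (-4)
    (-1) (WD 0 0 E1 5) (FO (-3) 0 E0 E2))))))"

definition cert_12 :: cert where
  "cert_12 = SB 2 (-3) (PV 1 (-4) E1 (SB 3 (-1) (NX 3 0 E2 (SB 1 (-5) (WD 1 (-4) E0 3) (PV 1 (-4) E0 (SB 3
    (-5) (TB 2 (-2) E2 (NX 2 (-2) E2 (TB 4 (-1) E2 (SB 5 0 (PV 4 (-1) E2 (TB 3 (-3) E2 (NX 3 (-3) E2 (SB 4 1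
    (NX 3 0 E0 (NX 3 0 E1 (SB 3 (-2) (WD 2 (-2) E0 3) (SB 4 (-3) (NX 3 (-3) E0 (NX 3 (-3) E1 (SB 3 2 (WD 2 1
    E0 8) (NX 2 1 E0 (SB 5 2 (NX 4 2 E2 (PV 2 1 E1 (SB 5 (-1) (WD 4 (-1) E0 8) (PV 4 (-1) E1 (TB 1 2 E2 (SB 2
    3 (PV 3 3 E2 (WD 3 3 E1 5)) (FO 1 2 E2 E2)) (SB 2 3 (PV 3 3 E2 (WD 3 3 E1 5)) (SB 5 3 (WD 3 0 E2 6) (NX 4
    2 E0 (TB 5 1 E0 (SB 6 2 (PV 5 1 E0 (PV 5 1 E2 (SB 6 1 (WD 5 1 E0 3) (PV 5 1 E1 (SB 8 3 (SB 0 2 (PV 1 2 E2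
    (PV 1 2 E1 (SB 7 4 (SB 1 4 (PV 2 4 E2 (SB 3 5 (PV 2 4 E1 (SB 6 5 (WD 2 4 E0 22) (SB 8 6 (WD 6 3 E2 6) (SB
    9 5 (WD 3 0 E2 13) (WD 6 3 E2 9))))) (PV 2 4 E1 (TB 1 5 E0 (SB 2 6 (PV 3 6 E2 (WD 3 6 E1 5)) (FO 1 5 E0
    E2)) (SB 0 4 (PV 1 5 E0 (SB 2 6 (PV 3 6 E2 (WD 3 6 E1 5)) (TB (-1) 4 E0 (SB 0 5 (PV 1 5 E2 (WD 1 5 E1 13))
    (FO (-1) 4 E0 E2)) (SB 0 5 (PV 1 5 E2 (WD 1 5 E1 13)) (TB 0 3 E1 (SB (-1) 3 (PV (-1) 4 E0 (WD (-1) 4 E2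
    8)) (FO 0 3 E1 E0)) (SB (-1) 2 (SB (-1) 3 (WD 0 3 E1 3) (TB (-1) 1 E1 (NX (-1) 1 E1 (NX (-1) 1 E2 (WD (-1)
    1 E0 3))) (PV (-1) 1 E1 (PV (-1) 1 E0 (SB (-2) 1 (WD (-1) 1 E1 3) (WD (-1) 1 E2 6)))))) (FO 0 3 E1
    E2))))))) (FO 1 5 E0 E2)))))) (PV 2 4 E2 (WD 0 3 E0 6))) (WD 2 1 E0 5)))) (PV 1 2 E2 (PV (-1) 1 E0 (WD
    (-1) 1 E2 8)))) (FO 7 2 E2 E2)))))) (FO 5 1 E0 E2)) (SB 6 1 (PV 6 0 E2 (WD 6 0 E1 5)) (FO 5 1 E0
    E0))))))))))) (FO 4 2 E2 E0)))))) (WD 2 (-2) E2 5))))) (WD 1 (-1) E2 5))) (SB 3 (-2) (WD 2 (-2) E0 3) (FO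
    3 (-3) E2 E1)))) (FO 4 (-1) E2 E2)) (SB 3 (-2) (WD 2 (-2) E0 3) (FO 4 (-1) E2 E2)))) (NX 2 (-2) E2 (NX 2
    (-2) E0 (WD 2 (-2) E1 3)))) (FO 2 (-5) E1 E0))))) (WD 1 (-1) E1 6))) (PV 1 (-4) E1 (PV 2 (-2) E2 (SB 1
    (-5) (NX 1 (-4) E2 (SB (-3) (-2) (NX (-2) (-1) E2 (NX (-2) (-1) E0 (SB (-2) (-3) (WD 0 0 E0 8) (NX (-1)
    (-2) E2 (NX (-3) (-3) E1 (SB (-4) (-4) (WD (-2) (-1) E1 6) (NX (-3) (-3) E2 (SB (-2) (-6) (PV (-1) (-5) E0
    (PV (-1) (-5) E2 (SB (-3) (-5) (PV (-2) (-4) E0 (PV (-2) (-4) E2 (PV (-3) (-3) E0 (SB (-4) (-6) (PV (-4)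
    (-5) E1 (SB (-5) (-3) (SB (-6) (-5) (SB (-5) (-6) (WD (-1) (-5) E2 22) (PV (-4) (-5) E0 (TB (-3) (-6) E2
    (SB (-3) (-7) (PV (-3) (-6) E2 (PV (-3) (-6) E1 (SB (-4) (-7) (PV (-5) (-7) E1 (WD (-5) (-7) E0 8)) (PV
    (-3) (-6) E0 (SB (-3) (-8) (PV (-4) (-8) E1 (SB (-5) (-9) (PV (-4) (-8) E0 (WD (-4) (-8) E2 16)) (PV (-4)
    (-8) E0 (TB (-3) (-9) E1 (SB (-2) (-8) (TB (-2) (-7) E0 (SB (-4) (-10) (PV (-5) (-10) E1 (WD (-5) (-10) E0
    5)) (TB 0 (-6) E1 (SB (-1) (-7) (WD (-2) (-7) E0 3) (SB 1 (-6) (PV 0 (-6) E1 (SB (-2) (-9) (TB 1 (-7) E1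
    (SB 2 (-6) (SB 0 (-8) (WD 0 (-6) E0 8) (SB 3 (-4) (TB 2 (-5) E2 (NX 2 (-5) E2 (PV 2 (-5) E2 (SB 2 (-7) (PV
    1 (-7) E1 (WD 1 (-7) E0 6)) (SB 3 (-5) (WD 2 (-5) E0 3) (WD 2 (-5) E1 9))))) (NX 2 (-5) E2 (NX 2 (-5) E0
    (WD 2 (-5) E1 3)))) (WD 1 (-4) E1 6))) (FO 1 (-7) E1 E2)) (SB 0 (-8) (WD 0 (-6) E0 8) (FO 1 (-7) E1 E2)))
    (WD 0 (-6) E0 25))) (PV 0 (-6) E1 (PV 2 (-5) E2 (WD 2 (-5) E1 5))))) (SB (-1) (-7) (WD (-2) (-7) E0 3) (FO
    0 (-6) E1 E2)))) (NX (-2) (-7) E0 (NX (-2) (-7) E1 (WD (-2) (-7) E2 3)))) (FO (-3) (-9) E1 E2)) (SB (-4)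
    (-10) (PV (-5) (-10) E1 (WD (-5) (-10) E0 5)) (FO (-3) (-9) E1 E2)))))) (PV (-4) (-8) E1 (WD (-2) (-7) E2
    6))))))) (FO (-3) (-6) E2 E1)) (SB (-4) (-7) (PV (-5) (-7) E1 (WD (-5) (-7) E0 8)) (FO (-3) (-6) E2
    E2))))) (WD (-1) (-2) E2 5)) (TB (-3) 0 E0 (SB (-2) 1 (NX (-3) 0 E0 (SB (-4) (-1) (WD (-2) (-1) E1 9) (SB
    (-3) 1 (TB (-4) 1 E0 (SB (-3) 2 (SB (-5) 0 (WD 0 0 E0 16) (SB (-4) 2 (WD (-3) 0 E0 6) (TB (-1) 1 E2 (SB 0
    2 (NX (-1) 1 E2 (NX (-1) 1 E0 (SB (-1) 2 (WD (-1) 1 E1 3) (NX (-1) 1 E1 (PV (-1) 1 E2 (PV (-2) 2 E0 (SB 1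
    3 (SB (-2) 3 (PV (-2) 2 E2 (TB 1 2 E0 (NX 1 2 E0 (NX 1 2 E1 (WD 1 2 E2 3))) (TB 2 4 E2 (SB 2 3 (WD 1 2 E0
    3) (FO 2 4 E2 E1)) (SB 2 5 (SB 0 4 (WD (-2) 2 E1 8) (WD (-1) 1 E0 5)) (FO 2 4 E2 E1))))) (WD 0 0 E0 25))
    (WD (-1) 1 E2 6)))))))) (FO (-1) 1 E2 E2)) (SB (-1) 2 (NX (-1) 1 E2 (SB 0 2 (WD (-1) 1 E0 3) (SB (-2) 3
    (TB (-2) 2 E2 (NX (-2) 2 E2 (NX (-2) 2 E0 (WD (-2) 2 E1 3))) (NX (-2) 2 E2 (PV (-2) 2 E2 (SB (-1) 3 (WD
    (-2) 2 E0 3) (WD (-2) 2 E1 6))))) (WD (-3) 0 E0 9)))) (FO (-1) 1 E2 E1))))) (FO (-4) 1 E0 E2)) (SB (-5) 0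
    (WD 0 0 E0 16) (FO (-4) 1 E0 E2))) (WD (-5) (-4) E1 5)))) (FO (-3) 0 E0 E2)) (SB (-4) (-1) (WD (-2) (-1)
    E1 9) (FO (-3) 0 E0 E2))))) (FO (-4) (-5) E1 E1))))) (PV (-2) (-4) E0 (WD (-3) (-6) E1 9))))) (PV (-1)
    (-5) E0 (TB 0 (-6) E1 (SB (-1) (-7) (PV (-2) (-7) E1 (WD (-2) (-7) E0 5)) (TB 2 (-5) E1 (SB 1 (-6) (PV 0
    (-6) E1 (WD 0 (-6) E0 13)) (WD 2 (-5) E1 8)) (SB 1 (-6) (PV 0 (-6) E1 (WD 0 (-6) E0 13)) (FO 2 (-5) E1
    E2)))) (SB (-1) (-7) (PV (-2) (-7) E1 (WD (-2) (-7) E0 5)) (FO 0 (-6) E1 E2)))))))))))) (SB (-2) (-3) (NX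
    (-2) (-4) E1 cert_11) (WD (-2) (-4) E1 8)))) (WD 2 (-2) E1 5))))"

definition cert_13 :: cert where
  "cert_13 = TB 0 (-3) E1 (SB 0 (-4) (NX 0 (-3) E1 (SB (-1) (-4) (NX 0 (-3) E2 (SB (-2) (-3) (PV (-1) (-2) E0
    (PV (-1) (-2) E2 (SB (-3) (-2) (WD (-1) (-2) E2 8) (PV (-2) (-1) E0 (SB (-3) (-4) (PV (-3) (-3) E1 (TB 2
    (-2) E1 (SB 3 (-1) (SB 1 (-3) (WD 0 (-3) E0 3) (NX 0 (-3) E0 (SB (-4) (-4) (PV (-3) (-3) E0 (WD (-3) (-3)
    E2 6)) (PV (-3) (-3) E0 (SB (-4) (-6) (SB 3 (-2) (PV 2 (-2) E1 (SB (-3) (-5) (TB (-2) (-4) E1 (NX (-2)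
    (-4) E1 (NX (-2) (-4) E2 (WD (-2) (-4) E0 3))) (PV (-2) (-4) E1 (TB (-1) (-5) E1 (SB (-2) (-5) (WD (-2)
    (-4) E0 3) (FO (-1) (-5) E1 E0)) (SB 0 (-5) (PV (-1) (-5) E1 (TB 3 (-3) E1 (SB 4 (-2) (SB 2 (-4) (WD 2
    (-2) E0 8) (SB (-2) (-5) (WD (-2) (-4) E0 3) (SB (-1) (-6) (PV (-1) (-5) E0 (PV (-1) (-5) E2 (TB 0 (-6) E1
    (NX 0 (-6) E1 (SB 4 (-3) (PV 3 (-3) E1 (WD 3 (-3) E0 6)) (PV 3 (-3) E1 (SB 6 (-1) (SB (-3) (-7) (WD (-1)
    (-5) E2 8) (PV (-3) (-6) E0 (SB (-1) (-7) (NX 0 (-6) E2 (PV (-2) (-7) E1 (SB 1 (-6) (WD 0 (-6) E0 3) (SB 5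
    (-1) (PV 5 (-2) E2 (SB (-2) (-8) (PV (-2) (-7) E0 (WD (-2) (-7) E2 6)) (PV (-2) (-7) E0 (SB 0 (-8) (SB
    (-2) (-9) (TB 4 (-1) E0 (NX 4 (-1) E0 (NX 4 (-1) E1 (WD 4 (-1) E2 3))) (TB 6 0 E2 (SB 5 0 (WD 4 (-1) E0 3)
    (FO 6 0 E2 E0)) (SB 7 0 (SB 6 (-2) (PV 5 (-2) E1 (PV 5 (-2) E0 (SB 5 (-4) (PV 4 (-4) E1 (SB 2 (-7) (WD 4
    (-4) E0 22) (SB 1 (-9) (WD 0 (-6) E2 5) (SB (-1) (-10) (WD 0 (-3) E2 13) (WD 0 (-6) E2 8))))) (PV 4 (-4)
    E1 (PV 6 (-3) E2 (SB 7 (-3) (PV 6 (-3) E1 (WD 6 (-3) E0 6)) (PV 6 (-3) E1 (TB 7 (-1) E2 (NX 7 (-1) E2 (PV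
    7 (-1) E2 (SB 8 (-1) (WD 7 (-1) E0 3) (WD 7 (-1) E1 9)))) (SB 8 (-1) (PV 8 (-2) E2 (WD 8 (-2) E1 13)) (FO
    7 (-1) E2 E0)))))))))) (PV 5 (-2) E1 (PV 7 (-1) E2 (WD 7 (-1) E1 5)))) (FO 6 0 E2 E0)))) (FO (-1) (-8) E1
    E2)) (FO (-1) (-8) E1 E0))))) (PV 5 (-2) E2 (PV 4 (-1) E0 (PV 4 (-1) E2 (WD 4 (-1) E1 9)))))))) (FO (-2)
    (-7) E1 E0)))) (FO 5 (-2) E2 E2))))) (SB 1 (-6) (WD 0 (-3) E2 5) (FO 0 (-6) E1 E0))))) (PV (-1) (-5) E0
    (SB 1 (-6) (WD 0 (-3) E2 5) (FO 0 (-6) E1 E0)))))) (FO 3 (-3) E1 E2)) (SB 2 (-4) (WD 2 (-2) E0 8) (FO 3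
    (-3) E1 E2)))) (FO (-1) (-5) E1 E0))))) (PV (-4) (-5) E1 (PV (-2) (-4) E2 (PV (-2) (-4) E1 (WD (-2) (-4)
    E0 9)))))) (PV 2 (-2) E1 (PV 4 (-1) E2 (WD 4 (-1) E1 5)))) (FO (-4) (-5) E1 E1)))))) (FO 2 (-2) E1 E2))
    (SB 1 (-3) (WD 0 (-3) E0 3) (FO 2 (-2) E1 E2)))) (FO (-3) (-3) E1 E1)))))) (PV (-1) (-2) E0 (PV (-2) (-4)
    E1 (WD (-2) (-4) E0 5))))) (NX 0 (-3) E2 (SB 1 (-3) (PV 0 (-3) E1 (PV 0 (-3) E0 (SB (-1) (-6) (SB 0 (-5)
    (PV (-1) (-5) E1 (TB 1 (-4) E1 (SB 2 (-3) (NX 1 (-4) E1 (NX 1 (-4) E2 (SB 3 (-1) (SB 2 (-4) (WD 1 (-4) E0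
    3) (TB 2 (-2) E0 (PV 2 (-2) E0 (PV 2 (-2) E2 (SB 3 (-2) (WD 2 (-2) E0 3) (WD 2 (-2) E1 6)))) (NX 2 (-2) E0
    (NX 2 (-2) E1 (WD 2 (-2) E2 3))))) (WD 1 (-1) E1 6)))) (FO 1 (-4) E1 E2)) (SB 2 (-4) (NX 1 (-4) E1
    cert_12) (FO 1 (-4) E1 E0)))) (PV (-1) (-5) E1 (SB 2 (-3) (PV 1 (-4) E2 (SB 3 (-1) (SB 2 (-4) (PV 1 (-4)
    E1 (WD 1 (-4) E0 6)) (TB 2 (-2) E1 (NX 2 (-2) E1 (NX 2 (-2) E2 (SB 3 (-2) (WD 2 (-2) E0 3) (WD 2 (-2) E1
    9)))) (NX 2 (-2) E1 (NX 2 (-2) E2 (WD 2 (-2) E0 3))))) (WD 1 (-1) E1 6))) (FO 1 (-4) E2 E2)))) (FO (-1)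
    (-5) E1 E1)))) (PV 0 (-3) E1 (PV 2 (-2) E2 (SB (-2) (-3) (WD 2 (-2) E1 5) (WD 2 (-2) E1 8)))))))) (FO 0
    (-3) E1 E1)) (SB (-1) (-4) (NX 0 (-3) E1 (PV 0 (-3) E1 (SB (-2) (-3) (PV (-1) (-2) E0 (PV (-1) (-2) E2 (SB
    (-3) (-2) (WD (-1) (-2) E2 8) (PV (-2) (-1) E0 (SB (-3) (-4) (PV (-3) (-3) E1 (SB 0 (-4) (WD 0 (-3) E0 3)
    (SB (-4) (-4) (PV (-3) (-3) E0 (WD (-3) (-3) E2 6)) (SB (-2) (-5) (TB (-2) (-4) E0 (SB (-3) (-5) (WD (-2)
    (-4) E0 3) (WD (-2) (-4) E0 9)) (NX (-2) (-4) E0 (NX (-2) (-4) E1 (WD (-2) (-4) E2 3)))) (WD 0 (-3) E0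
    6))))) (FO (-3) (-3) E1 E1)))))) (PV (-1) (-2) E0 (PV (-2) (-4) E1 (WD (-2) (-4) E0 5)))))) (FO 0 (-3) E1
    E2))"

definition cert_14 :: cert where
  "cert_14 = NX (-1) 1 E1 (SB (-1) 3 (SB 1 4 (SB 1 3 (NX 0 3 E0 (TB 1 2 E2 (NX 1 2 E2 (NX 1 2 E0 (WD 1 2 E1
    3))) (NX 1 2 E2 (TB 2 4 E2 (SB 2 3 (WD 1 2 E0 3) (FO 2 4 E2 E1)) (SB 2 5 (SB 0 4 (NX 0 3 E1 (NX 0 3 E2 (SB
    (-2) (-3) (PV (-1) (-2) E0 (PV (-1) (-2) E2 (SB (-3) (-2) (PV (-2) (-1) E0 (PV (-2) (-1) E2 (TB (-4) (-2)
    E1 (SB (-4) (-3) (PV (-4) (-2) E1 (SB (-4) (-1) (PV (-3) 0 E0 (WD (-3) 0 E2 5)) (SB (-2) 3 (NX (-2) 2 E1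
    (SB (-3) 1 (NX (-2) 2 E2 (NX (-2) 2 E0 (NX (-1) 1 E2 (NX (-3) 0 E1 (NX (-3) 0 E2 (SB (-5) (-3) (PV (-4)
    (-2) E0 (SB (-5) 0 (WD (-4) (-2) E2 25) (TB (-3) 3 E0 (SB (-2) 4 (NX (-3) 3 E0 (SB (-4) 2 (WD (-2) 2 E1 9)
    (SB (-3) 4 (TB (-4) 4 E0 (SB (-3) 5 (SB (-5) 3 (WD 0 3 E0 16) (SB (-4) 5 (WD (-3) 3 E0 6) (TB (-1) 4 E0
    (SB 0 5 (NX (-1) 4 E0 (PV (-1) 4 E0 (SB (-1) 5 (WD (-1) 4 E1 3) (NX (-1) 4 E1 (PV (-1) 4 E2 (PV (-2) 5 E0
    (SB 1 6 (SB (-2) 6 (PV (-2) 5 E2 (TB 1 5 E1 (NX 1 5 E1 (NX 1 5 E2 (WD 1 5 E0 3))) (NX 1 5 E1 (NX 1 5 E2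
    (TB 2 7 E2 (SB 2 6 (WD 1 5 E0 3) (FO 2 7 E2 E1)) (SB 2 8 (SB 0 7 (WD (-2) 5 E1 8) (WD (-1) 4 E0 5)) (FO 2
    7 E2 E1))))))) (WD 0 3 E0 25)) (WD (-1) 4 E2 6)))))))) (FO (-1) 4 E0 E2)) (SB (-1) 5 (SB 0 5 (WD (-1) 4 E0
    3) (SB (-2) 6 (TB (-2) 5 E2 (NX (-2) 5 E2 (NX (-2) 5 E0 (WD (-2) 5 E1 3))) (NX (-2) 5 E2 (PV (-2) 5 E2 (SB
    (-1) 6 (WD (-2) 5 E0 3) (WD (-2) 5 E1 6))))) (WD (-3) 3 E0 9))) (FO (-1) 4 E0 E1))))) (FO (-4) 4 E0 E2))
    (SB (-5) 3 (WD 0 3 E0 16) (FO (-4) 4 E0 E2))) (WD (-5) (-1) E1 5)))) (FO (-3) 3 E0 E2)) (SB (-4) 2 (WD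
    (-2) 2 E1 9) (FO (-3) 3 E0 E2))))) (PV (-4) (-2) E0 (TB (-3) (-3) E2 (SB (-3) (-4) (PV (-3) (-3) E2 (PV
    (-3) (-3) E1 (SB (-4) (-4) (PV (-5) (-4) E1 (WD (-5) (-4) E0 8)) (PV (-3) (-3) E0 (SB (-4) (-6) (SB (-3)
    (-5) (PV (-4) (-5) E1 (SB (-5) (-6) (PV (-4) (-5) E0 (WD (-4) (-5) E2 16)) (PV (-4) (-5) E0 (TB (-3) (-6)
    E2 (SB (-2) (-5) (PV (-3) (-6) E2 (SB (-4) (-7) (PV (-5) (-7) E1 (WD (-5) (-7) E0 5)) (TB (-2) (-4) E0 (TB
    (-1) (-5) E2 (SB 0 (-4) (TB 0 (-3) E2 (PV 0 (-3) E2 (SB (-1) (-4) (WD (-2) (-4) E0 3) (SB 1 (-3) (PV 0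
    (-3) E1 (SB (-2) (-6) (TB 1 (-4) E2 (SB 2 (-3) (PV 1 (-4) E2 (SB 0 (-5) (WD 0 (-3) E0 8) (SB 3 (-1) (SB 2
    (-4) (PV 1 (-4) E1 (WD 1 (-4) E0 6)) (TB 2 (-2) E1 (NX 2 (-2) E1 (NX 2 (-2) E2 (SB 3 (-2) (WD 2 (-2) E0 3)
    (WD 2 (-2) E1 9)))) (NX 2 (-2) E1 (NX 2 (-2) E2 (WD 2 (-2) E0 3))))) (WD 1 (-1) E1 6)))) (FO 1 (-4) E2
    E2)) (SB 0 (-5) (WD 0 (-3) E0 8) (FO 1 (-4) E2 E2))) (WD 0 (-3) E0 25))) (PV 0 (-3) E1 (PV 2 (-2) E2 (WD 2
    (-2) E1 5)))))) (SB (-1) (-4) (WD (-2) (-4) E0 3) (FO 0 (-3) E2 E2))) (FO (-1) (-5) E2 E2)) (SB (-1) (-4)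
    (WD (-2) (-4) E0 3) (FO (-1) (-5) E2 E1))) (NX (-2) (-4) E0 (NX (-2) (-4) E1 (WD (-2) (-4) E2 3)))))) (FO
    (-3) (-6) E2 E2)) (SB (-4) (-7) (PV (-5) (-7) E1 (WD (-5) (-7) E0 5)) (FO (-3) (-6) E2 E2)))))) (PV (-4)
    (-5) E1 (WD (-2) (-4) E2 6))) (FO (-4) (-5) E1 E1)))))) (FO (-3) (-3) E2 E1)) (SB (-4) (-4) (PV (-5) (-4)
    E1 (WD (-5) (-4) E0 8)) (FO (-3) (-3) E2 E2)))))))))) (WD (-2) (-1) E1 8))) (SB (-1) 5 (WD 0 3 E0 6) (SB 1
    6 (WD 0 0 E0 13) (WD 0 3 E0 9)))))) (FO (-4) (-2) E1 E1)) (SB (-4) (-1) (PV (-3) 0 E0 (WD (-3) 0 E2 5))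
    (FO (-4) (-2) E1 E1))))) (PV (-2) (-1) E0 (WD (-3) (-3) E1 9))))) (PV (-1) (-2) E0 (TB 0 (-3) E1 (SB (-1)
    (-4) (PV (-2) (-4) E1 (WD (-2) (-4) E0 5)) (TB 2 (-2) E1 (SB 1 (-3) (PV 0 (-3) E1 (WD 0 (-3) E0 13)) (WD 2
    (-2) E1 8)) (SB 1 (-3) (PV 0 (-3) E1 (WD 0 (-3) E0 13)) (FO 2 (-2) E1 E2)))) (SB (-1) (-4) (PV (-2) (-4)
    E1 (WD (-2) (-4) E0 5)) (FO 0 (-3) E1 E2))))))) (WD (-2) (-1) E1 5)) (FO 2 4 E2 E1)))))) (WD 0 0 E0 9))
    (FO 0 3 E0 E2)) (FO 0 3 E0 E0))"

definition cert_15 :: cert where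
  "cert_15 = SB (-1) 0 (SB 0 (-1) (SB 1 1 (NX 0 0 E0 (SB 2 (-1) (SB 0 (-2) (NX 1 (-1) E1 (SB (-1) (-1) (PV 0 0
    E0 (SB 0 1 (WD 0 0 E1 3) (NX 0 0 E1 (SB 2 3 (PV 0 0 E2 (SB (-2) 1 cert_6 (FO (-1) 1 E0 E0))) (FO 1 2 E0
    E2))))) (PV 0 0 E0 (SB (-2) (-2) (SB (-1) (-3) (PV (-1) (-2) E1 (SB 2 0 cert_10 (PV 1 (-1) E1 (SB 2 2 (PV
    2 1 E2 (SB 0 1 (NX 0 0 E1 (NX 0 0 E2 (SB (-3) (-1) (SB 1 (-2) (NX 1 (-1) E2 (NX 1 (-1) E0 (SB 4 0 (SB (-2)
    0 (NX (-2) (-1) E1 cert_13) (NX (-2) (-1) E1 (SB 0 2 (NX (-1) 1 E0 (SB (-1) 2 (WD 0 0 E0 6) cert_14)) (FO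
    (-1) 1 E0 E2)))) (FO 3 0 E2 E0)))) (WD 2 1 E1 5)) (FO (-2) (-1) E1 E0)))) (WD (-1) (-2) E0 5))) (FO 2 1 E2
    E1))))) (FO (-1) (-2) E1 E1)) (FO (-1) (-2) E1 E0))))) (FO 1 (-1) E1 E2)) (FO 1 (-1) E1 E0))) (FO 0 0 E0
    E2)) (FO 0 0 E0 E1)) (FO 0 0 E0 E0)"

text \<open>In the encoding by class 0 vertices, the initial facts describe a positive vertex
  \<open>(1, 0)\<close> reached from \<open>(0, 0)\<close> by a strand of type \<open>(1, 1)\<close>
  and from \<open>(1, -1)\<close> by one of type \<open>(2, -1)\<close>.\<close>

lemma certificate: "check cert_15 [((1, 0), True)] [(((1, - 1), E1), False), (((0, 0), E0), True)]"
  by code_simp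

lemma no_mixing_root:
  assumes "typed s ty" "s (1, 0) = 1"
    "ty (strand_in (1, 0) E0) = (1, 1)" "ty (strand_in (1, 0) E1) = (2, -1)"
  shows False
proof -
  have "strand ty ((1, 0) - dvec E0, E0) True"
    using assms by (intro strand_of_leave[OF assms(1)]) (simp_all add: end_type_def)
  moreover have "strand ty ((1, 0) - dvec E1, E1) False"
    using assms by (intro strand_of_leave[OF assms(1)]) (simp_all add: end_type_def)
  ultimately show False
    by (intro check_sound[OF assms(1) certificate]) (auto simp: assms(2) zero_prod_def)
qed

section \<open>Reduction of mixed vertices to one configuration\<close>

text \<open>An orientation preserving or (for \<open>\<epsilon> = -1\<close>) reversing affine symmetry of the lattice
  carries typings to typings; a reflection swaps left and right turns.\<close>

lemma orbit_transform:
  assumes g: "\<And>x d. g (x + dvec d) = g x + dvec (h d)"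
    and h: "\<And>d. h (rot d) = trn \<epsilon> (h d)" and e: "\<epsilon> = 1 \<or> \<epsilon> = -1" and s: "signs s"
  shows "nx s (g x, h d) = (let e = nx (\<lambda>x. \<epsilon> * s (g x)) (x, d) in (g (fst e), h (snd e)))"
proof -
  have "h (trn (\<epsilon> * \<sigma>) d) = trn \<sigma> (h d)" if "\<sigma> = 1 \<or> \<sigma> = -1" for \<sigma> d
    using that e by (auto simp: trn_def h)
  then show ?thesis using signsD[OF s] by (simp add: nx_def Let_def g)
qed

text \<open>Shifting the classes by \<open>\<kappa>\<close> shifts the residue of a type. A
  reflection exchanges left and right, hence negates the signs together with the second component,
  and \<open>FS_uminus\<close> carries the derived words along.\<close>

lemma typed_transform:
  assumes ty: "typed s ty" and g: "\<And>x d. g (x + dvec d) = g x + dvec (h d)"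
    and h: "\<And>d. h (rot d) = trn \<epsilon> (h d)" and e: "\<epsilon> = 1 \<or> \<epsilon> = -1"
    and c: "\<And>x. csum (g x) mod 3 = (csum x + \<kappa>) mod 3"
  shows "typed (\<lambda>x. \<epsilon> * s (g x))
    (\<lambda>e. ((fst (ty (g (fst e), h (snd e))) - \<kappa>) mod 3, \<epsilon> * snd (ty (g (fst e), h (snd e)))))"
    (is "typed ?s ?ty")
proof -
  note tyD = typedD[OF ty]
  have s: "signs ?s" unfolding signs_def
  proof
    fix x show "?s x = 1 \<or> ?s x = -1" using signsD[OF tyD(1), of "g x"] e by auto
  qed
  have nx: "nx s (g x, h d) = (g (fst (nx ?s (x, d))), h (snd (nx ?s (x, d))))" for x d
    using orbit_transform[OF g h e tyD(1)] by (simp add: Let_def)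
  have "?ty (nx ?s e) = ?ty e" for e
    using nx[of "fst e" "snd e"] tyD(2)[of "(g (fst e), h (snd e))"] by simp
  moreover have "fst (?ty e) \<in> {0, 1, 2} \<and> snd (?ty e) \<in> {1, -1}" for e
    using tyD(4)[of "(g (fst e), h (snd e))"] e by auto
  moreover have "sat (?ty e) (csum (fst e)) (?s (fst e))" for e
  proof -
    have "sat (ty (g (fst e), h (snd e))) (csum (fst e) + \<kappa>) (s (g (fst e)))"
      using tyD(5)[of "(g (fst e), h (snd e))" "csum (fst e) + \<kappa>"] c by simp
    moreover have "(csum (fst e) + \<kappa>) mod 3 = (r + i) mod 3"
      if "csum (fst e) mod 3 = ((r - \<kappa>) mod 3 + i) mod 3" for r i
    proof -
      have "csum (fst e) mod 3 = (r - \<kappa> + i) mod 3" using that by (simp add: mod_add_left_eq)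
      from mod_add_cong[OF this refl, of \<kappa>] show ?thesis by (simp add: algebra_simps)
    qed
    ultimately show ?thesis using e by (auto simp: sat_def)
  qed
  moreover have "FS {L. sign_sequence L} (\<lambda>k. ?s (fst (E (3 * k + m))))"
    if E: "orbit ?s E" "csum (fst (E m)) mod 3 = fst (?ty (E 0))" for E m
  proof -
    define E' where "E' k = (g (fst (E k)), h (snd (E k)))" for k
    have E': "orbit s E'" using orbitD[OF E(1)] nx unfolding orbit_def E'_def by simp
    have "csum (fst (E' m)) mod 3 = (fst (ty (E' 0)) - \<kappa> + \<kappa>) mod 3"
      using E(2) c[of "fst (E m)"] mod_add_cong[of "csum (fst (E m))" 3 "fst (ty (E' 0)) - \<kappa>" \<kappa> \<kappa>]
      unfolding E'_def by simp
    then have "csum (fst (E' m)) mod 3 = fst (ty (E' 0))" using tyD(3)[of "E' 0"] by auto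
    from tyD(6)[OF E' this] have "FS {L. sign_sequence L} (\<lambda>k. s (g (fst (E (3 * k + m)))))"
      by (simp add: E'_def)
    with FS_uminus[OF this] e show ?thesis by auto
  qed
  ultimately show ?thesis using s unfolding typed_def by blast
qed

definition affine :: "int \<times> int \<Rightarrow> (dir \<Rightarrow> dir) \<Rightarrow> int \<times> int \<Rightarrow> int \<times> int" where
  "affine v h x = (fst v + fst x * fst (dvec (h E0)) + snd x * fst (dvec (h E1)),
     snd v + fst x * snd (dvec (h E0)) + snd x * snd (dvec (h E1)))"

lemma affine:
  assumes "\<And>d. h (rot d) = trn \<epsilon> (h d)" "\<epsilon> = 1 \<or> \<epsilon> = -1"
  shows "affine v h (x + dvec d) = affine v h x + dvec (h d)"
    "csum (affine v h x) mod 3 = (csum x + csum v) mod 3"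
proof -
  have h: "h E1 = trn \<epsilon> (h E0)" "h E2 = trn \<epsilon> (h E1)" using assms(1)[of E0] assms(1)[of E1] by auto
  show "affine v h (x + dvec d) = affine v h x + dvec (h d)"
    using assms(2) h by (cases d; cases "h E0") (auto simp: affine_def trn_def algebra_simps prod_eq_iff)
  have "csum (affine v h x) = csum v + fst x * csum (dvec (h E0)) + snd x * csum (dvec (h E1))"
    by (simp add: affine_def csum_def algebra_simps)
  moreover have "(a * csum (dvec d)) mod 3 = a mod 3" for a d
    using mod_mult_cong[OF refl, of "csum (dvec d)" 3 1 a] csum_dvec by simp
  then have "(csum v + fst x * csum (dvec (h E0)) + snd x * csum (dvec (h E1))) mod 3 = (csum v + fst x + snd x) mod 3"
    by (intro mod_add_cong refl)
  ultimately show "csum (affine v h x) mod 3 = (csum x + csum v) mod 3"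
    by (simp add: csum_def[of x] algebra_simps)
qed

text \<open>The relabelling that sends \<open>E0\<close> to \<open>d\<close>: a rotation for
  \<open>\<epsilon> = 1\<close>, a reflection for \<open>\<epsilon> = -1\<close>.\<close>

definition frame :: "int \<Rightarrow> dir \<Rightarrow> dir \<Rightarrow> dir" where
  "frame \<epsilon> d e = (case e of E0 \<Rightarrow> d | E1 \<Rightarrow> trn \<epsilon> d | E2 \<Rightarrow> trn \<epsilon> (trn \<epsilon> d))"

lemma frame_rot: "\<epsilon> = 1 \<or> \<epsilon> = -1 \<Longrightarrow> frame \<epsilon> d (rot e) = trn \<epsilon> (frame \<epsilon> d e)"
  by (cases e) (auto simp: frame_def trn_def)

lemma no_mixing_after:
  assumes "typed s ty" "s v = 1" "csum v mod 3 = 1"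
    "ty (strand_in v d) = (1, 1)" "ty (strand_in v (rot d)) = (2, -1)"
  shows False
proof -
  \<comment> \<open>In the new coordinates \<open>v0\<close> is the origin and \<open>d\<close> is
    \<open>E0\<close>, which puts \<open>v\<close> at \<open>(1, 0)\<close>; as \<open>v0\<close>
    has class 0, the classes are unchanged.\<close>
  define v0 h where "v0 = v - dvec d" "h = frame 1 d"
  have h: "h (rot e) = trn 1 (h e)" for e unfolding v0_h_def by (rule frame_rot) simp
  have c0: "csum v0 mod 3 = 0 mod 3" using csum_step(2)[of v 1 d] assms(3) by (simp add: v0_h_def)
  have c: "csum (affine v0 h x) mod 3 = (csum x + 0) mod 3" for x
    using affine(2)[of h 1 v0 x, OF h] mod_add_cong[OF refl c0, of "csum x"] by simp
  have step: "affine v0 h (x + dvec e) = affine v0 h x + dvec (h e)" for x e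
    using affine(1)[of h 1 v0 x e] h by simp
  have T: "typed (\<lambda>x. 1 * s (affine v0 h x)) (\<lambda>e. ((fst (ty (affine v0 h (fst e), h (snd e))) - 0) mod 3,
      1 * snd (ty (affine v0 h (fst e), h (snd e)))))"
    by (rule typed_transform[OF assms(1) step h _ c]) simp
  have 0: "affine v0 h (0, 0) = v0" by (simp add: affine_def prod_eq_iff)
  have 1: "affine v0 h (1, 0) = v" using step[of "(0, 0)" E0] 0 by (simp add: v0_h_def frame_def)
  have 2: "affine v0 h (1, -1) = v - dvec (rot d)"
    using step[of "(1, -1)" E1] 1 by (simp add: v0_h_def frame_def trn_def eq_diff_eq)
  have z: "affine v0 h 0 = v - dvec d" by (simp add: affine_def v0_h_def prod_eq_iff)
  have hd: "h E0 = d" "h E1 = rot d" by (simp_all add: v0_h_def frame_def trn_def)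
  show False
    using assms(2,4,5) by (intro no_mixing_root[OF T])
      (simp_all add: strand_in_def z 1 2 hd)
qed

text \<open>At class 1 a change from \<open>(1, 1)\<close> to \<open>(2, -1)\<close> must occur
  somewhere in the cyclic order of the three directions. At class 2 the strands are followed to a
  neighbouring positive vertex of class 1, where both types occur again.\<close>

lemma no_mixing_12:
  assumes "typed s ty" "s v = 1" "csum v mod 3 = 1 \<or> csum v mod 3 = 2"
    "ty (strand_in v d) = (1, 1)" "ty (strand_in v d') = (2, -1)"
  shows False
proof -
  have all: "ty (strand_in v e) = (1, 1) \<or> ty (strand_in v e) = (2, -1)" for e
    using hot_vertex[OF assms(1-3), of d True e] assms(4) by (auto simp: end_type_def split: if_splits)
  have ne: "ty (strand_in v d') \<noteq> (1, 1)" using assms(5) by simp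
  from assms(3) show False
  proof
    assume v: "csum v mod 3 = 1"
    obtain e where "ty (strand_in v e) = (1, 1)" "ty (strand_in v (rot e)) \<noteq> (1, 1)"
      using dir_cases[of d' d] assms(4) ne by (metis rot3)
    with all no_mixing_after[OF assms(1,2) v] show False by blast
  next
    assume w: "csum v mod 3 = 2"
    obtain e where e: "ty (strand_in v e) = (1, 1)" "ty (strand_in v (rot (rot e))) \<noteq> (1, 1)"
      using dir_cases[of d' d] assms(4) ne by (metis rot3)
    define f where "f = rot (rot e)"
    \<comment> \<open>\<open>x\<close> is the own vertex of the first strand and a foreign corner at
      the centre of the second. It is positive by \<open>strand_foreign\<close>, and mixed, since
      \<open>strand_exclusive\<close> rules out \<open>(1, 1)\<close> for the strand arriving from
      that centre.\<close>
    define x where "x = v - dvec f"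
    have x: "csum x mod 3 = 1" using csum_step(2)[of v 2 f] w by (simp add: x_def)
    have cd: "csum (v + dvec e') mod 3 = 0" for e' using csum_step(1)[of v 2 e'] w by simp
    have A: "strand ty (v + dvec (rot e), e) True"
      using strand_before[OF assms(1,2), of e] e(1) cd by (simp add: strand_def end_type_def)
    have B: "strand ty (v + dvec e, f) False"
      using strand_before[OF assms(1,2), of f] e(2) all cd by (auto simp: strand_def end_type_def f_def)
    have xA: "x = v + dvec (rot e) + dvec e" by (simp add: x_def f_def dvec_rot2)
    have xB: "x = v + dvec e + dvec (rot e)" by (simp add: xA algebra_simps)
    have sx: "s x = 1" using strand_foreign[OF assms(1) B, of "rot e"] by (simp add: foreign_def xB)
    have tA: "ty (strand_in x e) = (1, 1)"
      using strand_leave[OF assms(1) A] by (simp add: xA end_type_def)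
    obtain b where b: "ty (strand_in x (rot e)) = end_type b"
      using hot_vertex[OF assms(1) sx, of e True "rot e"] x tA by (auto simp: end_type_def)
    have "strand ty (v + dvec e, rot e) b"
      using strand_of_leave[OF assms(1), of "v + dvec e" "rot e"] b cd by (simp add: xB)
    with strand_exclusive[OF assms(1) _ B] have "\<not> b" by (cases b) auto
    with b no_mixing_after[OF assms(1) sx x tA] show False by (simp add: end_type_def)
  qed
qed

lemma types_agree:
  assumes "typed s ty"
  shows "ty (strand_in v d) = ty (strand_in v d')"
proof -
  have no: False if m: "meets (csum v) (s v) (ty (strand_in v d)) (ty (strand_in v d'))" for d d'
  proof -
    define r l where "r = fst (ty (strand_in v d))" "l = snd (ty (strand_in v d))"
    have l: "l = 1 \<or> l = -1" and r: "r \<in> {0, 1, 2}" using typedD(3,4)[OF assms] by (simp_all add: r_l_def)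
    have t: "ty (strand_in v d) = (r, l)" by (simp add: r_l_def)
    have m': "ty (strand_in v d') = ((r + 1) mod 3, - l)" "s v = l" "csum v mod 3 = r \<or> csum v mod 3 = (r + 1) mod 3"
      using m by (auto simp: meets_def plus_type_def r_l_def)
    \<comment> \<open>For \<open>l = -1\<close> this is a reflection, which makes the sign at
      \<open>v\<close> positive.\<close>
    define h where "h = frame l E0"
    have h: "h (rot e) = trn l (h e)" for e unfolding h_def by (rule frame_rot[OF l])
    have aff: "affine u h (x + dvec e) = affine u h x + dvec (h e)"
      "csum (affine u h x) mod 3 = (csum x + csum u) mod 3" for u x e
      using affine[of h l u x] h l by blast+
    \<comment> \<open>\<open>w\<close> has class 1 or 2, according to which of the two classes
      allowed by \<open>meets\<close> is that of \<open>v\<close>. Subtracting \<open>r - 1\<close>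
      from the classes then turns the two types into \<open>(1, 1)\<close> and
      \<open>(2, -1)\<close>.\<close>
    define w :: "int \<times> int" where "w = (if csum v mod 3 = r then (1, 0) else (1, 1))"
    define v0 where "v0 = v - (affine 0 h w)"
    define g where "g = affine v0 h"
    have gw: "g w = v" by (simp add: g_def v0_def affine_def w_def prod_eq_iff)
    have w: "csum v mod 3 = (csum w + (r - 1)) mod 3" using m'(3) r by (auto simp: w_def add.commute)
    have "csum (affine 0 h w) mod 3 = csum w mod 3" using aff(2)[of 0 w] by simp
    from mod_diff_cong[OF w this] have v0: "csum v0 mod 3 = (r - 1) mod 3" by (simp add: v0_def)
    have c: "csum (g x) mod 3 = (csum x + (r - 1)) mod 3" for x
      unfolding g_def aff(2) by (rule mod_add_cong[OF refl v0])
    have g: "g (x + dvec e) = g x + dvec (h e)" for x e unfolding g_def by (rule aff(1))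
    have gin: "g (w - dvec e) = v - dvec (h e)" for e using g[of "w - dvec e" e] gw by (simp add: eq_diff_eq)
    have surj: "\<exists>e'. h e' = e" for e
      using l by (cases e) (auto simp: h_def frame_def trn_def intro: exI[of _ E0] exI[of _ E1] exI[of _ E2])
    obtain e where e: "h e = d" using surj by blast
    obtain e' where e': "h e' = d'" using surj by blast
    have w12: "csum w mod 3 = 1 \<or> csum w mod 3 = 2" by (simp add: w_def)
    have ll: "l * l = 1" using l by auto
    have "((r + 1) mod 3 - (r - 1)) mod 3 = 2" using r by auto
    then show False
      using gin t m' e e' ll r
      by (intro no_mixing_12[OF typed_transform[OF assms g h l c] _ w12, of e e'])
        (simp_all add: gw strand_in_def)
  qed
  show ?thesis using compatible_all[OF assms, of v d d'] no unfolding compatible_def by blast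
qed

section \<open>The hierarchy of a covering\<close>

text \<open>A side leaving \<open>v\<close> continues a strand entering \<open>v\<close>, so
  neighbouring vertices carry the same type, and the lattice is connected.\<close>

lemma types_const:
  assumes "typed s ty"
  shows "ty e = ty e'"
proof -
  define f where "f v = ty (strand_in v E0)" for v
  have f: "ty (strand_in v d) = f v" for v d unfolding f_def by (rule types_agree[OF assms])
  have step: "f (v + dvec d) = f v" for v d
  proof -
    have s: "s v = 1 \<or> s v = -1" using typedD(1)[OF assms] by (rule signsD)
    have "nx s (strand_in v (trn (- s v) d)) = strand_in (v + dvec d) d"
      using s by (simp add: nx_def strand_in_def)
    then have "ty (strand_in (v + dvec d) d) = ty (strand_in v (trn (- s v) d))"
      using typedD(2)[OF assms] by metis
    then show ?thesis by (simp add: f)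
  qed
  have 1: "f (a, b) = f (0, b)" for a b
  proof (induction a rule: int_induct[of _ 0])
    case (step1 i) then show ?case using step[of "(i, b)" E0] by simp
  next
    case (step2 i) then show ?case using step[of "(i - 1, b)" E0] by simp
  qed simp
  have 2: "f (0, b) = f (0, 0)" for b
  proof (induction b rule: int_induct[of _ 0])
    case (step1 i) then show ?case using step[of "(0, i)" E1] by simp
  next
    case (step2 i) then show ?case using step[of "(0, i - 1)" E1] by simp
  qed simp
  have "ty e = f (0, 0)" for e
  proof -
    have "e = strand_in (fst e + dvec (snd e)) (snd e)" by (simp add: strand_in_def)
    then have "ty e = f (fst e + dvec (snd e))" using f by metis
    then show ?thesis using 1 2 by (cases "fst e + dvec (snd e)") metis
  qed
  then show ?thesis by metis
qed

text \<open>Multiplication by \<open>2 + \<omega>\<close> or \<open>2 + \<omega>\<^sup>2\<close>: the sum of three consecutive sides with turns \<open>l\<close> and \<open>-l\<close>.\<close>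

definition inflate :: "int \<Rightarrow> int \<times> int \<Rightarrow> int \<times> int" where
  "inflate l x = (if l = 1 then (2 * fst x - snd x, fst x + snd x) else (fst x + snd x, 2 * snd x - fst x))"

definition embed :: "int \<Rightarrow> int \<Rightarrow> int \<times> int \<Rightarrow> int \<times> int" where
  "embed r l x = (r, 0) + inflate l x"

lemma inflate_add: "inflate l (x + y) = inflate l x + inflate l y"
  by (auto simp: inflate_def)

lemma inflate_diff: "inflate l (x - y) = inflate l x - inflate l y"
  by (auto simp: inflate_def)

lemma inflate_dvec: "l = 1 \<or> l = -1 \<Longrightarrow> inflate l (dvec d) = dvec d + dvec (trn l d) + dvec d"
  by (cases d) (auto simp: inflate_def trn_def)

lemma csum_embed: "csum (embed r l x) mod 3 = r mod 3"
proof -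
  have "csum (embed r l x) = r + 3 * (if l = 1 then fst x else snd x)"
    by (auto simp: embed_def inflate_def csum_def)
  then show ?thesis by simp
qed

text \<open>Both multipliers in \<open>inflate\<close> are unit multiples of
  \<open>1 - \<omega>\<close>, so each has the whole sublattice of class 0 as its image.\<close>

lemma embed_surj:
  assumes "csum x mod 3 = r mod 3"
  obtains y where "x = embed r l y"
proof -
  from assms have "3 dvd csum x - r" by (simp only: mod_eq_dvd_iff)
  then obtain q where "csum x - r = 3 * q" by (rule dvdE)
  then have "snd x = 3 * q + r - fst x" by (simp add: csum_def)
  then have "x = embed r l (if l = 1 then (q, q - (fst x - r) + q) else (fst x - r - q, q))"
    by (auto simp: embed_def inflate_def prod_eq_iff)
  then show ?thesis using that by blast
qed

definition level :: "int \<Rightarrow> int \<Rightarrow> (int \<times> int \<Rightarrow> int) \<Rightarrow> bool" where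
  "level r l s \<longleftrightarrow> r \<in> {0, 1, 2} \<and> (l = 1 \<or> l = -1) \<and>
     (\<forall>x. csum x mod 3 = (r + 1) mod 3 \<longrightarrow> s x = l) \<and> (\<forall>x. csum x mod 3 = (r + 2) mod 3 \<longrightarrow> s x = - l)"

lemma levelD:
  assumes "level r l s"
  shows "r \<in> {0, 1, 2}" "l = 1 \<or> l = -1" "csum x mod 3 = (r + 1) mod 3 \<Longrightarrow> s x = l"
    "csum x mod 3 = (r + 2) mod 3 \<Longrightarrow> s x = - l"
  using assms unfolding level_def by blast+

text \<open>The turns \<open>l\<close> and \<open>- l\<close> at the two intermediate vertices
  cancel. So the directions keep their labels, and three steps of \<open>s\<close> are one step of
  the rescaled function.\<close>

lemma embed_orbit_step:
  assumes "level r l s" "signs s"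
  shows "nx s (nx s (nx s (embed r l x, d))) =
    (embed r l (x + dvec d), trn (s (embed r l (x + dvec d))) d)"
proof -
  note lv = levelD[OF assms(1)]
  let ?x = "embed r l x"
  have x: "csum ?x mod 3 = r mod 3" by (rule csum_embed)
  have 1: "nx s (?x, d) = (?x + dvec d, trn l d)"
    using lv(3)[of "?x + dvec d"] csum_step(1)[OF x] by (simp add: nx_def)
  have y: "csum (?x + dvec d) mod 3 = (r + 1) mod 3" by (rule csum_step(1)[OF x])
  have "csum (?x + dvec d + dvec (trn l d)) mod 3 = (r + 2) mod 3"
    using csum_step(1)[OF y, of "trn l d"] by (simp only: add.assoc one_add_one)
  then have sz: "s (?x + dvec d + dvec (trn l d)) = - l" by (rule lv(4))
  have 2: "nx s (?x + dvec d, trn l d) = (?x + dvec d + dvec (trn l d), d)"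
    by (simp add: nx_def sz lv(2))
  have "?x + dvec d + dvec (trn l d) + dvec d = embed r l (x + dvec d)"
    using inflate_dvec[OF lv(2), of d] by (simp add: embed_def inflate_add add.assoc)
  then have 3: "nx s (?x + dvec d + dvec (trn l d), d) =
      (embed r l (x + dvec d), trn (s (embed r l (x + dvec d))) d)" by (simp add: nx_def)
  show ?thesis unfolding 1 2 3 ..
qed

lemma embed_orbit:
  assumes "level r l s" "signs s" "orbit s E" "orbit (\<lambda>x. s (embed r l x)) E'"
    and "E m = (embed r l (fst (E' 0)), snd (E' 0))"
  shows "E (3 * k + m) = (embed r l (fst (E' k)), snd (E' k))"
proof -
  have "E (3 * (k + 1) + m) = (nx s ^^ 3) (E (3 * k + m))" for k
  proof -
    have "E (3 * k + m + 1) = nx s (E (3 * k + m))" "E (3 * k + m + 1 + 1) = nx s (E (3 * k + m + 1))"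
      "E (3 * k + m + 1 + 1 + 1) = nx s (E (3 * k + m + 1 + 1))"
      by (rule orbitD[OF assms(3)])+
    moreover have "3 * (k + 1) + m = 3 * k + m + 1 + 1 + 1" by simp
    ultimately show ?thesis by (simp only: numeral_3_eq_3 funpow.simps comp_apply id_apply)
  qed
  moreover have "(embed r l (fst (E' (k + 1))), snd (E' (k + 1))) =
      (nx s ^^ 3) (embed r l (fst (E' k)), snd (E' k))" for k
    unfolding numeral_3_eq_3 funpow.simps comp_apply id_apply embed_orbit_step[OF assms(1,2)]
    by (simp add: orbitD[OF assms(4), of k] nx_def)
  moreover have "inj (nx s ^^ 3)" using inj_nx[OF assms(2)] by (rule inj_fn)
  ultimately show ?thesis
    using int_recursion_unique[of "\<lambda>k. E (3 * k + m)" "nx s ^^ 3"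
      "\<lambda>k. (embed r l (fst (E' k)), snd (E' k))" 0 k] assms(5) by simp
qed

text \<open>As the type is the same everywhere, it fixes the signs on two classes over the whole
  lattice. On the third class, the vertices of a strand of the rescaled function are every third
  vertex of a strand of \<open>s\<close>.\<close>

lemma folding_level:
  assumes "folding \<S> s" and sg: "\<And>L. L \<in> \<S> \<Longrightarrow> sign_sequence L"
  obtains r l where "level r l s" "l \<in> (\<lambda>L. L 1) ` \<S>" "folding (tl_seq ` \<S>) (\<lambda>x. s (embed r l x))"
proof -
  obtain ty where ty: "typed s ty" and ht: "\<And>e. has_type \<S> s (ty e) e"
    using folding_typed[OF assms] by metis
  have s: "signs s" by (rule typedD(1)[OF ty])
  define r l where "r = fst (ty ((0, 0), E0))" "l = snd (ty ((0, 0), E0))"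
  have t: "ty e = (r, l)" for e using types_const[OF ty, of e "((0, 0), E0)"] by (simp add: r_l_def)
  have rl: "r \<in> {0, 1, 2}" "l = 1 \<or> l = -1" using typedD(3,4)[OF ty] by (simp_all add: r_l_def)
  have lv: "level r l s" unfolding level_def
  proof (intro conjI allI impI)
    fix x assume "csum x mod 3 = (r + 1) mod 3"
    then show "s x = l" using typedD(5)[OF ty, of "(x, E0)" "csum x"] by (simp add: t sat_def)
  next
    fix x assume "csum x mod 3 = (r + 2) mod 3"
    then show "s x = - l" using typedD(5)[OF ty, of "(x, E0)" "csum x"] by (simp add: t sat_def)
  qed (use rl in auto)
  have "l \<in> (\<lambda>L. L 1) ` \<S>" using ht[of "((0, 0), E0)"] by (simp add: has_type_def t)
  moreover have "folding (tl_seq ` \<S>) (\<lambda>x. s (embed r l x))" unfolding folding_def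
  proof (intro conjI allI impI)
    show "signs (\<lambda>x. s (embed r l x))" using s unfolding signs_def by blast
    fix E' assume E': "orbit (\<lambda>x. s (embed r l x)) E'"
    obtain E where E: "orbit s E" "E 0 = (embed r l (fst (E' 0)), snd (E' 0))" by (rule orbit_exists[OF s])
    have "csum (fst (E 0)) mod 3 = r" using csum_embed[of r l] rl(1) by (auto simp: E(2))
    then have "FS (tl_seq ` \<S>) (\<lambda>k. s (fst (E (3 * k + 0))))"
      using has_type_FS[OF s ht E(1), of 0] by (simp add: t)
    then show "FS (tl_seq ` \<S>) (\<lambda>k. s (embed r l (fst (E' k))))"
      using embed_orbit[OF lv s E(1) E' E(2)] by simp
  qed
  ultimately show ?thesis using that lv by blast
qed

text \<open>\<open>f n\<close> is the restriction to the \<open>n\<close>-th nested sublattice,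
  rescaled to the full lattice, and \<open>r n\<close> is the class chosen there. Folding is no
  longer mentioned: the levels alone are compared later.\<close>

definition hierarchy :: "(nat \<Rightarrow> int) \<Rightarrow> (int \<times> int \<Rightarrow> int) \<Rightarrow> bool" where
  "hierarchy L s \<longleftrightarrow> (\<exists>f r. f 0 = s \<and>
     (\<forall>n. level (r n) (L (Suc n)) (f n) \<and> f (Suc n) = (\<lambda>x. f n (embed (r n) (L (Suc n)) x))))"

lemma hierarchyE:
  assumes "hierarchy L s"
  obtains r where "level r (L 1) s" "hierarchy (tl_seq L) (\<lambda>x. s (embed r (L 1) x))"
proof -
  obtain f r where f: "f 0 = s" "\<And>n. level (r n) (L (Suc n)) (f n)"
    "\<And>n. f (Suc n) = (\<lambda>x. f n (embed (r n) (L (Suc n)) x))"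
    using assms unfolding hierarchy_def by blast
  have "hierarchy (tl_seq L) (\<lambda>x. s (embed (r 0) (L 1) x))" unfolding hierarchy_def
    using f(1) f(2,3)[of "Suc _"] f(3)[of 0]
    by (intro exI[of _ "\<lambda>n. f (Suc n)"] exI[of _ "\<lambda>n. r (Suc n)"]) (simp add: tl_seq_def)
  with f(1) f(2)[of 0] show ?thesis using that by simp
qed

text \<open>\<open>T n\<close> collects the tails after \<open>n\<close> entries. The entries of
  \<open>L\<close> may come from different members of \<open>\<S>\<close>; for a singleton they are
  pinned down.\<close>

lemma folding_hierarchy:
  assumes "folding \<S> s" and sg: "\<And>L. L \<in> \<S> \<Longrightarrow> sign_sequence L"
  obtains L where "hierarchy L s" "\<And>n. \<exists>L'\<in>\<S>. L (Suc n) = L' (Suc n)"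
proof -
  define T where "T n = (tl_seq ^^ n) ` \<S>" for n
  have T: "T (Suc n) = tl_seq ` T n" for n by (simp add: T_def image_comp)
  have tln: "(tl_seq ^^ n) L = (\<lambda>k. L (k + n))" for n L
    by (induction n) (auto simp: tl_seq_def)
  have Tsg: "sign_sequence L" if L: "L \<in> T n" for L n
  proof -
    obtain L' where "L' \<in> \<S>" "L = (\<lambda>k. L' (k + n))" using L unfolding T_def tln by blast
    with sg[of L'] show ?thesis by (simp add: sign_sequence_def trans_le_add1)
  qed
  define Q where "Q n f f' rl \<longleftrightarrow> level (fst rl) (snd rl) f \<and> snd rl \<in> (\<lambda>L. L 1) ` T n \<and>
    f' = (\<lambda>x. f (embed (fst rl) (snd rl) x))" for n f f' and rl :: "int \<times> int"
  have "\<exists>f. f 0 = s \<and> (\<forall>n. folding (T n) (f n) \<and> (\<exists>rl. Q n (f n) (f (Suc n)) rl))"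
  proof -
    have "folding (T 0) s" using assms(1) by (simp add: T_def)
    moreover have "\<exists>f'. folding (T (Suc n)) f' \<and> (\<exists>rl. Q n f f' rl)" if fo: "folding (T n) f" for n f
    proof -
      obtain r l where "level r l f" "l \<in> (\<lambda>L. L 1) ` T n" "folding (tl_seq ` T n) (\<lambda>x. f (embed r l x))"
        by (rule folding_level[OF fo Tsg])
      then show ?thesis unfolding T Q_def
        by (intro exI[of _ "\<lambda>x. f (embed r l x)"] conjI exI[of _ "(r, l)"]) auto
    qed
    \<comment> \<open>The clause for \<open>n = 0\<close> makes the dependent choice start at
      \<open>s\<close>.\<close>
    ultimately show ?thesis
      using dependent_nat_choice[of "\<lambda>n f. folding (T n) f \<and> (n = 0 \<longrightarrow> f = s)" "\<lambda>n f f'. \<exists>rl. Q n f f' rl"]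
      by (metis nat.distinct(1))
  qed
  then obtain f where f: "f 0 = s" "\<And>n. \<exists>rl. Q n (f n) (f (Suc n)) rl" by blast
  then obtain rl where rl: "\<And>n. Q n (f n) (f (Suc n)) (rl n)" by metis
  \<comment> \<open>Sequences start at index 1, so \<open>rl n\<close> supplies the entry
    \<open>L (Suc n)\<close>.\<close>
  define L where "L n = snd (rl (n - 1))" for n
  have "hierarchy L s" unfolding hierarchy_def
    using f(1) rl unfolding Q_def by (intro exI[of _ f] exI[of _ "\<lambda>n. fst (rl n)"]) (simp add: L_def)
  moreover have "\<exists>L'\<in>\<S>. L (Suc n) = L' (Suc n)" for n
    using rl[of n] unfolding Q_def T_def tln by (auto simp: L_def)
  ultimately show ?thesis using that by blast
qed

lemma hierarchy_cong: "hierarchy L s \<Longrightarrow> (\<And>n. L (Suc n) = L' (Suc n)) \<Longrightarrow> hierarchy L' s"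
  unfolding hierarchy_def by simp

lemma hierarchy_sign: "hierarchy L s \<Longrightarrow> sign_sequence L"
  unfolding hierarchy_def sign_sequence_def level_def by (metis Suc_pred' insertCI less_eq_Suc_le One_nat_def)

text \<open>Two classes are settled at the first level and the third by the rescaled strand, so each
  level reduces the undetermined indices to a third; after \<open>n\<close> levels they form one
  residue class modulo \<open>3 ^ n\<close>.\<close>

lemma hierarchy_tau:
  assumes "hierarchy L s" "signs s" "orbit s E"
  shows "\<exists>p. \<forall>k. \<not> 3 ^ n dvd k - p \<longrightarrow> s (fst (E k)) = tau L (k - p)"
  using assms
proof (induction n arbitrary: L s E)
  case (Suc n)
  obtain r where r: "level r (L 1) s" "hierarchy (tl_seq L) (\<lambda>x. s (embed r (L 1) x))"
    by (rule hierarchyE[OF Suc.prems(1)])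
  let ?s = "\<lambda>x. s (embed r (L 1) x)"
  have s': "signs ?s" using Suc.prems(2) unfolding signs_def by blast
  note lv = levelD[OF r(1)]
  \<comment> \<open>The class grows by one per step, so this index leads to a vertex of class
    \<open>r\<close>.\<close>
  define m where "m = r - csum (fst (E 0))"
  have m: "csum (fst (E m)) mod 3 = r mod 3"
    using orbit_csum[OF Suc.prems(3), of 0 m] by (simp add: m_def)
  obtain y where y: "fst (E m) = embed r (L 1) y" by (rule embed_surj[OF m])
  obtain E' where E': "orbit ?s E'" "E' 0 = (y, snd (E m))" by (rule orbit_exists[OF s'])
  have EE: "E (3 * k + m) = (embed r (L 1) (fst (E' k)), snd (E' k))" for k
    by (rule embed_orbit[OF r(1) Suc.prems(2,3) E'(1)])
      (simp only: E'(2) fst_conv snd_conv y[symmetric] prod.collapse)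
  obtain p where p: "\<And>k. \<not> 3 ^ n dvd k - p \<Longrightarrow> ?s (fst (E' k)) = tau (tl_seq L) (k - p)"
    using Suc.IH[OF r(2) s' E'(1)] by blast
  have "s (fst (E k)) = tau L (k - (3 * p + m))" if k: "\<not> 3 ^ Suc n dvd k - (3 * p + m)" for k
  proof -
    have ck: "csum (fst (E k)) mod 3 = (r + (k - m)) mod 3"
      using orbit_csum[OF Suc.prems(3), of m "k - m"] mod_add_cong[OF m refl, of "k - m"] by simp
    have eq: "k - (3 * p + m) = k - m + 3 * (- p)" by simp
    show ?thesis
    proof (cases "k - m" rule: mod3_cases)
      case 0
      then obtain q where q: "k = 3 * q + m" by (metis add.commute diff_add_cancel mod_0_imp_dvd dvdE)
      have kq: "k - (3 * p + m) = 3 * (q - p)" by (simp add: q)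
      have np: "\<not> 3 ^ n dvd q - p" using k unfolding kq power_Suc by (simp only: dvd_mult_cancel_left) simp
      then have "q - p \<noteq> 0" by (metis dvd_0_right)
      then have "tau L (k - (3 * p + m)) = tau (tl_seq L) (q - p)" unfolding kq by (rule tau_3)
      then show ?thesis using p[OF np] EE[of q] by (simp add: q)
    next
      case 1
      have "(k - (3 * p + m)) mod 3 = 1" unfolding eq using 1 by (simp only: mod_mult_self2)
      moreover have "csum (fst (E k)) mod 3 = (r + 1) mod 3"
        unfolding ck by (rule mod_add_cong[OF refl]) (simp add: 1)
      ultimately show ?thesis using lv(3) by (simp add: tau_1)
    next
      case 2
      have "(k - (3 * p + m)) mod 3 = 2" unfolding eq using 2 by (simp only: mod_mult_self2)
      moreover have "csum (fst (E k)) mod 3 = (r + 2) mod 3"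
        unfolding ck by (rule mod_add_cong[OF refl]) (simp add: 2)
      ultimately show ?thesis using lv(4) by (simp add: tau_2)
    qed
  qed
  then show ?case by blast
qed simp

text \<open>A short window meets the undetermined residue class modulo \<open>3 ^ n\<close> at most
  once. Off this class the window may be moved along \<open>tau\<close> by multiples of
  \<open>3 ^ n\<close>; the move is chosen to put the exceptional index on an entry of the required
  sign, with \<open>j\<close> beyond \<open>N\<close>.\<close>

lemma tau_window:
  fixes a :: "int \<Rightarrow> int"
  assumes "\<And>n. \<exists>p. \<forall>k. \<not> 3 ^ n dvd k - p \<longrightarrow> a k = tau L (k - p)" "\<And>k. a k = 1 \<or> a k = -1"
    "sign_sequence L"
  obtains j where "N < j" "\<And>k. \<bar>k\<bar> \<le> N \<Longrightarrow> a k = tau L (j + k)"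
proof -
  \<comment> \<open>Two indices of the window differ by at most \<open>2 * N\<close>, which has to
    stay below \<open>3 ^ n\<close>.\<close>
  define n where "n = nat (2 * \<bar>N\<bar> + 1)"
  have "n < 3 ^ n" using less_le_trans[OF less_exp[of n] power_mono[of 2 "3::nat" n]] by simp
  then have "int n < int (3 ^ n)" by (simp only: of_nat_less_iff)
  then have n: "2 * \<bar>N\<bar> < 3 ^ n" by (simp add: n_def)
  obtain p where p: "\<And>k. \<not> 3 ^ n dvd k - p \<Longrightarrow> a k = tau L (k - p)" using assms(1) by blast
  have pos: "0 < (3::int) ^ n" by simp
  have far: "\<exists>q. N < 3 ^ n * (3 * q + i) - p" for i
  proof
    have "\<bar>N\<bar> + \<bar>p\<bar> + \<bar>i\<bar> + 1 \<le> 3 ^ n * (\<bar>N\<bar> + \<bar>p\<bar> + \<bar>i\<bar> + 1)" 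
      using mult_right_mono[of 1 "3 ^ n" "\<bar>N\<bar> + \<bar>p\<bar> + \<bar>i\<bar> + 1"] by simp
    also have "\<dots> \<le> 3 ^ n * (3 * (\<bar>N\<bar> + \<bar>p\<bar> + \<bar>i\<bar> + 1) + i)" using pos by (intro mult_left_mono) auto
    finally show "N < 3 ^ n * (3 * (\<bar>N\<bar> + \<bar>p\<bar> + \<bar>i\<bar> + 1) + i) - p" by linarith
  qed
  have main: "a k = tau L (3 ^ n * q - p + k)" if "\<not> 3 ^ n dvd k - p" for k q
    using p[OF that] tau_period[OF that, of L q] by (simp add: algebra_simps)
  show ?thesis
  proof (cases "\<exists>k0. \<bar>k0\<bar> \<le> N \<and> 3 ^ n dvd k0 - p")
    case False
    obtain q where "N < 3 ^ n * (3 * q + 0) - p" using far by blast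
    then show ?thesis using that[of "3 ^ n * (3 * q + 0) - p"] main False by blast
  next
    case True
    then obtain k0 z where k0: "\<bar>k0\<bar> \<le> N" and z: "k0 - p = 3 ^ n * z" by (auto elim: dvdE)
    have uniq: "k = k0" if "\<bar>k\<bar> \<le> N" "3 ^ n dvd k - p" for k
    proof (rule ccontr)
      assume "k \<noteq> k0"
      have "3 ^ n dvd k0 - p" by (simp add: z)
      then have "3 ^ n dvd (k - p) - (k0 - p)" by (rule dvd_diff[OF that(2)])
      then have "3 ^ n \<le> \<bar>k - k0\<bar>" using \<open>k \<noteq> k0\<close> by (intro zdvd_imp_le) auto
      with n that(1) k0 show False by linarith
    qed
    have "a k0 = L (Suc n) \<or> a k0 = - L (Suc n)" using assms(2)[of k0] sign_1[OF assms(3), of n] by auto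
    then obtain i where i: "\<And>q. tau L (3 ^ n * (3 * q + i)) = a k0" using tau_pow[of L n] by metis
    \<comment> \<open>The exceptional index is \<open>p + 3 ^ n * z\<close>; subtracting
      \<open>z\<close> makes it land on \<open>3 ^ n * (3 * q + i)\<close>.\<close>
    obtain q where q: "N < 3 ^ n * (3 * q + (i - z)) - p" using far by blast
    have "a k = tau L (3 ^ n * (3 * q + (i - z)) - p + k)" if k: "\<bar>k\<bar> \<le> N" for k
    proof (cases "k = k0")
      case True
      have "3 ^ n * (3 * q + (i - z)) - p + k0 = 3 ^ n * (3 * q + i)" using z by (simp add: algebra_simps)
      then show ?thesis using i True by simp
    next
      case False
      then show ?thesis using main uniq k by blast
    qed
    with q that show ?thesis by blast
  qed
qed

lemma hierarchy_window:
  assumes "hierarchy L s" "signs s" "orbit s E"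
  obtains j where "N < j" "\<And>k. \<bar>k\<bar> \<le> N \<Longrightarrow> s (fst (E k)) = tau L (j + k)"
  by (rule tau_window[of "\<lambda>k. s (fst (E k))" L N])
    (use hierarchy_tau[OF assms] signsD[OF assms(2)] hierarchy_sign[OF assms(1)] in auto)

section \<open>Agreement of two hierarchies up to translation\<close>

definition norm_sq :: "int \<times> int \<Rightarrow> int" where
  "norm_sq x = fst x * fst x - fst x * snd x + snd x * snd x"

text \<open>\<open>norm_sq\<close> is the squared modulus of \<open>a + b * \<omega>\<close>, and
  both multipliers have squared modulus 3.\<close>

lemma norm_sq_inflate: "norm_sq (inflate l x) = 3 * norm_sq x"
  by (auto simp: norm_sq_def inflate_def algebra_simps)

lemma norm_sq_pos: "x \<noteq> 0 \<Longrightarrow> 1 \<le> norm_sq x"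
proof -
  assume "x \<noteq> 0"
  have "4 * norm_sq x = (2 * fst x - snd x) * (2 * fst x - snd x) + 3 * (snd x * snd x)"
    by (simp add: norm_sq_def algebra_simps)
  moreover have "0 < (2 * fst x - snd x) * (2 * fst x - snd x) + 3 * (snd x * snd x)"
    using \<open>x \<noteq> 0\<close> by (cases "snd x = 0")
      (auto simp: prod_eq_iff zero_less_mult_iff intro!: add_pos_nonneg add_nonneg_pos)
  ultimately show ?thesis by linarith
qed

text \<open>Here \<open>Z\<close> and \<open>W\<close> are the vertices of \<open>s\<close> and \<open>t\<close> that are left undetermined by the first
  \<open>n\<close> levels.\<close>

definition matching where
  "matching n s t Z W \<longleftrightarrow> (\<forall>z\<in>Z. \<forall>z'\<in>Z. z \<noteq> z' \<longrightarrow> 3 ^ n \<le> norm_sq (z - z')) \<and> Z \<noteq> {} \<and>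
    (\<forall>z\<in>Z. \<forall>w\<in>W. \<forall>x. x \<notin> Z \<longrightarrow> s x = t (x + (w - z))) \<and>
    (\<exists>w\<in>W. t w = (1 :: int)) \<and> (\<exists>w\<in>W. t w = -1)"

lemma matchingD:
  assumes "matching n s t Z W"
  shows "z \<in> Z \<Longrightarrow> z' \<in> Z \<Longrightarrow> z \<noteq> z' \<Longrightarrow> 3 ^ n \<le> norm_sq (z - z')" "Z \<noteq> {}"
    "z \<in> Z \<Longrightarrow> w \<in> W \<Longrightarrow> x \<notin> Z \<Longrightarrow> s x = t (x + (w - z))"
    "\<exists>w\<in>W. t w = 1" "\<exists>w\<in>W. t w = -1"
  using assms unfolding matching_def by blast+

text \<open>At the start nothing is determined, and \<open>Z\<close> and \<open>W\<close> are the
  whole lattice. A level fixes the signs off one class, so \<open>Z\<close> and \<open>W\<close>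
  become the embedded sets of the rescaled functions, with squared distances multiplied by 3. Both
  signs occur on \<open>W\<close> because they occur in the last rescaled function.\<close>

lemma hierarchy_match:
  assumes "hierarchy L s" "hierarchy L t"
  shows "\<exists>Z W. matching n s t Z W"
  using assms
proof (induction n arbitrary: L s t)
  case 0
  obtain r where r: "level r (L 1) t" by (rule hierarchyE[OF 0(2)])
  note lv = levelD[OF r]
  have "t (r + 1, 0) = L 1" "t (r + 2, 0) = - L 1" using lv(3,4) by simp_all
  then have "(\<exists>w. t w = 1) \<and> (\<exists>w. t w = -1)" using lv(2) by (metis minus_minus)
  moreover have "1 \<le> norm_sq (z - z')" if "z \<noteq> z'" for z z'
    using norm_sq_pos[of "z - z'"] that by simp
  ultimately show ?case unfolding matching_def by (intro exI[of _ UNIV] conjI) simp_all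
next
  case (Suc n)
  obtain r where r: "level r (L 1) s" "hierarchy (tl_seq L) (\<lambda>x. s (embed r (L 1) x))"
    by (rule hierarchyE[OF Suc.prems(1)])
  obtain r' where r': "level r' (L 1) t" "hierarchy (tl_seq L) (\<lambda>x. t (embed r' (L 1) x))"
    by (rule hierarchyE[OF Suc.prems(2)])
  let ?g = "embed r (L 1)" and ?h = "embed r' (L 1)"
  obtain Z W where m: "matching n (\<lambda>x. s (?g x)) (\<lambda>x. t (?h x)) Z W"
    using Suc.IH[OF r(2) r'(2)] by (elim exE)
  note Z = matchingD(1,2)[OF m] and ZW = matchingD(3)[OF m] and W = matchingD(4,5)[OF m]
  have gh: "?h w - ?g z = (r' - r, 0) + inflate (L 1) (w - z)" for w z
    by (simp add: embed_def inflate_diff)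
  have "3 ^ Suc n \<le> norm_sq (?g z - ?g z')" if "z \<in> Z" "z' \<in> Z" "z \<noteq> z'" for z z'
  proof -
    have "?g z - ?g z' = inflate (L 1) (z - z')" by (simp add: embed_def inflate_diff)
    then show ?thesis using Z(1)[OF that] by (simp add: norm_sq_inflate)
  qed
  then have 1: "\<forall>z\<in>?g ` Z. \<forall>z'\<in>?g ` Z. z \<noteq> z' \<longrightarrow> 3 ^ Suc n \<le> norm_sq (z - z')" by blast
  have 2: "s x = t (x + (?h w - ?g z))" if zw: "z \<in> Z" "w \<in> W" and x: "x \<notin> ?g ` Z" for z w x
  proof (cases "csum x mod 3 = r mod 3")
    case True
    obtain y where y: "x = ?g y" by (rule embed_surj[OF True])
    have "x + (?h w - ?g z) = ?h (y + (w - z))" unfolding gh y by (simp add: embed_def inflate_add)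
    then show ?thesis using ZW[OF zw, of y] x y by auto
  next
    case False
    have ch: "csum (?h w - ?g z) mod 3 = (r' - r) mod 3"
      using mod_diff_cong[OF csum_embed[of r' "L 1" w] csum_embed[of r "L 1" z]] by simp
    have c: "csum (x + (?h w - ?g z)) mod 3 = (r' + i) mod 3" if "csum x mod 3 = (r + i) mod 3" for i
      using mod_add_cong[OF that ch] by (simp add: algebra_simps)
    have "csum x mod 3 \<in> {0, 1, 2}" by auto
    with False levelD(1)[OF r(1)] have "csum x mod 3 = (r + 1) mod 3 \<or> csum x mod 3 = (r + 2) mod 3"
      by auto
    then show ?thesis
    proof
      assume x: "csum x mod 3 = (r + 1) mod 3"
      show ?thesis unfolding levelD(3)[OF r(1) x] levelD(3)[OF r'(1) c[OF x]] ..
    next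
      assume x: "csum x mod 3 = (r + 2) mod 3"
      show ?thesis unfolding levelD(4)[OF r(1) x] levelD(4)[OF r'(1) c[OF x]] ..
    qed
  qed
  have "matching (Suc n) s t (?g ` Z) (?h ` W)"
    unfolding matching_def
  proof (intro conjI)
    show "\<forall>z\<in>?g ` Z. \<forall>w\<in>?h ` W. \<forall>x. x \<notin> ?g ` Z \<longrightarrow> s x = t (x + (w - z))"
      by (intro ballI allI impI, elim imageE, hypsubst, rule 2) assumption+
    show "\<forall>z\<in>?g ` Z. \<forall>z'\<in>?g ` Z. z \<noteq> z' \<longrightarrow> 3 ^ Suc n \<le> norm_sq (z - z')" by (rule 1)
    show "?g ` Z \<noteq> {}" using Z(2) by blast
    show "\<exists>w\<in>?h ` W. t w = 1" "\<exists>w\<in>?h ` W. t w = -1" using W by blast+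
  qed
  then show ?case by blast
qed

text \<open>Once \<open>3 ^ n\<close> exceeds the squared diameter of \<open>X\<close>, at most one
  point of \<open>X\<close> is undetermined, and the choice of \<open>w\<close> matches the sign
  there.\<close>

lemma hierarchy_translate:
  assumes "hierarchy L s" "hierarchy L t" "signs s" "finite X"
  obtains v where "\<And>x. x \<in> X \<Longrightarrow> s x = t (x + v)"
proof -
  define M where "M = Max (insert 0 ((\<lambda>(x, y). norm_sq (x - y)) ` (X \<times> X)))"
  have M: "norm_sq (x - y) \<le> M" if "x \<in> X" "y \<in> X" for x y
    unfolding M_def using that assms(4) by (intro Max_ge) auto
  define n where "n = nat M"
  have "n < 3 ^ n" using less_le_trans[OF less_exp[of n] power_mono[of 2 "3::nat" n]] by simp
  then have "int n < int (3 ^ n)" by (simp only: of_nat_less_iff)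
  then have "int n < 3 ^ n" by (simp only: of_nat_power of_nat_numeral)
  moreover have "M \<le> int n" by (simp add: n_def)
  ultimately have n: "M < 3 ^ n" by linarith
  obtain Z W where m: "matching n s t Z W" using hierarchy_match[OF assms(1,2)] by metis
  note Z = matchingD(1,2)[OF m] and ZW = matchingD(3)[OF m] and W = matchingD(4,5)[OF m]
  obtain z where z: "z \<in> Z" "X \<inter> Z \<subseteq> {z}"
  proof (cases "X \<inter> Z = {}")
    case True
    then show ?thesis using Z(2) that by blast
  next
    case False
    then obtain z where z: "z \<in> X" "z \<in> Z" by blast
    have "z' = z" if "z' \<in> X" "z' \<in> Z" for z'
      using Z(1)[OF that(2) z(2)] M[OF that(1) z(1)] n by linarith
    then show ?thesis using that z by blast
  qed
  obtain w where w: "w \<in> W" "t w = s z" using W signsD[OF assms(3), of z] by metis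
  have "s x = t (x + (w - z))" if "x \<in> X" for x
  proof (cases "x \<in> Z")
    case True
    then have "x = z" using z(2) that by blast
    then show ?thesis using w(2) by simp
  next
    case False
    then show ?thesis by (rule ZW[OF z(1) w(1)])
  qed
  then show ?thesis using that by blast
qed

section \<open>Curves in the plane\<close>

definition omega :: complex where
  "omega = Complex (- 1 / 2) (sqrt 3 / 2)"

lemma omega_sq: "omega * omega = - 1 - omega"
  by (simp add: omega_def complex_eq_iff)

lemma cis_third: "cis (pi / 3) = 1 + omega" "cis (- pi / 3) = - omega"
  by (simp_all add: omega_def complex_eq_iff cos_60 sin_60)

fun dirc :: "dir \<Rightarrow> complex" where
  "dirc E0 = 1" | "dirc E1 = omega" | "dirc E2 = - 1 - omega"

lemma dirc_rot: "dirc (rot d) = omega * dirc d"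
proof (cases d)
  case E2
  have "omega * (- 1 - omega) = - omega - omega * omega" by (simp add: algebra_simps)
  then show ?thesis by (simp add: E2 omega_sq)
qed (simp_all add: omega_sq)

lemma dirc_rot2: "dirc (rot (rot d)) = - (1 + omega) * dirc d"
  unfolding dirc_rot mult.assoc[symmetric] omega_sq by (simp add: algebra_simps)

lemma dirc_nonzero: "dirc d \<noteq> 0"
  by (cases d) (simp_all add: omega_def complex_eq_iff)

lemma dirc_neq_minus: "dirc d \<noteq> - dirc d'"
  by (cases d; cases d') (simp_all add: omega_def complex_eq_iff)

locale plane_lattice =
  fixes c u :: complex
  assumes u: "u \<noteq> 0"
begin

text \<open>Real coordinates with respect to \<open>u\<close> and \<open>omega * u\<close>; points
  of a drawing are located by comparing integer and fractional parts.\<close>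

definition pt :: "real \<Rightarrow> real \<Rightarrow> complex" where
  "pt \<alpha> \<beta> = c + (of_real \<alpha> + of_real \<beta> * omega) * u"

definition pos :: "int \<times> int \<Rightarrow> complex" where
  "pos x = pt (of_int (fst x)) (of_int (snd x))"

definition side :: "(int \<times> int) \<times> dir \<Rightarrow> oside" where
  "side e = (pos (fst e), pos (fst e + dvec (snd e)))"

lemma coords_eq: "(of_real \<alpha> + of_real \<beta> * omega) * u = (of_real \<alpha>' + of_real \<beta>' * omega) * u \<longleftrightarrow> \<alpha> = \<alpha>' \<and> \<beta> = \<beta>'"
proof -
  have "(of_real \<alpha> + of_real \<beta> * omega) * u = (of_real \<alpha>' + of_real \<beta>' * omega) * u \<longleftrightarrow>
      of_real \<alpha> + of_real \<beta> * omega = of_real \<alpha>' + of_real \<beta>' * omega"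
    using u by simp
  also have "\<dots> \<longleftrightarrow> \<alpha> = \<alpha>' \<and> \<beta> = \<beta>'" by (auto simp: omega_def complex_eq_iff)
  finally show ?thesis .
qed

lemma pt_eq [simp]: "pt \<alpha> \<beta> = pt \<alpha>' \<beta>' \<longleftrightarrow> \<alpha> = \<alpha>' \<and> \<beta> = \<beta>'"
  using coords_eq by (simp add: pt_def)

lemma pos_eq [simp]: "pos x = pos y \<longleftrightarrow> x = y"
  by (simp add: pos_def prod_eq_iff)

lemma pos_dvec: "pos (x + dvec d) = pos x + dirc d * u"
  by (cases d) (simp_all add: pos_def pt_def algebra_simps)

lemma side_eq [simp]: "side e = side e' \<longleftrightarrow> e = e'"
proof
  assume "side e = side e'"
  then have "fst e = fst e'" "dvec (snd e) = dvec (snd e')" by (auto simp: side_def)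
  moreover have "dvec d = dvec d' \<Longrightarrow> d = d'" for d d' by (cases d; cases d') auto
  ultimately show "e = e'" by (simp add: prod_eq_iff)
qed simp

lemma side_neq_swap: "side e \<noteq> prod.swap (side e')"
proof
  assume "side e = prod.swap (side e')"
  then have "pos (fst e) = pos (fst e' + dvec (snd e')) \<and> pos (fst e + dvec (snd e)) = pos (fst e')"
    by (simp only: side_def swap_simp prod.inject)
  then have h: "fst e = fst e' + dvec (snd e')" "fst e + dvec (snd e) = fst e'"
    unfolding pos_eq by blast+
  from h(2)[unfolded h(1)] have "fst e' + (dvec (snd e') + dvec (snd e)) = fst e' + 0"
    by (simp only: add.assoc add_0_right)
  then have "dvec (snd e') + dvec (snd e) = 0" by (rule add_left_imp_eq)
  then show False by (cases "snd e"; cases "snd e'") (auto simp: zero_prod_def)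
qed

definition tiling :: "complex set set" where
  "tiling = (\<Union>a::int. \<Union>b::int. let x = c + of_int a * u + of_int b * (cis (pi / 3) * u)
     in {{x, x + u, x + cis (pi / 3) * u}, {x, x + cis (pi / 3) * u, x + cis (pi / 3) * u - u}})"

lemma tiling: "tiling = (\<Union>x. {{pos x, pos (x + (1, 0)), pos (x + (1, 1))}, {pos x, pos (x + (1, 1)), pos (x + (0, 1))}})"
proof -
  \<comment> \<open>The tiling is given in the basis \<open>u\<close>,
    \<open>(1 + omega) * u\<close>, which accounts for the coordinates
    \<open>(a + b, b)\<close>.\<close>
  have "c + of_int a * u + of_int b * (cis (pi / 3) * u) = pos (a + b, b)"
    "pos x + u = pos (x + (1, 0))" "pos x + cis (pi / 3) * u = pos (x + (1, 1))"
    "pos x + cis (pi / 3) * u - u = pos (x + (0, 1))" for a b x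
    by (simp_all add: pos_def pt_def cis_third algebra_simps)
  then have "tiling = (\<Union>a. \<Union>b. {{pos (a + b, b), pos ((a + b, b) + (1, 0)), pos ((a + b, b) + (1, 1))},
      {pos (a + b, b), pos ((a + b, b) + (1, 1)), pos ((a + b, b) + (0, 1))}})"
    unfolding tiling_def Let_def by presburger
  also have "\<dots> = (\<Union>(a, b). {{pos (a + b, b), pos ((a + b, b) + (1, 0)), pos ((a + b, b) + (1, 1))},
      {pos (a + b, b), pos ((a + b, b) + (1, 1)), pos ((a + b, b) + (0, 1))}})" by blast
  also have "\<dots> = (\<Union>x\<in>range (\<lambda>(a, b). (a + b, b)). {{pos x, pos (x + (1, 0)), pos (x + (1, 1))},
      {pos x, pos (x + (1, 1)), pos (x + (0, 1))}})"
    by (simp add: image_image case_prod_unfold)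
  also have "range (\<lambda>(a, b). (a + b, b :: int)) = (UNIV :: (int \<times> int) set)"
  proof -
    have "x = (\<lambda>(a, b). (a + b, b)) (fst x - snd x, snd x)" for x :: "int \<times> int" by simp
    then show ?thesis by blast
  qed
  finally show ?thesis .
qed

lemma oriented_sides: "A \<in> oriented_sides tiling \<longleftrightarrow> (\<exists>e. A = side e \<or> A = prod.swap (side e))"
proof
  assume "A \<in> oriented_sides tiling"
  then obtain T where T: "T \<in> tiling" "fst A \<in> T" "snd A \<in> T" "fst A \<noteq> snd A"
    unfolding oriented_sides_def by auto
  obtain p q where A: "A = (p, q)" by (cases A)
  from T(1) obtain x where Tx: "T = {pos x, pos (x + (1, 0)), pos (x + (1, 1))} \<or> T = {pos x, pos (x + (1, 1)), pos (x + (0, 1))}"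
    unfolding tiling by blast
  have s: "side (x, E0) = (pos x, pos (x + (1, 0)))" "side (x, E1) = (pos x, pos (x + (0, 1)))"
    "side (x + (1, 0), E1) = (pos (x + (1, 0)), pos (x + (1, 1)))"
    "side (x + (1, 1), E2) = (pos (x + (1, 1)), pos x)"
    "side (x + (0, 1), E0) = (pos (x + (0, 1)), pos (x + (1, 1)))"
    by (cases x; simp add: side_def)+
  with T(2-4) Tx have "A \<in> {side (x, E0), side (x, E1), side (x + (1, 0), E1), side (x + (1, 1), E2), side (x + (0, 1), E0)} \<union>
      prod.swap ` {side (x, E0), side (x, E1), side (x + (1, 0), E1), side (x + (1, 1), E2), side (x + (0, 1), E0)}"
    unfolding s A by auto
  then show "\<exists>e. A = side e \<or> A = prod.swap (side e)" by blast
next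
  assume "\<exists>e. A = side e \<or> A = prod.swap (side e)"
  then obtain x d where e: "A = side (x, d) \<or> A = prod.swap (side (x, d))" by auto
  have t: "{pos z, pos (z + (1, 0)), pos (z + (1, 1))} \<in> tiling" "{pos z, pos (z + (1, 1)), pos (z + (0, 1))} \<in> tiling" for z
    unfolding tiling by blast+
  have "\<exists>T\<in>tiling. pos x \<in> T \<and> pos (x + dvec d) \<in> T"
  proof (cases d)
    case E0 show ?thesis by (rule bexI[OF _ t(1)[of x]]) (simp add: E0)
  next
    case E1 show ?thesis by (rule bexI[OF _ t(2)[of x]]) (simp add: E1)
  next
    case E2
    have "x = x + dvec d + (1, 1)" by (cases x) (simp add: E2)
    then have "pos x = pos (x + dvec d + (1, 1))" by (rule arg_cong)
    then show ?thesis by (intro bexI[OF _ t(1)[of "x + dvec d"]]) simp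
  qed
  moreover have "pos x \<noteq> pos (x + dvec d)" by (cases x; cases d) auto
  ultimately show "A \<in> oriented_sides tiling" using e unfolding oriented_sides_def side_def by auto
qed

lemma joins_swap: "joins A B \<Longrightarrow> joins (prod.swap B) (prod.swap A)"
proof -
  have cc: "cis (pi / 3) * cis (- pi / 3) = 1" by (simp add: cis_mult)
  assume "joins A B"
  then obtain z z' where z: "snd B - fst B = z * (fst A - snd A)" "z * z' = 1" "snd A = fst B"
     "(z = cis (pi / 3) \<and> z' = cis (- pi / 3)) \<or> (z = cis (- pi / 3) \<and> z' = cis (pi / 3))"
    unfolding joins_def using cc by (metis mult.commute)
  then have "fst A - snd A = z' * (snd B - fst B)" by (metis mult.assoc mult.commute mult_1)
  with z(3,4) show ?thesis by (auto simp: joins_def prod.swap_def)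
qed

lemma im_turn: "Im (cnj z * (k * z)) = Im k * (cmod z)\<^sup>2"
  unfolding cmod_power2 by (simp add: power2_eq_square algebra_simps)

lemma dirc_trn:
  "dirc (trn (-1) d) * u = (1 + omega) * (- dirc d * u)" "dirc (trn 1 d) * u = - omega * (- dirc d * u)"
  by (simp add: trn_def dirc_rot2 algebra_simps) (simp add: trn_def dirc_rot)

text \<open>Reversal negates the cross product, which has to be nonzero because \<open>turn\<close>
  counts zero as a right turn.\<close>

lemma turn_swap:
  assumes "joins A B" "fst A \<noteq> snd A"
  shows "turn (prod.swap B) (prod.swap A) = - turn A B"
proof -
  define D D' where "D = snd A - fst A" "D' = snd B - fst B"
  have "D' = - (1 + omega) * D \<or> D' = omega * D"
    using assms(1) unfolding joins_def cis_third D_D'_def by (auto simp: algebra_simps)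
  moreover have "D \<noteq> 0" using assms(2) by (simp add: D_D'_def)
  then have "Im (cnj D * (k * D)) \<noteq> 0" if "Im k \<noteq> 0" for k
    using that by (simp only: im_turn) simp
  moreover have "Im (- (1 + omega)) \<noteq> 0" "Im omega \<noteq> 0" by (simp_all add: omega_def)
  ultimately have "Im (cnj D * D') \<noteq> 0" by metis
  moreover have "Im (cnj (fst B - snd B) * (fst A - snd A)) = - Im (cnj D * D')"
    by (simp add: D_D'_def algebra_simps)
  ultimately show ?thesis unfolding turn_def D_D'_def by (simp add: prod.swap_def)
qed

text \<open>The direction is multiplied by \<open>omega\<close> or \<open>- (1 + omega)\<close>,
  both cube roots of unity, so the next side is again oriented along a cube root of unity.\<close>

lemma joins_side:
  assumes "joins (side e) B"
  obtains \<sigma> where "\<sigma> = 1 \<or> \<sigma> = -1" "B = side (fst e + dvec (snd e), trn \<sigma> (snd e))"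
proof -
  obtain p q where B: "B = (p, q)" by (cases B)
  have p: "p = pos (fst e + dvec (snd e))" using assms by (simp add: joins_def side_def B)
  have D: "pos (fst e) - pos (fst e + dvec (snd e)) = - dirc (snd e) * u" by (simp add: pos_dvec)
  have "q - p = (1 + omega) * (- dirc (snd e) * u) \<or> q - p = - omega * (- dirc (snd e) * u)"
    using assms unfolding joins_def cis_third B side_def fst_conv snd_conv D by blast
  then have "q - p = dirc (trn (-1) (snd e)) * u \<or> q - p = dirc (trn 1 (snd e)) * u"
    unfolding dirc_trn by blast
  then show ?thesis
  proof
    assume "q - p = dirc (trn (-1) (snd e)) * u"
    then have "q = p + dirc (trn (-1) (snd e)) * u" by (simp add: algebra_simps)
    then have "q = pos (fst e + dvec (snd e) + dvec (trn (-1) (snd e)))" by (simp only: p pos_dvec)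
    then show ?thesis using that[of "-1"] by (simp add: B p side_def)
  next
    assume "q - p = dirc (trn 1 (snd e)) * u"
    then have "q = p + dirc (trn 1 (snd e)) * u" by (simp add: algebra_simps)
    then have "q = pos (fst e + dvec (snd e) + dvec (trn 1 (snd e)))" by (simp only: p pos_dvec)
    then show ?thesis using that[of 1] by (simp add: B p side_def)
  qed
qed

lemma side_joins:
  assumes "\<sigma> = 1 \<or> \<sigma> = -1"
  shows "joins (side e) (side (fst e + dvec (snd e), trn \<sigma> (snd e)))"
    "turn (side e) (side (fst e + dvec (snd e), trn \<sigma> (snd e))) = \<sigma>"
proof -
  have d: "dirc (trn \<sigma> (snd e)) * u = (if \<sigma> = 1 then - omega else 1 + omega) * (- dirc (snd e) * u)"
    using assms dirc_trn by auto
  have D: "pos (fst e) - pos (fst e + dvec (snd e)) = - dirc (snd e) * u" by (simp add: pos_dvec)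
  have D': "pos (fst e + dvec (snd e) + dvec (trn \<sigma> (snd e))) - pos (fst e + dvec (snd e)) =
      (if \<sigma> = 1 then - omega else 1 + omega) * (- dirc (snd e) * u)"
    unfolding d[symmetric] by (simp add: pos_dvec)
  show "joins (side e) (side (fst e + dvec (snd e), trn \<sigma> (snd e)))"
    unfolding joins_def cis_third side_def fst_conv snd_conv D D' by simp
  define z where "z = dirc (snd e) * u"
  have "z \<noteq> 0" using dirc_nonzero u by (simp add: z_def)
  then have z: "0 < (cmod z)\<^sup>2" by simp
  have "pos (fst e + dvec (snd e)) - pos (fst e) = z" by (simp add: pos_dvec z_def)
  moreover have "pos (fst e + dvec (snd e) + dvec (trn \<sigma> (snd e))) - pos (fst e + dvec (snd e)) =
      (if \<sigma> = 1 then omega else - (1 + omega)) * z"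
    unfolding D' z_def by (simp add: algebra_simps)
  ultimately show "turn (side e) (side (fst e + dvec (snd e), trn \<sigma> (snd e))) = \<sigma>"
    using assms z unfolding turn_def side_def fst_conv snd_conv
    by (simp only: im_turn) (auto simp: omega_def mult_less_0_iff zero_less_mult_iff)
qed

lemma support_eq: "support A = support (side e) \<Longrightarrow> A = side e \<or> A = prod.swap (side e)"
  unfolding support_def by (auto simp: closed_segment_eq doubleton_eq_iff prod_eq_iff)

lemma complete_reverse: "complete_tcurve tiling A \<Longrightarrow> complete_tcurve tiling (reverse_curve A)"
proof -
  assume A: "complete_tcurve tiling A"
  have "prod.swap B \<in> oriented_sides tiling" if "B \<in> oriented_sides tiling" for B
    using that unfolding oriented_sides_def by auto
  moreover have "joins (prod.swap (A (- k))) (prod.swap (A (- (k + 1))))" for k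
    using A joins_swap[of "A (- (k + 1))" "A (- k)"] unfolding complete_tcurve_def
    by (metis add.commute add_diff_cancel_left' diff_minus_eq_add minus_add_distrib minus_diff_eq uminus_add_conv_diff)
  ultimately show ?thesis using A unfolding complete_tcurve_def reverse_curve_def by blast
qed

lemma positive_forward:
  assumes "complete_tcurve tiling A" "A 0 = side e" "0 \<le> k"
  shows "\<exists>e. A k = side e"
  using assms(3)
proof (induction k rule: int_ge_induct)
  case (step i)
  then obtain f where f: "A i = side f" by blast
  have "joins (side f) (A (i + 1))" using assms(1) f unfolding complete_tcurve_def by metis
  then show ?case by (rule joins_side) blast
qed (use assms(2) in blast)

text \<open>A positively oriented successor would yield two cube roots of unity that are negatives
  of each other.\<close>

lemma negative_forward:
  assumes "complete_tcurve tiling A" "A 0 = prod.swap (side e)" "0 \<le> k"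
  shows "\<exists>e. A k = prod.swap (side e)"
  using assms(3)
proof (induction k rule: int_ge_induct)
  case (step i)
  then obtain f where f: "A i = prod.swap (side f)" by blast
  have j: "joins (A i) (A (i + 1))" and o: "A (i + 1) \<in> oriented_sides tiling"
    using assms(1) unfolding complete_tcurve_def by blast+
  from o obtain g where "A (i + 1) = side g \<or> A (i + 1) = prod.swap (side g)" unfolding oriented_sides by blast
  moreover have False if g: "A (i + 1) = side g"
  proof -
    have "joins (prod.swap (side g)) (side f)" using joins_swap[OF j] f g by simp
    then have "pos (fst f + dvec (snd f)) - pos (fst f) = (1 + omega) * (pos (fst g + dvec (snd g)) - pos (fst g)) \<or>
      pos (fst f + dvec (snd f)) - pos (fst f) = - omega * (pos (fst g + dvec (snd g)) - pos (fst g))"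
      unfolding joins_def cis_third side_def prod.swap_def fst_conv snd_conv by blast
    then have "dirc (snd f) * u = ((1 + omega) * dirc (snd g)) * u \<or> dirc (snd f) * u = (- omega * dirc (snd g)) * u"
      by (simp add: pos_dvec mult.assoc)
    then have "dirc (snd f) = (1 + omega) * dirc (snd g) \<or> dirc (snd f) = - omega * dirc (snd g)"
      unfolding mult_cancel_right using u by blast
    then have "dirc (snd f) = - dirc (rot (rot (snd g))) \<or> dirc (snd f) = - dirc (rot (snd g))"
      unfolding dirc_rot2 unfolding dirc_rot by (auto simp: algebra_simps)
    then show False using dirc_neq_minus by blast
  qed
  ultimately show ?case by blast
qed (use assms(2) in blast)

text \<open>Negative indices are handled by the reversed curve: it starts with a reversed side, so
  all its later sides are reversed.\<close>

lemma positive_curve: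
  assumes "complete_tcurve tiling A" "A 0 = side e"
  shows "\<exists>E. \<forall>k. A k = side (E k)"
proof -
  have "\<exists>e. A k = side e" for k
  proof (cases "0 \<le> k")
    case True then show ?thesis by (rule positive_forward[OF assms])
  next
    case False
    have "reverse_curve A 0 = prod.swap (side e)" using assms(2) by (simp add: reverse_curve_def)
    from negative_forward[OF complete_reverse[OF assms(1)] this, of "- k"] False
    obtain f where "prod.swap (A k) = prod.swap (side f)" by (auto simp: reverse_curve_def)
    then show ?thesis by (metis swap_swap)
  qed
  then show ?thesis by metis
qed

end

section \<open>Turns along complete folding curves\<close>

lemma reverse_reverse [simp]: "reverse_curve (reverse_curve A) = A"
  by (simp add: reverse_curve_def)

lemma subcurve_nth: "t \<le> m \<Longrightarrow> subcurve A i m ! t = A (i + int t)"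
  by (simp add: subcurve_def del: upt_Suc)

lemma subcurve_length [simp]: "length (subcurve A i m) = Suc m"
  by (simp add: subcurve_def)

lemma associated_nth:
  assumes "Suc t < length As"
  shows "associated_sequence As ! t = turn (As ! t) (As ! Suc t)"
  using assms by (cases As) (simp_all add: associated_sequence_def)

lemma length_associated: "length (associated_sequence As) = length As - 1"
  by (simp add: associated_sequence_def)

lemma T_seq_nth: "Suc t < 3 ^ n \<Longrightarrow> T_seq L n ! t = tau L (int t + 1)"
  using nth_upt[of 1 t "3 ^ n"] by (simp add: T_seq_tau add.commute)

lemma length_T_seq: "length (T_seq L n) = 3 ^ n - 1"
  by (simp add: T_seq_tau)

text \<open>Some \<open>n\<close>-folding piece covers the window; in it the turn at
  \<open>k\<close> stands at position \<open>k - s n\<close>, so \<open>- s n\<close> serves as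
  \<open>j\<close>.\<close>

lemma complete_folding_FS:
  assumes "complete_folding_tcurve P A"
  shows "FS {L. sign_sequence L} (\<lambda>k. turn (A (k - 1)) (A k))"
  unfolding FS_def
proof
  fix N
  obtain s m where sm: "\<And>n. folding_tcurve P n (subcurve A (s n) (m n))"
    "\<And>n. {s n..s n + int (m n)} \<subseteq> {s (Suc n)..s (Suc n) + int (m (Suc n))}"
    "(\<Union>n. {s n..s n + int (m n)}) = UNIV"
    using assms unfolding complete_folding_tcurve_def by blast
  have mono: "{s n..s n + int (m n)} \<subseteq> {s n'..s n' + int (m n')}" if "n \<le> n'" for n n'
    using lift_Suc_mono_le[of "\<lambda>n. {s n..s n + int (m n)}", OF sm(2) that] .
  \<comment> \<open>One index further to the left than the window, as the turn at \<open>k\<close>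
    is that from \<open>A (k - 1)\<close> to \<open>A k\<close>.\<close>
  obtain n1 where n1: "- \<bar>N\<bar> - 1 \<in> {s n1..s n1 + int (m n1)}" using sm(3) by blast
  obtain n2 where n2: "\<bar>N\<bar> \<in> {s n2..s n2 + int (m n2)}" using sm(3) by blast
  define n where "n = max n1 n2"
  have n: "s n \<le> - \<bar>N\<bar> - 1" "\<bar>N\<bar> \<le> s n + int (m n)"
    using n1 n2 mono[of n1 n] mono[of n2 n] unfolding n_def by auto
  obtain L where L: "sign_sequence L" "associated_sequence (subcurve A (s n) (m n)) = T_seq L n"
    using sm(1)[of n] unfolding folding_tcurve_def by blast
  have len: "m n = 3 ^ n - 1"
    using arg_cong[OF L(2), of length] by (simp add: length_associated length_T_seq)
  have "turn (A (k - 1)) (A k) = tau L (- s n + k)" if k: "\<bar>k\<bar> \<le> N" for k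
  proof -
    define t where "t = nat (k - 1 - s n)"
    have t: "int t = k - 1 - s n" "Suc t \<le> m n" using k n by (simp_all add: t_def)
    have "turn (A (k - 1)) (A k) = associated_sequence (subcurve A (s n) (m n)) ! t"
      using t by (simp add: associated_nth subcurve_nth)
    also have "\<dots> = tau L (int t + 1)" unfolding L(2) using t(2) len by (intro T_seq_nth) auto
    finally show ?thesis by (simp add: t(1) algebra_simps)
  qed
  moreover have "N < \<bar>- s n\<bar>" using n by linarith
  ultimately show "\<exists>L\<in>{L. sign_sequence L}. \<exists>j. N < \<bar>j\<bar> \<and> (\<forall>k. \<bar>k\<bar> \<le> N \<longrightarrow> turn (A (k - 1)) (A k) = tau L (j + k))"
    using L(1) by blast
qed

lemma associated_FS:
  assumes "curve_associated P A L"
  shows "FS {L} (\<lambda>k. turn (A (k - 1)) (A k))"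
  unfolding FS_def
proof
  fix N
  let ?M = "nat (2 * \<bar>N\<bar> + 1)" and ?i = "- \<bar>N\<bar> - 1"
  obtain n Bs where B: "associated_sequence Bs = T_seq L n" "sublist (subcurve A ?i ?M) Bs"
    using assms unfolding curve_associated_def by blast
  obtain ps ss where Bs: "Bs = ps @ subcurve A ?i ?M @ ss" using B(2) unfolding sublist_def by blast
  have len: "length Bs - 1 = 3 ^ n - 1" using arg_cong[OF B(1), of length] by (simp add: length_associated length_T_seq)
  have nth: "Bs ! (length ps + t) = A (?i + int t)" if "t \<le> ?M" for t
    using that unfolding Bs by (simp add: nth_append subcurve_nth)
  have "turn (A (k - 1)) (A k) = tau L (int (length ps) + \<bar>N\<bar> + 1 + k)" if k: "\<bar>k\<bar> \<le> N" for k
  proof -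
    define t where "t = nat (k + \<bar>N\<bar>)"
    have t: "int t = k + \<bar>N\<bar>" "Suc t \<le> ?M" using k by (simp_all add: t_def)
    have lt: "Suc (length ps + t) < length Bs" using t unfolding Bs by simp
    have "turn (A (k - 1)) (A k) = turn (Bs ! (length ps + t)) (Bs ! (length ps + Suc t))"
      using nth[of t] nth[of "Suc t"] t by simp
    also have "\<dots> = associated_sequence Bs ! (length ps + t)" using lt by (simp add: associated_nth)
    also have "\<dots> = tau L (int (length ps + t) + 1)" unfolding B(1) using lt len by (intro T_seq_nth) simp
    finally show ?thesis by (simp add: t(1) algebra_simps)
  qed
  moreover have "N < \<bar>int (length ps) + \<bar>N\<bar> + 1\<bar>" by linarith
  ultimately show "\<exists>L\<in>{L}. \<exists>j. N < \<bar>j\<bar> \<and> (\<forall>k. \<bar>k\<bar> \<le> N \<longrightarrow> turn (A (k - 1)) (A k) = tau L (j + k))"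
    by blast
qed

text \<open>The reason why the sequence of a curve does not depend on its orientation.\<close>

lemma T_seq_antisym: "rev (map uminus (T_seq L n)) = T_seq L n"
  by (induction n) (simp_all add: rev_map)

lemma tau_sign: "sign_sequence L \<Longrightarrow> tau L i = 1 \<or> tau L i = -1"
proof (induction L i rule: tau.induct)
  case (1 L i)
  show ?case
  proof (cases "i = 0")
    case False
    show ?thesis
    proof (cases i rule: mod3_cases)
      case 0
      then show ?thesis
        using 1(1)[OF False 0] sign_tl[OF 1(2)] False by (subst (1 2) tau.simps) (simp add: tl_seq_def)
    qed (use sign_1[OF 1(2), of 0] in \<open>auto simp: tau_1 tau_2\<close>)
  qed (simp add: tau.simps)
qed

context plane_lattice
begin

lemma side_oriented: "side e \<in> oriented_sides tiling" "prod.swap (side e) \<in> oriented_sides tiling"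
  unfolding oriented_sides by blast+

lemma complete_turn_swap:
  assumes "complete_tcurve tiling A"
  shows "turn (prod.swap (A (k + 1))) (prod.swap (A k)) = - turn (A k) (A (k + 1))"
proof (rule turn_swap)
  show "joins (A k) (A (k + 1))" using assms by (simp add: complete_tcurve_def)
  have "A k \<in> oriented_sides tiling" using assms by (simp add: complete_tcurve_def)
  then show "fst (A k) \<noteq> snd (A k)" unfolding oriented_sides_def by auto
qed

lemma FS_reverse_curve:
  assumes "complete_tcurve tiling A" "FS \<S> (\<lambda>k. turn (A (k - 1)) (A k))"
  shows "FS \<S> (\<lambda>k. turn (reverse_curve A (k - 1)) (reverse_curve A k))"
proof -
  have "turn (reverse_curve A (k - 1)) (reverse_curve A k) = - turn (A (- k + 1 - 1)) (A (- k + 1))" for k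
    using complete_turn_swap[OF assms(1), of "- k"] by (simp add: reverse_curve_def)
  \<comment> \<open>The reversed curve has at \<open>k\<close> the negated turn of \<open>A\<close>
    at \<open>1 - k\<close>, hence the extra shift by 1.\<close>
  then show ?thesis using FS_reverse[OF FS_shift[OF assms(2), of 1]] by simp
qed

lemma associated_reverse:
  assumes "curve_associated tiling A L"
  shows "curve_associated tiling (reverse_curve A) L"
  unfolding curve_associated_def
proof (intro allI)
  fix i :: int and m :: nat
  obtain n Bs where B: "bounded_tcurve tiling Bs" "associated_sequence Bs = T_seq L n"
    "sublist (subcurve A (- i - int m) m) Bs" using assms unfolding curve_associated_def by blast
  define Cs where "Cs = rev (map prod.swap Bs)"
  have j: "joins (Bs ! t) (Bs ! Suc t)" if "Suc t < length Bs" for t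
    using B(1) that unfolding bounded_tcurve_def successively_conv_nth by blast
  have o: "b \<in> oriented_sides tiling" if "b \<in> set Bs" for b using B(1) that unfolding bounded_tcurve_def by blast
  have len: "length Cs = length Bs" by (simp add: Cs_def)
  have nth: "Cs ! t = prod.swap (Bs ! (length Bs - Suc t))" if "t < length Bs" for t
    using that by (simp add: Cs_def rev_nth)
  have "bounded_tcurve tiling Cs" unfolding bounded_tcurve_def successively_conv_nth
  proof (intro conjI allI impI)
    show "Cs \<noteq> []" using B(1) by (simp add: Cs_def bounded_tcurve_def)
    show "set Cs \<subseteq> oriented_sides tiling"
      using o unfolding Cs_def oriented_sides_def by fastforce
    fix t assume t: "Suc t < length Cs"
    have "joins (Bs ! (length Bs - Suc (Suc t))) (Bs ! Suc (length Bs - Suc (Suc t)))" using t len by (intro j) simp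
    moreover have "Suc (length Bs - Suc (Suc t)) = length Bs - Suc t" using t len by simp
    ultimately show "joins (Cs ! t) (Cs ! Suc t)" using t len joins_swap by (simp add: nth)
  qed
  moreover have "associated_sequence Cs = rev (map uminus (associated_sequence Bs))"
  proof (rule nth_equalityI)
    fix t assume "t < length (associated_sequence Cs)"
    then have t: "Suc t < length Bs" by (simp add: length_associated len)
    define r where "r = length Bs - Suc (Suc t)"
    have r: "Suc r < length Bs" "Suc r = length Bs - Suc t" "length Bs - 1 - Suc t = r" using t by (simp_all add: r_def)
    have "fst (Bs ! r) \<noteq> snd (Bs ! r)" using o[of "Bs ! r"] r(1) unfolding oriented_sides_def by auto
    from turn_swap[OF j[OF r(1)] this]
    have "turn (Cs ! t) (Cs ! Suc t) = - turn (Bs ! r) (Bs ! Suc r)" using t r(2) by (simp add: nth r_def)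
    then show "associated_sequence Cs ! t = rev (map uminus (associated_sequence Bs)) ! t"
      using t r by (simp add: associated_nth len rev_nth length_associated)
  qed (simp add: length_associated len)
  then have "associated_sequence Cs = T_seq L n" by (simp add: B(2) T_seq_antisym)
  moreover have "subcurve (reverse_curve A) i m = rev (map prod.swap (subcurve A (- i - int m) m))"
    by (rule nth_equalityI) (simp_all add: rev_nth subcurve_nth reverse_curve_def less_Suc_eq_le of_nat_diff)
  then have "sublist (subcurve (reverse_curve A) i m) Cs"
    using B(3) unfolding sublist_def Cs_def by fastforce
  ultimately show "\<exists>n Bs. bounded_tcurve tiling Bs \<and> associated_sequence Bs = T_seq L n \<and>
      sublist (subcurve (reverse_curve A) i m) Bs" by blast
qed

text \<open>\<open>curve_associated\<close> asks for an actual t-curve with associated sequence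
  \<open>T_seq L n\<close> around each subcurve. The orbit itself need not continue in this way, so
  a new curve is unfolded from the window: its turns follow \<open>tau L\<close>, and it agrees with
  the orbit on the window.\<close>

lemma associated_positive:
  assumes "hierarchy L s" "signs s" "orbit s E"
  shows "curve_associated tiling (\<lambda>k. side (E k)) L"
  unfolding curve_associated_def
proof (intro allI)
  fix i :: int and m :: nat
  have tsg: "tau L k = 1 \<or> tau L k = -1" for k by (rule tau_sign[OF hierarchy_sign[OF assms(1)]])
  obtain j where j: "\<bar>i\<bar> + int m + 1 < j" "\<And>k. \<bar>k\<bar> \<le> \<bar>i\<bar> + int m + 1 \<Longrightarrow> s (fst (E k)) = tau L (j + k)"
    using hierarchy_window[OF assms] by metis
  \<comment> \<open>\<open>f\<close> continues a side with the turn prescribed by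
    \<open>tau L\<close>, and \<open>g\<close> undoes this; the turn at index \<open>k + 1\<close>
    is the entry \<open>j + k + 1\<close>.\<close>
  define f where "f k x = (fst x + dvec (snd x), trn (tau L (j + k + 1)) (snd x))" for k and x :: "(int \<times> int) \<times> dir"
  define g where "g k x = (fst x - dvec (trn (- tau L (j + k + 1)) (snd x)), trn (- tau L (j + k + 1)) (snd x))"
    for k and x :: "(int \<times> int) \<times> dir"
  have fg: "f k (g k x) = x" for k x using tsg[of "j + k + 1"] by (simp add: f_def g_def)
  obtain E' where E': "E' i = E i" "\<And>k. E' (k + 1) = f k (E' k)"
    using int_recursion[of f g i "E i", OF fg] by blast
  have same: "E' (i + int t) = E (i + int t)" if "t \<le> m" for t
    using that
  proof (induction t)
    case (Suc t)
    have "E (i + int t + 1) = nx s (E (i + int t))" by (rule orbitD[OF assms(3)])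
    moreover have "s (fst (E (i + int t + 1))) = tau L (j + (i + int t + 1))" using Suc.prems by (intro j(2)) auto
    ultimately have "E (i + int t + 1) = f (i + int t) (E (i + int t))"
      by (simp add: nx_def f_def add.assoc)
    moreover have "i + int (Suc t) = i + int t + 1" by simp
    ultimately show ?case using Suc E'(2)[of "i + int t"] by (simp only: Suc_leD)
  qed (simp add: E'(1))
  have step: "joins (side (E' k)) (side (E' (k + 1)))" "turn (side (E' k)) (side (E' (k + 1))) = tau L (j + k + 1)" for k
    unfolding E'(2) f_def using side_joins[OF tsg] by simp_all
  \<comment> \<open>The window occupies the positions from \<open>i + j\<close> to
    \<open>i + j + m\<close>, which have to lie below \<open>3 ^ n\<close>.\<close>
  define n where "n = nat (i + j) + m"
  have n: "n < 3 ^ n" using less_le_trans[OF less_exp[of n] power_mono[of 2 "3::nat" n]] by simp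
  \<comment> \<open>Starting at index \<open>- j\<close> makes the turns of \<open>Bs\<close> the
    entries of \<open>tau L\<close> from 1 on.\<close>
  define Bs where "Bs = map (\<lambda>t. side (E' (int t - j))) [0..<3 ^ n]"
  have len: "length Bs = 3 ^ n" by (simp add: Bs_def)
  have nth: "Bs ! t = side (E' (int t - j))" if "t < 3 ^ n" for t using that by (simp add: Bs_def)
  have nth': "Bs ! Suc t = side (E' (int t - j + 1))" if "Suc t < 3 ^ n" for t
    using nth[OF that] by (simp add: algebra_simps)
  have "bounded_tcurve tiling Bs" unfolding bounded_tcurve_def successively_conv_nth
  proof (intro conjI allI impI)
    show "Bs \<noteq> []" by (simp add: Bs_def)
    show "set Bs \<subseteq> oriented_sides tiling" unfolding Bs_def set_map using side_oriented by blast
    fix t assume "Suc t < length Bs"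
    then have t: "Suc t < 3 ^ n" "t < 3 ^ n" by (simp_all add: len)
    show "joins (Bs ! t) (Bs ! Suc t)" unfolding nth'[OF t(1)] nth[OF t(2)] by (rule step(1))
  qed
  moreover have "associated_sequence Bs = T_seq L n"
  proof (rule nth_equalityI)
    fix t assume "t < length (associated_sequence Bs)"
    then have t: "Suc t < 3 ^ n" by (simp add: length_associated len)
    have "turn (side (E' (int t - j))) (side (E' (int t - j + 1))) = tau L (int t + 1)"
      unfolding step(2) by (rule arg_cong) simp
    then show "associated_sequence Bs ! t = T_seq L n ! t"
      using t nth[of t] nth'[OF t] by (simp add: associated_nth len T_seq_nth)
  qed (simp add: length_associated len length_T_seq)
  moreover have "sublist (subcurve (\<lambda>k. side (E k)) i m) Bs"
  proof -
    define p where "p = nat (i + j)"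
    have p: "int p = i + j" using j(1) by (simp add: p_def)
    have le: "p + Suc m \<le> 3 ^ n" using n by (simp add: n_def p_def)
    have "map (\<lambda>t. side (E' (int t - j))) [p..<p + Suc m] = subcurve (\<lambda>k. side (E k)) i m"
      by (rule nth_equalityI) (simp_all add: subcurve_nth less_Suc_eq_le p same del: upt_Suc)
    moreover have "[0..<3 ^ n] = [0..<p] @ [p..<p + Suc m] @ [p + Suc m..<3 ^ n]"
      using le upt_add_eq_append[of 0 p "3 ^ n - p"] upt_add_eq_append[of p "p + Suc m" "3 ^ n - (p + Suc m)"]
      by (simp del: upt_Suc)
    ultimately show ?thesis unfolding sublist_def Bs_def by (metis map_append)
  qed
  ultimately show "\<exists>n Bs. bounded_tcurve tiling Bs \<and> associated_sequence Bs = T_seq L n \<and>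
      sublist (subcurve (\<lambda>k. side (E k)) i m) Bs" by blast
qed

section \<open>The sign function of a covering\<close>

definition induces :: "(int \<Rightarrow> oside) set set \<Rightarrow> (int \<times> int \<Rightarrow> int) \<Rightarrow> bool" where
  "induces \<C> s \<longleftrightarrow> signs s \<and> (\<forall>A\<in>\<Union>\<C>. \<forall>k e. A k = side e \<longrightarrow> A (k + 1) = side (nx s e))"

context
  fixes \<C> :: "(int \<Rightarrow> oside) set set"
  assumes cov: "folding_covering tiling \<C>"
begin

lemma curve_cases:
  assumes "K \<in> \<C>" "A \<in> K"
  shows "K = {A, reverse_curve A}" "complete_tcurve tiling A" "FS {L. sign_sequence L} (\<lambda>k. turn (A (k - 1)) (A k))"
proof -
  obtain B where B: "K = {B, reverse_curve B}" "complete_folding_tcurve tiling B"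
    using cov assms(1) unfolding folding_covering_def nonoriented_def by blast
  have c: "complete_tcurve tiling B" using B(2) by (simp add: complete_folding_tcurve_def)
  have A: "A = B \<or> A = reverse_curve B" using B(1) assms(2) by simp
  show "K = {A, reverse_curve A}" using A unfolding B(1) by (elim disjE) (simp_all add: insert_commute)
  show "complete_tcurve tiling A" using A c complete_reverse[OF c] by (elim disjE) simp_all
  show "FS {L. sign_sequence L} (\<lambda>k. turn (A (k - 1)) (A k))"
    using A complete_folding_FS[OF B(2)] FS_reverse_curve[OF c complete_folding_FS[OF B(2)]]
    by (elim disjE) (simp_all only:)
qed

lemma covering_support:
  shows "\<exists>!K. K \<in> \<C> \<and> (\<exists>A\<in>K. \<exists>k. support (A k) = support (side e))"
    "\<forall>K\<in>\<C>. \<forall>A\<in>K. \<forall>j k. support (A j) = support (side e) \<and> support (A k) = support (side e) \<longrightarrow> j = k"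
proof -
  have S: "support (side e) \<in> support ` oriented_sides tiling" by (rule imageI[OF side_oriented(1)])
  have "is_covering tiling \<C>" using cov by (simp add: folding_covering_def)
  note * = bspec[OF this[unfolded is_covering_def] S]
  show "\<exists>!K. K \<in> \<C> \<and> (\<exists>A\<in>K. \<exists>k. support (A k) = support (side e))" by (rule conjunct1[OF *])
  show "\<forall>K\<in>\<C>. \<forall>A\<in>K. \<forall>j k. support (A j) = support (side e) \<and> support (A k) = support (side e) \<longrightarrow> j = k"
    by (rule conjunct2[OF *])
qed

text \<open>A nonoriented curve contains both its orientations, and one of them runs along the side
  in the positive direction.\<close>

lemma side_covered:
  obtains A k where "A \<in> \<Union>\<C>" "A k = side e"
proof -
  from ex1_implies_ex[OF covering_support(1)[of e]] obtain K where "K \<in> \<C> \<and> (\<exists>A\<in>K. \<exists>k. support (A k) = support (side e))"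
    by (elim exE)
  then obtain A k where *: "K \<in> \<C>" "A \<in> K" "support (A k) = support (side e)"
    by (elim conjE bexE exE)
  from support_eq[OF *(3)] show ?thesis
  proof
    assume "A k = side e" then show ?thesis using * that by blast
  next
    assume "A k = prod.swap (side e)"
    then have "reverse_curve A (- k) = side e" by (simp add: reverse_curve_def)
    moreover have "reverse_curve A \<in> K" using curve_cases(1)[OF *(1,2)] by blast
    ultimately show ?thesis using * that by blast
  qed
qed

text \<open>Both passages lie on the same nonoriented curve. If they belonged to opposite
  orientations, the one index at which the curve uses this support would carry the side and its
  reversal.\<close>

lemma side_unique:
  assumes "A \<in> \<Union>\<C>" "A' \<in> \<Union>\<C>" "A k = side e" "A' k' = side e"
  shows "A = A' \<and> k = k'"
proof -
  let ?S = "support (side e)"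
  have inj: "j = k" if "K \<in> \<C>" "A \<in> K" "support (A j) = ?S" "support (A k) = ?S" for K A j k
    using covering_support(2)[of e, rule_format, OF that(1,2)] that(3,4) by (simp only:)
  obtain K K' where K: "K \<in> \<C>" "A \<in> K" "K' \<in> \<C>" "A' \<in> K'" using assms(1,2) by blast
  let ?P = "\<lambda>K. K \<in> \<C> \<and> (\<exists>A\<in>K. \<exists>k. support (A k) = ?S)"
  have PK: "?P K" by (intro conjI bexI[of _ A] exI[of _ k] K) (simp add: assms(3))
  have PK': "?P K'" by (intro conjI bexI[of _ A'] exI[of _ k'] K) (simp add: assms(4))
  obtain z where z: "\<forall>y. ?P y \<longrightarrow> y = z" using covering_support(1)[of e] by (elim ex1E) (rule that)
  have KK: "K = K'" using mp[OF spec[OF z] PK] mp[OF spec[OF z] PK'] by simp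
  have "A' \<in> {A, reverse_curve A}" using curve_cases(1)[OF K(1,2)] K(4) unfolding KK by simp
  then consider "A' = A" | "A' = reverse_curve A" by blast
  then show ?thesis
  proof cases
    case 1
    then show ?thesis using inj[OF K(1,2)] assms(3,4) by simp
  next
    case 2
    then have "prod.swap (A (- k')) = side e" using assms(4) by (simp add: reverse_curve_def)
    then have sw: "A (- k') = prod.swap (side e)" by (metis swap_swap)
    then have "support (A (- k')) = ?S" by (simp add: support_def closed_segment_commute)
    then have "- k' = k" using inj[OF K(1,2)] assms(3) by simp
    then show ?thesis using sw assms(3) side_neq_swap by metis
  qed
qed

lemma curve_step:
  assumes "A \<in> \<Union>\<C>" "A k = side e"
  shows "\<exists>\<sigma>. (\<sigma> = 1 \<or> \<sigma> = -1) \<and> A (k + 1) = side (fst e + dvec (snd e), trn \<sigma> (snd e))"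
proof -
  have "joins (side e) (A (k + 1))" using assms curve_cases(2) unfolding complete_tcurve_def by (metis UnionE)
  then show ?thesis by (rule joins_side) blast
qed

text \<open>A left turn out of direction \<open>d\<close> and a right turn out of
  \<open>rot (rot d)\<close> would leave the vertex along the same side, which is traversed only
  once. So a left turn is passed on from direction to direction around the vertex, and the three
  turns agree.\<close>

lemma induces_exists: "\<exists>s. induces \<C> s"
proof -
  have "\<exists>\<sigma>. (\<sigma> = 1 \<or> \<sigma> = -1) \<and> (\<exists>A\<in>\<Union>\<C>. \<exists>k. A k = side e \<and> A (k + 1) = side (fst e + dvec (snd e), trn \<sigma> (snd e)))" for e
  proof -
    obtain A k where "A \<in> \<Union>\<C>" "A k = side e" by (rule side_covered)
    with curve_step[OF this] show ?thesis by blast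
  qed
  then have "\<exists>f. \<forall>e. (f e = 1 \<or> f e = (-1 :: int)) \<and>
      (\<exists>A\<in>\<Union>\<C>. \<exists>k. A k = side e \<and> A (k + 1) = side (fst e + dvec (snd e), trn (f e) (snd e)))"
    by (intro choice) blast
  then obtain f where f: "\<And>e. f e = 1 \<or> f e = (-1 :: int)"
    "\<And>e. \<exists>A\<in>\<Union>\<C>. \<exists>k. A k = side e \<and> A (k + 1) = side (fst e + dvec (snd e), trn (f e) (snd e))" by blast
  have fA: "A (k + 1) = side (fst e + dvec (snd e), trn (f e) (snd e))" if "A \<in> \<Union>\<C>" "A k = side e" for A k e
    using f(2)[of e] side_unique[OF that(1) _ that(2)] by metis
  have inj: "e = e'"
    if "(fst e + dvec (snd e), trn (f e) (snd e)) = (fst e' + dvec (snd e'), trn (f e') (snd e'))" for e e'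
  proof -
    obtain A k where A: "A \<in> \<Union>\<C>" "A k = side e" by (rule side_covered)
    obtain A' k' where A': "A' \<in> \<Union>\<C>" "A' k' = side e'" by (rule side_covered)
    have "A (k + 1) = A' (k' + 1)" using fA[OF A] fA[OF A'] that by simp
    then have "A = A' \<and> k + 1 = k' + 1" using side_unique[OF A(1) A'(1)] fA[OF A] by metis
    then show ?thesis using A A' by simp
  qed
  have next1: "f (strand_in v (rot (rot d))) = 1" if "f (strand_in v d) = 1" for v d
  proof (rule ccontr)
    assume "f (strand_in v (rot (rot d))) \<noteq> 1"
    then have "f (strand_in v (rot (rot d))) = -1" using f(1) by blast
    then have "trn (f (strand_in v d)) d = trn (f (strand_in v (rot (rot d)))) (rot (rot d))"
      using that by (simp only: trn_def) simp
    moreover have hd: "fst (strand_in v e) + dvec (snd (strand_in v e)) = v" "snd (strand_in v e) = e" for e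
      by (simp_all add: strand_in_def)
    ultimately have "(fst (strand_in v d) + dvec (snd (strand_in v d)), trn (f (strand_in v d)) (snd (strand_in v d))) =
      (fst (strand_in v (rot (rot d))) + dvec (snd (strand_in v (rot (rot d)))),
       trn (f (strand_in v (rot (rot d)))) (snd (strand_in v (rot (rot d)))))"
      by (simp only: hd)
    then have "strand_in v d = strand_in v (rot (rot d))" by (rule inj)
    then show False by (cases d) (simp_all add: strand_in_def)
  qed
  define s where "s v = f (strand_in v E0)" for v
  have s: "f (strand_in v d) = s v" for v d
  proof -
    have "f (strand_in v E0) = 1 \<Longrightarrow> f (strand_in v E2) = 1" "f (strand_in v E2) = 1 \<Longrightarrow> f (strand_in v E1) = 1"
      "f (strand_in v E1) = 1 \<Longrightarrow> f (strand_in v E0) = 1"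
      using next1[of v E0] next1[of v E2] next1[of v E1] by simp_all
    then have "f (strand_in v E0) = 1 \<longleftrightarrow> f (strand_in v d) = 1" by (cases d) blast+
    then show ?thesis
      unfolding s_def using f(1)[of "strand_in v E0"] f(1)[of "strand_in v d"] by (elim disjE) simp_all
  qed
  have "A (k + 1) = side (nx s e)" if "A \<in> \<Union>\<C>" "A k = side e" for A k e
  proof -
    have "strand_in (fst e + dvec (snd e)) (snd e) = e" by (simp add: strand_in_def)
    then have "s (fst e + dvec (snd e)) = f e" using s by metis
    then show ?thesis using fA[OF that] by (simp add: nx_def)
  qed
  moreover have "signs s" unfolding signs_def s_def using f(1) by blast
  ultimately show ?thesis unfolding induces_def by blast
qed

context
  fixes s
  assumes ind: "induces \<C> s"
begin

lemma induced_signs: "signs s"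
  using ind by (simp add: induces_def)

lemma induced_orbit:
  assumes "K \<in> \<C>" "A \<in> K"
  obtains E B where "orbit s E" "B \<in> K" "B = (\<lambda>k. side (E k))" "A = B \<or> A = reverse_curve B"
proof -
  have pos: "\<exists>E. orbit s E \<and> B = (\<lambda>k. side (E k))" if B: "B \<in> K" "B 0 = side e" for B e
  proof -
    obtain E where E: "\<And>k. B k = side (E k)" using positive_curve[OF curve_cases(2)[OF assms(1) B(1)] B(2)] by blast
    have "side (E (k + 1)) = side (nx s (E k))" for k
      using ind E B(1) assms(1) unfolding induces_def by (metis UnionI)
    then have "orbit s E" unfolding orbit_def by simp
    then show ?thesis using E by blast
  qed
  have "A 0 \<in> oriented_sides tiling" using curve_cases(2)[OF assms] by (simp add: complete_tcurve_def)
  then obtain e where "A 0 = side e \<or> A 0 = prod.swap (side e)" unfolding oriented_sides by blast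
  then show ?thesis
  proof
    assume "A 0 = side e"
    then show ?thesis using pos[OF assms(2)] assms(2) that by blast
  next
    assume "A 0 = prod.swap (side e)"
    then have "reverse_curve A 0 = side e" by (simp add: reverse_curve_def)
    moreover have "reverse_curve A \<in> K" using curve_cases(1)[OF assms] by blast
    ultimately show ?thesis using pos[of "reverse_curve A" e] that by (metis reverse_reverse)
  qed
qed

lemma orbit_induced:
  assumes "orbit s E"
  obtains A m where "A \<in> \<Union>\<C>" "\<And>k. A (k + m) = side (E k)"
proof -
  obtain A m where A: "A \<in> \<Union>\<C>" "A m = side (E 0)" by (rule side_covered)
  have step: "A (k + 1 + m) = side (nx s e)" if "A (k + m) = side e" for k e
    using ind A(1) that unfolding induces_def by (metis add.assoc add.commute)
  obtain K where K: "K \<in> \<C>" "A \<in> K" using A(1) by blast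
  have "complete_tcurve tiling (\<lambda>k. A (k + m))"
    using curve_cases(2)[OF K] unfolding complete_tcurve_def by (metis add.assoc add.commute)
  then obtain E' where E': "\<And>k. A (k + m) = side (E' k)"
    using positive_curve[of "\<lambda>k. A (k + m)"] A(2) by auto
  have "side (E' (k + 1)) = side (nx s (E' k))" for k using step[OF E'] E' by metis
  then have "orbit s E'" unfolding orbit_def by simp
  moreover have "E' 0 = E 0" using E'[of 0] A(2) by simp
  ultimately have "E' = E" using orbit_unique[OF induced_signs _ assms] by blast
  then show ?thesis using that A(1) E' by blast
qed

lemma turn_orbit:
  assumes "orbit s E"
  shows "turn (side (E (k - 1))) (side (E k)) = s (fst (E k))"
proof -
  have "E k = nx s (E (k - 1))" using orbitD[OF assms, of "k - 1"] by simp
  then show ?thesis using side_joins(2)[OF signsD[OF induced_signs], of "E (k - 1)"] by (simp add: nx_def)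
qed

lemma induced_folding:
  assumes "\<And>A. A \<in> \<Union>\<C> \<Longrightarrow> FS \<S> (\<lambda>k. turn (A (k - 1)) (A k))"
  shows "folding \<S> s"
  unfolding folding_def
proof (intro conjI allI impI)
  fix E assume E: "orbit s E"
  obtain A m where A: "A \<in> \<Union>\<C>" "\<And>k. A (k + m) = side (E k)" by (rule orbit_induced[OF E]) blast
  have "turn (A (k + m - 1)) (A (k + m)) = s (fst (E k))" for k
    using turn_orbit[OF E, of k] A(2)[of k] A(2)[of "k - 1"] by (simp add: algebra_simps)
  then show "FS \<S> (\<lambda>k. s (fst (E k)))" using FS_shift[OF assms[OF A(1)], of m] by simp
qed (rule induced_signs)

lemma induced_hierarchy: "\<exists>L. hierarchy L s"
  using folding_hierarchy[OF induced_folding[of "{L. sign_sequence L}"]] curve_cases(3) by (metis UnionE mem_Collect_eq)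

lemma associated_hierarchy:
  assumes "sign_sequence L" "covering_associated tiling \<C> L"
  shows "hierarchy L s"
proof -
  have "folding {L} s"
    using assms(2) unfolding covering_associated_def by (intro induced_folding associated_FS) blast
  then obtain L' where "hierarchy L' s" "\<And>n. \<exists>L''\<in>{L}. L' (Suc n) = L'' (Suc n)"
    using folding_hierarchy assms(1) by (metis singletonD)
  then show ?thesis using hierarchy_cong by (metis singletonD)
qed

lemma hierarchy_associated:
  assumes "hierarchy L s"
  shows "covering_associated tiling \<C> L"
  unfolding covering_associated_def
proof (intro ballI)
  fix K A assume "K \<in> \<C>" "A \<in> K"
  then obtain E B where "orbit s E" "B = (\<lambda>k. side (E k))" "A = B \<or> A = reverse_curve B"
    by (rule induced_orbit)
  then show "curve_associated tiling A L"
    using associated_positive[OF assms induced_signs] associated_reverse by metis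
qed

end

end

end

section \<open>Drawings\<close>

lemma draw_side_translate:
  "draw_side \<epsilon> (fst A + t, snd A + t) = (\<lambda>z. z + t) ` draw_side \<epsilon> A"
proof -
  have "draw_side \<epsilon> (fst A + t, snd A + t) =
      closed_segment (t + (fst A + \<epsilon> *\<^sub>R (snd A - fst A))) (t + (snd A + \<epsilon> *\<^sub>R (fst A - snd A)))"
    unfolding draw_side_def by (rule arg_cong2[where f = closed_segment]) simp_all
  also have "\<dots> = (\<lambda>z. t + z) ` draw_side \<epsilon> A"
    by (simp add: closed_segment_translation draw_side_def)
  finally show ?thesis by (simp add: add.commute[of _ t])
qed

lemma draw_corner_translate:
  "draw_corner \<epsilon> (fst A + t, snd A + t) (fst B + t, snd B + t) = (\<lambda>z. z + t) ` draw_corner \<epsilon> A B"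
proof -
  define v p q where "v = snd A" "p = v + \<epsilon> *\<^sub>R (fst A - v)" "q = v + \<epsilon> *\<^sub>R (snd B - v)"
  define z where "z = v + (2 / 3) *\<^sub>R ((p - v) + (q - v))"
  have 1: "draw_corner \<epsilon> A B = sphere z (dist z p) \<inter> convex hull {v, p, q}"
    by (simp add: draw_corner_def Let_def z_def v_p_q_def)
  have 2: "draw_corner \<epsilon> (fst A + t, snd A + t) (fst B + t, snd B + t) =
      sphere (t + z) (dist (t + z) (t + p)) \<inter> convex hull {t + v, t + p, t + q}"
  proof -
    have "snd A + t = t + v" "t + v + \<epsilon> *\<^sub>R (fst A + t - (t + v)) = t + p" "t + v + \<epsilon> *\<^sub>R (snd B + t - (t + v)) = t + q"
      "t + v + (2 / 3) *\<^sub>R ((t + p - (t + v)) + (t + q - (t + v))) = t + z"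
      by (simp_all add: v_p_q_def z_def)
    then show ?thesis unfolding draw_corner_def Let_def fst_conv snd_conv by (simp only:)
  qed
  have 3: "sphere (t + z) (dist (t + z) (t + p)) = (\<lambda>x. t + x) ` sphere z (dist z p)"
    by (simp add: sphere_translation)
  have 4: "convex hull {t + v, t + p, t + q} = (\<lambda>x. t + x) ` (convex hull {v, p, q})"
    using convex_hull_translation[of t "{v, p, q}"] by simp
  show ?thesis unfolding 1 2 3 4 by (auto simp: add.commute)
qed

text \<open>The radius in \<open>draw_corner\<close> is measured at the first free end; as the two
  sides have equal length, the second free end is equally far from the centre.\<close>

lemma draw_corner_reverse:
  assumes "snd A = fst B" "cmod (snd B - fst B) = cmod (fst A - snd A)"
  shows "draw_corner \<epsilon> (prod.swap B) (prod.swap A) = draw_corner \<epsilon> A B"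
proof -
  define v a b where "v = fst B" "a = fst A - v" "b = snd B - v"
  have ab: "(cmod a)\<^sup>2 = (cmod b)\<^sup>2" using assms by (simp add: v_a_b_def)
  define p q where "p = v + \<epsilon> *\<^sub>R a" "q = v + \<epsilon> *\<^sub>R b"
  define z where "z = v + (2 / 3) *\<^sub>R ((p - v) + (q - v))"
  have "(cmod (2 *\<^sub>R b - a))\<^sup>2 = (cmod (2 *\<^sub>R a - b))\<^sup>2"
    using ab unfolding cmod_power2 by (simp add: power2_eq_square algebra_simps)
  moreover have "z - p = (\<epsilon> / 3) *\<^sub>R (2 *\<^sub>R b - a)" "z - q = (\<epsilon> / 3) *\<^sub>R (2 *\<^sub>R a - b)"
    unfolding z_def p_q_def by (simp_all add: scaleR_conv_of_real algebra_simps)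
  ultimately have "dist z p = dist z q" by (simp add: dist_norm)
  moreover have "draw_corner \<epsilon> A B = sphere z (dist z p) \<inter> convex hull {v, p, q}"
    using assms(1) by (simp add: draw_corner_def Let_def z_def p_q_def v_a_b_def)
  moreover have "draw_corner \<epsilon> (prod.swap B) (prod.swap A) = sphere z (dist z q) \<inter> convex hull {v, q, p}"
    using assms(1) by (simp add: draw_corner_def Let_def z_def p_q_def v_a_b_def add.commute)
  ultimately show ?thesis by (simp add: insert_commute)
qed

lemma same_patch_sym:
  assumes "same_patch r x E y F"
  shows "same_patch r y F x E"
proof -
  have "(\<lambda>z. z + (x - y)) ` (\<lambda>z. z + (y - x)) ` (cball x r \<inter> E) = cball x r \<inter> E"
    by (simp add: image_image)
  then show ?thesis using assms unfolding same_patch_def by simp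
qed

lemma finite_if_subsingleton:
  assumes "\<And>x y. x \<in> A \<Longrightarrow> y \<in> A \<Longrightarrow> x = y"
  shows "finite A"
proof (cases "A = {}")
  case False
  then obtain x where "x \<in> A" by blast
  then have "A \<subseteq> {x}" using assms by blast
  then show ?thesis by (rule finite_subset) simp
qed simp

text \<open>Serves to show that a segment is not made up of isolated intersections with countably
  many sides and arcs.\<close>

lemma uncountable_segment:
  fixes a b :: real
  assumes "a < b" "countable I" "\<And>\<alpha>. a \<le> \<alpha> \<Longrightarrow> \<alpha> \<le> b \<Longrightarrow> \<exists>i\<in>I. \<alpha> \<in> S i" "\<And>i. i \<in> I \<Longrightarrow> finite (S i)"
  shows False
proof -
  have "{a..b} \<subseteq> (\<Union>i\<in>I. S i)" using assms(3) by force
  moreover have "countable (\<Union>i\<in>I. S i)" using assms(2,4) by (intro countable_UN) (simp_all add: countable_finite)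
  ultimately have "countable {a..b}" by (rule countable_subset)
  then show False using uncountable_closed_interval[of a b] assms(1) by blast
qed

lemma finite_line_sphere:
  fixes z D w :: complex
  assumes "D \<noteq> 0"
  shows "finite {\<alpha>. z + of_real \<alpha> * D \<in> sphere w r}"
proof -
  define a b e where "a = (Re D)\<^sup>2 + (Im D)\<^sup>2" "b = 2 * (Re D * Re (z - w) + Im D * Im (z - w))"
    "e = (Re (z - w))\<^sup>2 + (Im (z - w))\<^sup>2 - r\<^sup>2"
  have a: "a \<noteq> 0" using assms by (simp add: a_b_e_def complex_eq_iff sum_power2_eq_zero_iff)
  have "poly [:e, b, a:] \<alpha> = 0" if "z + of_real \<alpha> * D \<in> sphere w r" for \<alpha>
  proof -
    have "dist w (z + of_real \<alpha> * D) = r" using that by simp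
    then have "(cmod (z - w + of_real \<alpha> * D))\<^sup>2 = r\<^sup>2"
      by (simp add: dist_norm norm_minus_commute algebra_simps)
    then show ?thesis unfolding cmod_power2 by (simp add: a_b_e_def power2_eq_square algebra_simps)
  qed
  then have "{\<alpha>. z + of_real \<alpha> * D \<in> sphere w r} \<subseteq> {\<alpha>. poly [:e, b, a:] \<alpha> = 0}" by blast
  moreover have "finite {\<alpha>. poly [:e, b, a:] \<alpha> = 0}" using a by (intro poly_roots_finite) simp
  ultimately show ?thesis by (rule finite_subset)
qed

lemma norm_omega: "cmod omega = 1" "cmod (1 + omega) = 1"
  by (simp_all add: omega_def cmod_def power2_eq_square)

lemma norm_dirc: "cmod (dirc d) = 1"
proof -
  have "- 1 - omega = - (1 + omega)" by simp
  then show ?thesis by (cases d) (simp_all only: dirc.simps norm_minus_cancel norm_omega norm_one)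
qed

lemma dirc_parallel:
  assumes "of_real a * dirc d = of_real b * dirc d'" "a \<noteq> 0"
  shows "d = d'"
  using assms by (cases d; cases d') (auto simp: omega_def complex_eq_iff)

context plane_lattice
begin

definition corner :: "real \<Rightarrow> (int \<times> int \<Rightarrow> int) \<Rightarrow> (int \<times> int) \<times> dir \<Rightarrow> complex set" where
  "corner \<epsilon> s e = draw_corner \<epsilon> (side e) (side (nx s e))"

text \<open>It refers to the signs alone, which turns local isomorphism of coverings into a question
  about sign functions.\<close>

definition drawing :: "real \<Rightarrow> (int \<times> int \<Rightarrow> int) \<Rightarrow> complex set" where
  "drawing \<epsilon> s = (\<Union>e. draw_side \<epsilon> (side e) \<union> corner \<epsilon> s e)"

definition shift :: "int \<times> int \<Rightarrow> complex" where
  "shift v = (of_int (fst v) + of_int (snd v) * omega) * u"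

lemma pos_shift: "pos (x + v) = pos x + shift v"
  by (simp add: pos_def pt_def shift_def algebra_simps)

lemma shift_neg: "shift (- v) = - shift v"
  by (simp add: shift_def algebra_simps)

lemma side_shift: "side (fst e + v, snd e) = (fst (side e) + shift v, snd (side e) + shift v)"
proof -
  have "fst e + v + dvec (snd e) = fst e + dvec (snd e) + v" by (simp add: algebra_simps)
  then show ?thesis unfolding side_def fst_conv snd_conv by (simp only: pos_shift)
qed

lemma draw_covering_induced:
  assumes cov: "folding_covering tiling \<C>" and ind: "induces \<C> s"
  shows "draw_covering \<epsilon> \<C> = drawing \<epsilon> s"
proof -
  have swap: "draw_side \<epsilon> (prod.swap A) = draw_side \<epsilon> A" for A
    by (simp add: draw_side_def closed_segment_commute)
  have curve: "draw_curve \<epsilon> (\<lambda>k. side (E k)) = (\<Union>k. draw_side \<epsilon> (side (E k)) \<union> corner \<epsilon> s (E k))"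
    if "orbit s E" for E
    using orbitD[OF that] by (simp add: draw_curve_def corner_def)
  have sub: "draw_curve \<epsilon> (\<lambda>k. side (E k)) \<subseteq> drawing \<epsilon> s" if "orbit s E" for E
    unfolding curve[OF that] drawing_def by blast
  show ?thesis
  proof
    show "draw_covering \<epsilon> \<C> \<subseteq> drawing \<epsilon> s"
    proof
      fix x assume "x \<in> draw_covering \<epsilon> \<C>"
      then obtain K A where KA: "K \<in> \<C>" "A \<in> K" "x \<in> draw_curve \<epsilon> A" unfolding draw_covering_def by blast
      obtain E B where E: "orbit s E" "B = (\<lambda>k. side (E k))" "A = B \<or> A = reverse_curve B"
        by (rule induced_orbit[OF cov ind KA(1,2)])
      have "draw_curve \<epsilon> (reverse_curve B) \<subseteq> draw_curve \<epsilon> B"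
      proof
        fix y assume "y \<in> draw_curve \<epsilon> (reverse_curve B)"
        then obtain k where "y \<in> draw_side \<epsilon> (prod.swap (B (- k))) \<or>
            y \<in> draw_corner \<epsilon> (prod.swap (B (- k))) (prod.swap (B (- (k + 1))))"
          unfolding draw_curve_def reverse_curve_def by blast
        moreover have "- k = - (k + 1) + 1" by simp
        moreover have "draw_corner \<epsilon> (prod.swap (B (m + 1))) (prod.swap (B m)) = draw_corner \<epsilon> (B m) (B (m + 1))" for m
        proof -
          have "E (m + 1) = nx s (E m)" by (rule orbitD[OF E(1)])
          then have "snd (B m) = fst (B (m + 1))" by (simp add: E(2) side_def nx_def)
          moreover have "joins (B m) (B (m + 1))"
            using side_joins(1)[OF signsD[OF induced_signs[OF cov ind]], of "E m"] \<open>E (m + 1) = nx s (E m)\<close>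
            by (simp add: E(2) nx_def)
          then have "cmod (snd (B (m + 1)) - fst (B (m + 1))) = cmod (fst (B m) - snd (B m))"
            unfolding joins_def by (auto simp: norm_mult)
          ultimately show ?thesis by (rule draw_corner_reverse)
        qed
        ultimately show "y \<in> draw_curve \<epsilon> B" unfolding draw_curve_def swap by (metis UNIV_I UN_I Un_iff)
      qed
      then have "x \<in> draw_curve \<epsilon> B" using KA(3) E(3) by blast
      then show "x \<in> drawing \<epsilon> s" using sub[OF E(1)] E(2) by blast
    qed
    show "drawing \<epsilon> s \<subseteq> draw_covering \<epsilon> \<C>"
    proof
      fix x assume "x \<in> drawing \<epsilon> s"
      then obtain e where e: "x \<in> draw_side \<epsilon> (side e) \<union> corner \<epsilon> s e" unfolding drawing_def by blast
      obtain E where E: "orbit s E" "E 0 = e" by (rule orbit_exists[OF induced_signs[OF cov ind]])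
      obtain A m where A: "A \<in> \<Union>\<C>" "\<And>k. A (k + m) = side (E k)" by (rule orbit_induced[OF cov ind E(1)]) blast
      have "A m = side e" "A (m + 1) = side (nx s e)"
        using A(2)[of 0] A(2)[of 1] orbitD[OF E(1), of 0] E(2) by (simp_all add: add.commute)
      moreover have "draw_side \<epsilon> (A m) \<union> draw_corner \<epsilon> (A m) (A (m + 1)) \<subseteq> draw_curve \<epsilon> A"
        unfolding draw_curve_def by blast
      ultimately have "x \<in> draw_curve \<epsilon> A" using e unfolding corner_def by auto
      then show "x \<in> draw_covering \<epsilon> \<C>" using A(1) unfolding draw_covering_def by blast
    qed
  qed
qed

text \<open>An arc stays within one side length of its vertex, so a ball of radius \<open>r\<close>
  sees only signs of vertices within \<open>r + cmod u\<close> of its centre.\<close>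

lemma corner_hull:
  assumes "0 < \<epsilon>" "\<epsilon> < 1"
  shows "corner \<epsilon> s e \<subseteq> cball (pos (fst e + dvec (snd e))) (cmod u)"
proof -
  define v p q where "v = pos (fst e + dvec (snd e))" "p = v + \<epsilon> *\<^sub>R (fst (side e) - v)" "q = v + \<epsilon> *\<^sub>R (snd (side (nx s e)) - v)"
  have "corner \<epsilon> s e \<subseteq> convex hull {v, p, q}"
    unfolding corner_def draw_corner_def Let_def v_p_q_def by (auto simp: side_def)
  also have "\<dots> \<subseteq> cball v (cmod u)"
  proof (rule hull_minimal)
    have "fst (side e) - v = - dirc (snd e) * u" "snd (side (nx s e)) - v = dirc (snd (nx s e)) * u"
      by (simp_all add: side_def v_p_q_def pos_dvec nx_def)
    then have "dist v p = \<epsilon> * cmod u" "dist v q = \<epsilon> * cmod u"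
      using assms by (simp_all add: v_p_q_def(2,3) dist_norm norm_mult norm_dirc)
    moreover have "\<epsilon> * cmod u \<le> cmod u" using assms by (simp add: mult_left_le_one_le)
    ultimately show "{v, p, q} \<subseteq> cball v (cmod u)" by auto
  qed simp
  finally show ?thesis by (simp add: v_p_q_def)
qed

lemma finite_near: "finite {x. dist (pos x) z \<le> R}"
proof -
  define M where "M = nat \<lceil>2 * (R + cmod (z - c)) / cmod u\<rceil>"
  have "\<bar>fst x\<bar> \<le> int M \<and> \<bar>snd x\<bar> \<le> int M" if "dist (pos x) z \<le> R" for x
  proof -
    let ?a = "real_of_int (fst x)" and ?b = "real_of_int (snd x)"
    let ?w = "of_real ?a + of_real ?b * omega"
    have "cmod (?w * u) \<le> R + cmod (z - c)"
      using that norm_triangle_ineq[of "pos x - z" "z - c"] by (simp add: dist_norm pos_def pt_def)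
    then have w: "cmod ?w * cmod u \<le> R + cmod (z - c)" by (simp add: norm_mult)
    have "(cmod ?w)\<^sup>2 = (?a - ?b / 2)\<^sup>2 + (?b * sqrt 3 / 2)\<^sup>2"
      unfolding cmod_power2 by (simp add: omega_def)
    also have "\<dots> = ?a\<^sup>2 - ?a * ?b + ?b\<^sup>2" by (simp add: power2_eq_square algebra_simps)
    finally have n: "(cmod ?w)\<^sup>2 = ?a\<^sup>2 - ?a * ?b + ?b\<^sup>2" .
    \<comment> \<open>Completing squares bounds each coordinate by twice the modulus.\<close>
    have sq: "(2 * cmod ?w)\<^sup>2 = ?a\<^sup>2 + (2 * ?a\<^sup>2 + (?a - 2 * ?b)\<^sup>2)"
      "(2 * cmod ?w)\<^sup>2 = ?b\<^sup>2 + (2 * ?b\<^sup>2 + (?b - 2 * ?a)\<^sup>2)"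
      unfolding power_mult_distrib n by (simp_all add: power2_eq_square algebra_simps)
    have "?a\<^sup>2 \<le> (2 * cmod ?w)\<^sup>2" unfolding sq(1) by simp
    moreover have "?b\<^sup>2 \<le> (2 * cmod ?w)\<^sup>2" unfolding sq(2) by simp
    ultimately have "\<bar>?a\<bar> \<le> 2 * cmod ?w" "\<bar>?b\<bar> \<le> 2 * cmod ?w" by (simp_all only: power2_le_iff_abs_le mult_nonneg_nonneg zero_le_numeral norm_ge_zero)
    moreover have "2 * cmod ?w \<le> 2 * (R + cmod (z - c)) / cmod u" using w u by (simp add: pos_le_divide_eq)
    moreover have "2 * (R + cmod (z - c)) / cmod u \<le> real M" unfolding M_def by linarith
    ultimately have "\<bar>?a\<bar> \<le> real M" "\<bar>?b\<bar> \<le> real M" by linarith+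
    then show ?thesis by linarith
  qed
  then have "{x. dist (pos x) z \<le> R} \<subseteq> {- int M..int M} \<times> {- int M..int M}" by force
  then show ?thesis by (rule finite_subset) simp
qed

lemma corner_shift:
  assumes "t (fst e + dvec (snd e) + v) = s (fst e + dvec (snd e))"
  shows "corner \<epsilon> t (fst e + v, snd e) = (\<lambda>z. z + shift v) ` corner \<epsilon> s e"
proof -
  have "nx t (fst e + v, snd e) = (fst (nx s e) + v, snd (nx s e))"
    using assms by (simp add: nx_def add.commute add.left_commute)
  then show ?thesis unfolding corner_def by (simp only: side_shift draw_corner_translate)
qed

lemma matching_patch:
  assumes e: "0 < \<epsilon>" "\<epsilon> < 1" and m: "\<And>x. dist (pos x) z \<le> r + cmod u \<Longrightarrow> s x = t (x + v)"
  shows "same_patch r z (drawing \<epsilon> s) (z + shift v) (drawing \<epsilon> t)"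
proof -
  \<comment> \<open>Stated for arbitrary \<open>s\<close>, \<open>t\<close> and \<open>v\<close>, so
    that the other inclusion follows with the roles exchanged and \<open>- v\<close>.\<close>
  have forward: "y + shift v \<in> drawing \<epsilon> t" if y: "y \<in> cball z r" "y \<in> drawing \<epsilon> s"
      and m: "\<And>x. dist (pos x) z \<le> r + cmod u \<Longrightarrow> s x = t (x + v)" for y z s t v
  proof -
    obtain e where e: "y \<in> draw_side \<epsilon> (side e) \<or> y \<in> corner \<epsilon> s e" using y(2) unfolding drawing_def by blast
    then show ?thesis
    proof
      assume "y \<in> draw_side \<epsilon> (side e)"
      then have "y + shift v \<in> draw_side \<epsilon> (side (fst e + v, snd e))"
        unfolding side_shift draw_side_translate by blast
      then show ?thesis unfolding drawing_def by blast
    next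
      assume y': "y \<in> corner \<epsilon> s e"
      then have "dist (pos (fst e + dvec (snd e))) y \<le> cmod u" using corner_hull[OF assms(1,2), of s e] by (metis mem_cball subsetD)
      then have "dist (pos (fst e + dvec (snd e))) z \<le> r + cmod u"
        using y(1) dist_triangle[of "pos (fst e + dvec (snd e))" z y] by (simp add: dist_commute)
      then have "y + shift v \<in> corner \<epsilon> t (fst e + v, snd e)"
        using corner_shift[of t e v s] m y' by auto
      then show ?thesis unfolding drawing_def by blast
    qed
  qed
  have backward: "t x = s (x + - v)" if "dist (pos x) (z + shift v) \<le> r + cmod u" for x
  proof -
    have "pos x = pos (x + - v) + shift v" using pos_shift[of "x + - v" v] by simp
    then have "dist (pos (x + - v)) z \<le> r + cmod u" using that by simp
    from m[OF this] show ?thesis by simp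
  qed
  show ?thesis unfolding same_patch_def
  proof (intro equalityI subsetI)
    fix y assume "y \<in> (\<lambda>y. y + (z + shift v - z)) ` (cball z r \<inter> drawing \<epsilon> s)"
    then obtain x where x: "y = x + shift v" "x \<in> cball z r" "x \<in> drawing \<epsilon> s" by auto
    then have "y \<in> drawing \<epsilon> t" using forward[OF x(2,3) m] by simp
    moreover have "y \<in> cball (z + shift v) r" using x(1,2) by simp
    ultimately show "y \<in> cball (z + shift v) r \<inter> drawing \<epsilon> t" by blast
  next
    fix y assume y: "y \<in> cball (z + shift v) r \<inter> drawing \<epsilon> t"
    then have "y + shift (- v) \<in> drawing \<epsilon> s" using forward[of y "z + shift v" t s "- v"] backward by blast
    moreover have "y - shift v \<in> cball z r"
    proof -
      have "dist (z + shift v) (y - shift v + shift v) \<le> r" using y by simp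
      then show ?thesis unfolding dist_add_cancel2 by simp
    qed
    ultimately show "y \<in> (\<lambda>y. y + (z + shift v - z)) ` (cball z r \<inter> drawing \<epsilon> s)"
      by (intro image_eqI[of _ _ "y - shift v"]) (simp_all add: shift_neg)
  qed
qed

section \<open>Recovering the lattice translation from a patch\<close>

lemma draw_side_line:
  assumes "y \<in> draw_side \<epsilon> (side e)"
  shows "\<exists>\<beta>. y = pos (fst e) + of_real \<beta> * (dirc (snd e) * u)"
proof -
  let ?D = "dirc (snd e) * u"
  obtain \<theta> where "y = (1 - \<theta>) *\<^sub>R (pos (fst e) + \<epsilon> *\<^sub>R ?D) + \<theta> *\<^sub>R (pos (fst e) + ?D + \<epsilon> *\<^sub>R (- ?D))"
    using assms unfolding draw_side_def in_segment side_def fst_conv snd_conv pos_dvec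
    by (auto simp del: scaleR_minus_right)
  also have "\<dots> = pos (fst e) + of_real ((1 - \<theta>) * \<epsilon> + \<theta> * (1 - \<epsilon>)) * ?D"
    by (simp add: scaleR_conv_of_real algebra_simps)
  finally show ?thesis by blast
qed

text \<open>A line meets each arc in finitely many points and each side in at most one, unless the
  side lies on the line. Countably many sides and arcs thus cannot cover a segment that lies on no
  lattice line of its direction.\<close>

lemma line_in_drawing:
  assumes "\<epsilon> < 1 / 2" "\<And>\<alpha>. \<epsilon> \<le> \<alpha> \<Longrightarrow> \<alpha> \<le> 1 - \<epsilon> \<Longrightarrow> z + of_real \<alpha> * (dirc d * u) \<in> drawing \<epsilon> s"
  shows "\<exists>x \<rho>. z = pos x + of_real \<rho> * (dirc d * u)"
proof (rule ccontr)
  assume none: "\<not> ?thesis"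
  let ?D = "dirc d * u"
  have D: "?D \<noteq> 0" using dirc_nonzero u by simp
  define S where "S e = {\<alpha>. z + of_real \<alpha> * ?D \<in> draw_side \<epsilon> (side e)} \<union> {\<alpha>. z + of_real \<alpha> * ?D \<in> corner \<epsilon> s e}" for e
  have "finite (S e)" for e
  proof -
    obtain w r' where wr: "corner \<epsilon> s e \<subseteq> sphere w r'"
      unfolding corner_def draw_corner_def Let_def by blast
    have f1: "finite {\<alpha>. z + of_real \<alpha> * ?D \<in> corner \<epsilon> s e}"
      by (rule finite_subset[OF _ finite_line_sphere[OF D, of z w r']]) (use wr in blast)
    let ?D' = "dirc (snd e) * u"
    have on: "\<exists>\<beta>. z + of_real \<alpha> * ?D = pos (fst e) + of_real \<beta> * ?D'"
      if "z + of_real \<alpha> * ?D \<in> draw_side \<epsilon> (side e)" for \<alpha>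
      using that by (rule draw_side_line)
    have "\<alpha> = \<alpha>'" if a: "z + of_real \<alpha> * ?D \<in> draw_side \<epsilon> (side e)" "z + of_real \<alpha>' * ?D \<in> draw_side \<epsilon> (side e)" for \<alpha> \<alpha>'
    proof (rule ccontr)
      assume ne: "\<alpha> \<noteq> \<alpha>'"
      obtain \<beta> \<beta>' where b: "z + of_real \<alpha> * ?D = pos (fst e) + of_real \<beta> * ?D'" "z + of_real \<alpha>' * ?D = pos (fst e) + of_real \<beta>' * ?D'"
        using on a by blast
      have "of_real (\<alpha> - \<alpha>') * ?D = of_real (\<beta> - \<beta>') * ?D'"
        using arg_cong2[OF b, of "(-)"] by (simp add: algebra_simps)
      then have par: "of_real (\<alpha> - \<alpha>') * dirc d = of_real (\<beta> - \<beta>') * dirc (snd e)" using u by (simp add: mult.assoc[symmetric])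
      have "d = snd e"
        using dirc_parallel[OF par] ne by simp
      then have "z = pos (fst e) + of_real (\<beta> - \<alpha>) * ?D" using b(1) by (simp add: algebra_simps)
      then show False using none by blast
    qed
    then have "finite {\<alpha>. z + of_real \<alpha> * ?D \<in> draw_side \<epsilon> (side e)}"
      by (intro finite_if_subsingleton) blast
    with f1 show ?thesis unfolding S_def by blast
  qed
  moreover have "\<exists>e\<in>UNIV. \<alpha> \<in> S e" if "\<epsilon> \<le> \<alpha>" "\<alpha> \<le> 1 - \<epsilon>" for \<alpha>
    using assms(2)[OF that] unfolding drawing_def S_def by blast
  moreover have "countable (UNIV :: ((int \<times> int) \<times> dir) set)"
  proof -
    have "(UNIV :: dir set) = {E0, E1, E2}" using dir.exhaust by blast
    then have "finite (UNIV :: dir set)" by (metis finite.simps)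
    then have "countable (UNIV \<times> UNIV :: ((int \<times> int) \<times> dir) set)" by (intro countable_SIGMA) (auto intro: countable_finite)
    then show ?thesis by simp
  qed
  ultimately show False using uncountable_segment[of \<epsilon> "1 - \<epsilon>" UNIV S] assms(1) by auto
qed

lemma side_segment:
  assumes "\<epsilon> \<le> \<alpha>" "\<alpha> \<le> 1 - \<epsilon>" "\<epsilon> < 1 / 2"
  shows "pos x + of_real \<alpha> * (dirc d * u) \<in> draw_side \<epsilon> (side (x, d))"
proof -
  define \<theta> where "\<theta> = (\<alpha> - \<epsilon>) / (1 - 2 * \<epsilon>)"
  have \<theta>: "0 \<le> \<theta>" "\<theta> \<le> 1" "\<epsilon> + \<theta> * (1 - 2 * \<epsilon>) = \<alpha>" using assms by (simp_all add: \<theta>_def field_simps)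
  have "pos x + of_real \<alpha> * (dirc d * u) = (1 - \<theta>) *\<^sub>R (pos x + \<epsilon> *\<^sub>R (dirc d * u)) + \<theta> *\<^sub>R (pos x + dirc d * u + \<epsilon> *\<^sub>R (- (dirc d * u)))"
    unfolding \<theta>(3)[symmetric] by (simp add: scaleR_conv_of_real algebra_simps)
  then show ?thesis using \<theta>(1,2) unfolding draw_side_def in_segment side_def fst_conv snd_conv pos_dvec
    by (intro exI[of _ \<theta>]) simp
qed

text \<open>A translation between large patches is a lattice translation: it maps straight segments of two
  directions into the other drawing, and only the lattice lines contain segments.\<close>

lemma patch_translation:
  assumes "\<epsilon> < 1 / 2" "\<And>y. y \<in> draw_side \<epsilon> (side (0, E0)) \<union> draw_side \<epsilon> (side (0, E1)) \<Longrightarrow> y + \<tau> \<in> drawing \<epsilon> t"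
  shows "\<exists>v. \<tau> = shift v"
proof -
  have seg: "\<exists>x \<rho>. pos 0 + \<tau> = pos x + of_real \<rho> * (dirc d * u)" if "d = E0 \<or> d = E1" for d
  proof (rule line_in_drawing[OF assms(1), of "pos 0 + \<tau>" d t])
    fix \<alpha> assume "\<epsilon> \<le> \<alpha>" "\<alpha> \<le> 1 - \<epsilon>"
    then have "pos 0 + of_real \<alpha> * (dirc d * u) + \<tau> \<in> drawing \<epsilon> t"
      using side_segment[OF _ _ assms(1), of \<alpha> 0 d] assms(2) that by blast
    then show "pos 0 + \<tau> + of_real \<alpha> * (dirc d * u) \<in> drawing \<epsilon> t" by (simp add: algebra_simps)
  qed
  obtain x \<rho> where x: "pos 0 + \<tau> = pos x + of_real \<rho> * (dirc E0 * u)" using seg by blast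
  obtain y \<rho>' where y: "pos 0 + \<tau> = pos y + of_real \<rho>' * (dirc E1 * u)" using seg by blast
  have "pt (of_int (fst x) + \<rho>) (of_int (snd x)) = pos 0 + \<tau>" unfolding x by (simp add: pos_def pt_def algebra_simps)
  moreover have "pt (of_int (fst y)) (of_int (snd y) + \<rho>') = pos 0 + \<tau>" unfolding y by (simp add: pos_def pt_def algebra_simps)
  ultimately have "of_int (fst x) + \<rho> = of_int (fst y)" by (metis pt_eq)
  then have "pos 0 + \<tau> = pt (of_int (fst y)) (of_int (snd x))" using \<open>pt (of_int (fst x) + \<rho>) _ = _\<close> by simp
  then have "\<tau> = shift (fst y, snd x)" by (simp add: pos_def pt_def shift_def)
  then show ?thesis by blast
qed

text \<open>The centroid of the corner triangle of the strand entering along \<open>E0\<close>. As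
  the angle is \<open>pi / 3\<close>, it is also the midpoint of the arc. It serves as a point from
  which the sign at \<open>x\<close> can be read off.\<close>

definition arc_mid :: "real \<Rightarrow> int \<times> int \<Rightarrow> int \<Rightarrow> complex" where
  "arc_mid \<epsilon> x \<sigma> = pos x + of_real (\<epsilon> / 3) * ((dirc (trn \<sigma> E0) - 1) * u)"

lemma arc_mid_corner:
  assumes "signs s"
  shows "arc_mid \<epsilon> x (s x) \<in> corner \<epsilon> s (strand_in x E0)"
proof -
  define v a b where "v = pos x" "a = - u" "b = dirc (trn (s x) E0) * u"
  have A: "fst (side (strand_in x E0)) - v = a" "snd (side (strand_in x E0)) = v" "snd (side (nx s (strand_in x E0))) - v = b"
    using pos_dvec[of "x - (1, 0)" E0] by (simp_all add: side_def strand_in_def nx_def v_a_b_def pos_dvec)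
  define p q where "p = v + \<epsilon> *\<^sub>R a" "q = v + \<epsilon> *\<^sub>R b"
  define z where "z = v + (2 / 3) *\<^sub>R ((p - v) + (q - v))"
  have c: "corner \<epsilon> s (strand_in x E0) = sphere z (dist z p) \<inter> convex hull {v, p, q}"
    unfolding corner_def draw_corner_def Let_def A z_def p_q_def by simp
  have m: "arc_mid \<epsilon> x (s x) = v + (\<epsilon> / 3) *\<^sub>R (a + b)"
    by (simp add: arc_mid_def v_a_b_def scaleR_conv_of_real algebra_simps)
  have "arc_mid \<epsilon> x (s x) = (1 / 3) *\<^sub>R v + (1 / 3) *\<^sub>R p + (1 / 3) *\<^sub>R q"
    unfolding m p_q_def by (simp add: scaleR_conv_of_real algebra_simps)
  then have "arc_mid \<epsilon> x (s x) \<in> convex hull {v, p, q}"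
    unfolding convex_hull_3 by (intro CollectI exI[of _ "1 / 3 :: real"]) simp
  moreover have "dist z (arc_mid \<epsilon> x (s x)) = dist z p"
  proof -
    have "z - arc_mid \<epsilon> x (s x) = (\<epsilon> / 3) *\<^sub>R (a + b)" "z - p = (\<epsilon> / 3) *\<^sub>R (2 *\<^sub>R b - a)"
      unfolding m z_def p_q_def by (simp_all add: scaleR_conv_of_real algebra_simps)
    moreover have "cmod (a + b) = cmod (2 *\<^sub>R b - a)"
    proof -
      let ?k = "dirc (trn (s x) E0)"
      have "cmod (?k - 1) = cmod (2 * ?k + 1)"
        using signsD[OF assms, of x] by (auto simp: trn_def omega_def cmod_def power2_eq_square algebra_simps)
      moreover have "a + b = (?k - 1) * u" "2 *\<^sub>R b - a = (2 * ?k + 1) * u"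
        by (simp_all add: v_a_b_def scaleR_conv_of_real algebra_simps)
      ultimately show ?thesis by (simp only: norm_mult)
    qed
    ultimately show ?thesis by (simp add: dist_norm)
  qed
  ultimately show ?thesis unfolding c by simp
qed

end

text \<open>On a finite stretch a strand of \<open>t\<close> is a translate of a stretch of a strand
  of \<open>s\<close>, so it reads \<open>L\<close> there. Hence \<open>t\<close> is folding for the
  single sequence \<open>L\<close>, and its own hierarchy has this sequence.\<close>

lemma hierarchy_transfer:
  assumes h: "hierarchy L s" and sg: "signs s" "signs t"
    and match: "\<And>X. finite X \<Longrightarrow> \<exists>v. \<forall>x\<in>X. t x = s (x + v)"
  shows "hierarchy L t"
proof -
  have "folding {L} t" unfolding folding_def FS_def
  proof (intro conjI allI impI)
    fix E and N :: int assume E: "orbit t E"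
    define M where "M = max N 0"
    have M: "0 \<le> M" "N \<le> M" by (simp_all add: M_def)
    obtain v where v: "\<And>k. - M \<le> k \<Longrightarrow> k \<le> M \<Longrightarrow> t (fst (E k)) = s (fst (E k) + v)"
      using match[of "(\<lambda>k. fst (E k)) ` {- M..M}"] by auto
    obtain E' where E': "orbit s E'" "E' (- M) = (fst (E (- M)) + v, snd (E (- M)))"
      using orbit_exists[OF sg(1)] by blast
    have same: "E' (- M + int n) = (fst (E (- M + int n)) + v, snd (E (- M + int n)))" if "int n \<le> 2 * M" for n
      using that
    proof (induction n)
      case (Suc n)
      define k where "k = - M + int n"
      have k: "- M + int (Suc n) = k + 1" by (simp add: k_def)
      have IH: "E' k = (fst (E k) + v, snd (E k))" using Suc by (simp add: k_def)
      have "- M \<le> k + 1" "k + 1 \<le> M" using Suc.prems by (simp_all add: k_def)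
      then have "t (fst (E (k + 1))) = s (fst (E (k + 1)) + v)" by (rule v)
      then show ?case unfolding k orbitD[OF E] orbitD[OF E'(1)] IH
        by (simp add: nx_def add.commute add.left_commute)
    qed (simp add: E'(2))
    obtain j where j: "M < j" "\<And>k. \<bar>k\<bar> \<le> M \<Longrightarrow> s (fst (E' k)) = tau L (j + k)"
      using hierarchy_window[OF h sg(1) E'(1)] by metis
    have "t (fst (E k)) = tau L (j + k)" if "\<bar>k\<bar> \<le> N" for k
    proof -
      have k: "- M \<le> k" "k \<le> M" "\<bar>k\<bar> \<le> M" using that M by linarith+
      have "E' k = (fst (E k) + v, snd (E k))" using same[of "nat (k + M)"] k(1,2) by simp
      then show ?thesis using v[OF k(1,2)] j(2)[OF k(3)] by simp
    qed
    moreover have "N < \<bar>j\<bar>" using j(1) M by linarith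
    ultimately show "\<exists>L\<in>{L}. \<exists>j. N < \<bar>j\<bar> \<and> (\<forall>k. \<bar>k\<bar> \<le> N \<longrightarrow> t (fst (E k)) = tau L (j + k))" by blast
  qed (rule sg(2))
  then obtain L' where "hierarchy L' t" "\<And>n. \<exists>L''\<in>{L}. L' (Suc n) = L'' (Suc n)"
    using folding_hierarchy[of "{L}" t] hierarchy_sign[OF h] by blast
  then show ?thesis using hierarchy_cong[of L' t L] by simp
qed

section \<open>Recovering the signs from a patch\<close>

lemma of_int_small:
  assumes "of_int a + \<alpha> = of_int b + \<beta>" "\<bar>\<alpha>\<bar> < 1 / 2" "\<bar>\<beta>\<bar> < (1 / 2 :: real)"
  shows "a = b" "\<alpha> = \<beta>"
proof -
  have "\<bar>of_int a - of_int b :: real\<bar> < 1" using assms by linarith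
  then show "a = b" by linarith
  then show "\<alpha> = \<beta>" using assms(1) by simp
qed

context plane_lattice
begin

text \<open>The six sectors around a vertex belong alternately to left and to right turns, whence
  three cases for each sign. The arc is enlarged to its triangle; \<open>a\<close> and
  \<open>b\<close> are coordinates back along the incoming side and along the outgoing side.\<close>

lemma corner_coordinates:
  assumes "0 < \<epsilon>" "signs s" "y \<in> corner \<epsilon> s e"
  defines "z \<equiv> fst e + dvec (snd e)"
  obtains a b \<alpha> \<beta> where "0 \<le> a" "0 \<le> b" "a + b \<le> \<epsilon>" "y = pt (of_int (fst z) + \<alpha>) (of_int (snd z) + \<beta>)"
    "s z = 1 \<and> (\<alpha> = - a \<and> \<beta> = b \<or> \<alpha> = - b \<and> \<beta> = - a - b \<or> \<alpha> = a + b \<and> \<beta> = a) \<or>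
     s z = -1 \<and> (\<alpha> = - a - b \<and> \<beta> = - b \<or> \<alpha> = b \<and> \<beta> = - a \<or> \<alpha> = a \<and> \<beta> = a + b)"
proof -
  let ?d = "snd e" and ?d' = "trn (s z) (snd e)"
  have A: "fst (side e) - pos z = - dirc ?d * u" "snd (side e) = pos z" "snd (side (nx s e)) - pos z = dirc ?d' * u"
    by (simp_all add: side_def nx_def z_def pos_dvec)
  have "y \<in> convex hull {pos z, pos z + \<epsilon> *\<^sub>R (- dirc ?d * u), pos z + \<epsilon> *\<^sub>R (dirc ?d' * u)}"
    using assms(3) unfolding corner_def draw_corner_def Let_def A by simp
  then obtain p q r where w: "0 \<le> p" "0 \<le> q" "0 \<le> r" "p + q + r = 1"
      "y = p *\<^sub>R pos z + q *\<^sub>R (pos z + \<epsilon> *\<^sub>R (- dirc ?d * u)) + r *\<^sub>R (pos z + \<epsilon> *\<^sub>R (dirc ?d' * u))"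
    unfolding convex_hull_3 by blast
  define a b where "a = q * \<epsilon>" "b = r * \<epsilon>"
  have p: "p = 1 - q - r" using w(4) by simp
  then have y: "y = pos z + (of_real b * dirc ?d' - of_real a * dirc ?d) * u"
    unfolding w(5) p by (simp add: a_b_def scaleR_conv_of_real algebra_simps)
  have ab: "0 \<le> a" "0 \<le> b" "a + b \<le> \<epsilon>"
  proof -
    show "0 \<le> a" "0 \<le> b" using w(2,3) assms(1) by (simp_all add: a_b_def)
    have "(q + r) * \<epsilon> \<le> \<epsilon>" using w assms(1) by (intro mult_left_le_one_le) simp_all
    then show "a + b \<le> \<epsilon>" by (simp add: a_b_def algebra_simps)
  qed
  define f g :: "dir \<Rightarrow> real" where "f d = (case d of E0 \<Rightarrow> 1 | E1 \<Rightarrow> 0 | E2 \<Rightarrow> -1)"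
    and "g d = (case d of E0 \<Rightarrow> 0 | E1 \<Rightarrow> 1 | E2 \<Rightarrow> -1)" for d
  have fg: "dirc d = of_real (f d) + of_real (g d) * omega" for d
    by (cases d) (simp_all add: f_def g_def)
  show ?thesis
  proof (rule that[OF ab])
    show "y = pt (of_int (fst z) + (b * f ?d' - a * f ?d)) (of_int (snd z) + (b * g ?d' - a * g ?d))"
      unfolding y pos_def pt_def fg by (simp add: algebra_simps)
    show "s z = 1 \<and> (b * f ?d' - a * f ?d = - a \<and> b * g ?d' - a * g ?d = b \<or> b * f ?d' - a * f ?d = - b \<and> b * g ?d' - a * g ?d = - a - b \<or>
        b * f ?d' - a * f ?d = a + b \<and> b * g ?d' - a * g ?d = a) \<or>
      s z = -1 \<and> (b * f ?d' - a * f ?d = - a - b \<and> b * g ?d' - a * g ?d = - b \<or> b * f ?d' - a * f ?d = b \<and> b * g ?d' - a * g ?d = - a \<or>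
        b * f ?d' - a * f ?d = a \<and> b * g ?d' - a * g ?d = a + b)"
      using signsD[OF assms(2), of z] by (cases ?d) (auto simp: trn_def f_def g_def)
  qed
qed

text \<open>On a drawn side one of the two coordinates or their difference is an integer, which
  fails for the arc midpoint. In a corner, \<open>\<epsilon> < 1 / 2\<close> keeps the offsets below
  1/2, so the vertex is \<open>x\<close>, and the sector reveals the sign.\<close>

lemma arc_mid_unique:
  assumes e: "0 < \<epsilon>" "\<epsilon> < 1 / 2" and t: "signs t" and \<sigma>: "\<sigma> = 1 \<or> \<sigma> = -1"
    and mem: "arc_mid \<epsilon> x \<sigma> \<in> drawing \<epsilon> t"
  shows "t x = \<sigma>"
proof -
  define \<eta> where "\<eta> = \<epsilon> / 3"
  have \<eta>: "0 < \<eta>" "\<eta> < 1 / 6" using e by (simp_all add: \<eta>_def)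
  define m n where "m = (if \<sigma> = 1 then - \<eta> else - 2 * \<eta>)" "n = (if \<sigma> = 1 then \<eta> else - \<eta>)"
  have mn: "\<bar>m\<bar> < 1 / 2" "\<bar>n\<bar> < 1 / 2" "m \<noteq> 0" "n \<noteq> 0" "n \<noteq> m" using \<eta> by (auto simp: m_n_def)
  have mid: "arc_mid \<epsilon> x \<sigma> = pt (of_int (fst x) + m) (of_int (snd x) + n)"
    using \<sigma> by (auto simp: arc_mid_def m_n_def \<eta>_def[symmetric] trn_def pos_def pt_def algebra_simps)
  obtain f where "arc_mid \<epsilon> x \<sigma> \<in> draw_side \<epsilon> (side f) \<or> arc_mid \<epsilon> x \<sigma> \<in> corner \<epsilon> t f"
    using mem unfolding drawing_def by blast
  then show ?thesis
  proof
    assume "arc_mid \<epsilon> x \<sigma> \<in> draw_side \<epsilon> (side f)"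
    then obtain \<beta> where "pt (of_int (fst x) + m) (of_int (snd x) + n) = pos (fst f) + of_real \<beta> * (dirc (snd f) * u)"
      unfolding mid[symmetric] using draw_side_line by blast
    moreover have "pos (fst f) + of_real \<beta> * (dirc E0 * u) = pt (of_int (fst (fst f)) + \<beta>) (of_int (snd (fst f)))"
      "pos (fst f) + of_real \<beta> * (dirc E1 * u) = pt (of_int (fst (fst f))) (of_int (snd (fst f)) + \<beta>)"
      "pos (fst f) + of_real \<beta> * (dirc E2 * u) = pt (of_int (fst (fst f)) - \<beta>) (of_int (snd (fst f)) - \<beta>)"
      by (simp_all add: pos_def pt_def algebra_simps)
    ultimately have "\<exists>a b :: int. of_int a + m = of_int b + 0 \<or> of_int a + n = of_int b + 0 \<or> of_int a + (n - m) = of_int b + 0"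
    proof (cases "snd f")
      case E2
      then have "of_int (fst x) + m = of_int (fst (fst f)) - \<beta>" "of_int (snd x) + n = of_int (snd (fst f)) - \<beta>"
        using \<open>pt _ _ = _ + _\<close> \<open>_ = pt (_ - _) _\<close> by simp_all
      then have "of_int (snd x - fst x) + (n - m) = of_int (snd (fst f) - fst (fst f)) + 0" by simp
      then show ?thesis by blast
    qed (auto simp del: pt_eq dest!: pt_eq[THEN iffD1])
    moreover have "\<bar>n - m\<bar> < 1 / 2" using \<eta> by (auto simp: m_n_def)
    ultimately show ?thesis using of_int_small(2)[of _ _ _ 0] mn by fastforce
  next
    assume in_corner: "arc_mid \<epsilon> x \<sigma> \<in> corner \<epsilon> t f"
    define z where "z = fst f + dvec (snd f)"
    obtain a b \<alpha> \<beta> where c: "0 \<le> a" "0 \<le> b" "a + b \<le> \<epsilon>"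
      "arc_mid \<epsilon> x \<sigma> = pt (of_int (fst z) + \<alpha>) (of_int (snd z) + \<beta>)"
      "t z = 1 \<and> (\<alpha> = - a \<and> \<beta> = b \<or> \<alpha> = - b \<and> \<beta> = - a - b \<or> \<alpha> = a + b \<and> \<beta> = a) \<or>
       t z = -1 \<and> (\<alpha> = - a - b \<and> \<beta> = - b \<or> \<alpha> = b \<and> \<beta> = - a \<or> \<alpha> = a \<and> \<beta> = a + b)"
      by (rule corner_coordinates[OF e(1) t in_corner, folded z_def])
    have "\<bar>\<alpha>\<bar> < 1 / 2" "\<bar>\<beta>\<bar> < 1 / 2" using c(1,2,3,5) e by auto
    moreover have "of_int (fst z) + \<alpha> = of_int (fst x) + m" "of_int (snd z) + \<beta> = of_int (snd x) + n"
      using c(4) unfolding mid by simp_all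
    ultimately have z: "fst z = fst x" "snd z = snd x" "\<alpha> = m" "\<beta> = n"
      using of_int_small mn(1,2) by blast+
    then have "z = x" by (simp add: prod_eq_iff)
    with c(1,2,5) \<sigma> \<eta> show ?thesis unfolding z(3,4) m_n_def by auto
  qed
qed

text \<open>The two sides at the origin force the displacement to be a lattice vector, and the arc
  midpoints over \<open>X\<close> reveal the signs there.\<close>

lemma patch_matching:
  assumes e: "0 < \<epsilon>" "\<epsilon> < 1 / 2" and sg: "signs s" "signs t" and X: "finite X"
    and patch: "\<And>r. 0 < r \<Longrightarrow> \<exists>y. same_patch r (pos 0) (drawing \<epsilon> s) y (drawing \<epsilon> t)"
  shows "\<exists>v. \<forall>x\<in>X. s x = t (x + v)"
proof -
  define K where "K = draw_side \<epsilon> (side (0, E0)) \<union> draw_side \<epsilon> (side (0, E1)) \<union> (\<lambda>x. arc_mid \<epsilon> x (s x)) ` X"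
  have "bounded K" unfolding K_def draw_side_def
    using X by (simp add: bounded_Un compact_imp_bounded finite_imp_bounded)
  then obtain r where r: "0 < r" "K \<subseteq> cball (pos 0) r"
    using bounded_subset_ballD[of K "pos 0"] ball_subset_cball by blast
  have K: "K \<subseteq> drawing \<epsilon> s"
    using arc_mid_corner[OF sg(1)] unfolding K_def drawing_def by blast
  obtain y where y: "same_patch r (pos 0) (drawing \<epsilon> s) y (drawing \<epsilon> t)" using patch[OF r(1)] by blast
  have moved: "k + (y - pos 0) \<in> drawing \<epsilon> t" if "k \<in> K" for k
    using y that r(2) K unfolding same_patch_def by blast
  obtain v where v: "y - pos 0 = shift v"
    using patch_translation[OF e(2), of "y - pos 0" t] moved unfolding K_def by blast
  have "s x = t (x + v)" if "x \<in> X" for x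
  proof -
    have "arc_mid \<epsilon> x (s x) + shift v \<in> drawing \<epsilon> t" using moved that unfolding K_def v by blast
    moreover have "arc_mid \<epsilon> (x + v) (s x) = arc_mid \<epsilon> x (s x) + shift v"
      unfolding arc_mid_def pos_shift by (simp add: algebra_simps)
    ultimately have "arc_mid \<epsilon> (x + v) (s x) \<in> drawing \<epsilon> t" by simp
    then show ?thesis using arc_mid_unique[OF e sg(2)] signsD[OF sg(1)] by metis
  qed
  then show ?thesis by blast
qed

theorem coverings_locally_isomorphic:
  assumes e: "0 < \<epsilon>" "\<epsilon> < 1 / 2" and C: "folding_covering tiling \<C>" and D: "folding_covering tiling \<D>"
  shows "locally_isomorphic (draw_covering \<epsilon> \<C>) (draw_covering \<epsilon> \<D>) \<longleftrightarrow>
    (\<exists>\<Lambda>. sign_sequence \<Lambda> \<and> covering_associated tiling \<C> \<Lambda> \<and> covering_associated tiling \<D> \<Lambda>)"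
proof -
  obtain s t where s: "induces \<C> s" and t: "induces \<D> t" using induces_exists[OF C] induces_exists[OF D] by blast
  have sg: "signs s" "signs t" using induced_signs[OF C s] induced_signs[OF D t] by simp_all
  show ?thesis unfolding draw_covering_induced[OF C s] draw_covering_induced[OF D t]
  proof
    assume iso: "locally_isomorphic (drawing \<epsilon> s) (drawing \<epsilon> t)"
    obtain L where L: "hierarchy L s" using induced_hierarchy[OF C s] by blast
    \<comment> \<open>Patches of \<open>t\<close> are sought in \<open>s\<close>, the direction that
      \<open>hierarchy_transfer\<close> requires; hence the use of
      \<open>same_patch_sym\<close>.\<close>
    have "\<exists>v. \<forall>x\<in>X. t x = s (x + v)" if "finite X" for X
    proof (rule patch_matching[OF e sg(2,1) that])
      fix r :: real assume "0 < r"
      then show "\<exists>y. same_patch r (pos 0) (drawing \<epsilon> t) y (drawing \<epsilon> s)"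
        using iso same_patch_sym unfolding locally_isomorphic_def by blast
    qed
    then have "hierarchy L t" by (rule hierarchy_transfer[OF L sg])
    then show "\<exists>\<Lambda>. sign_sequence \<Lambda> \<and> covering_associated tiling \<C> \<Lambda> \<and> covering_associated tiling \<D> \<Lambda>"
      using hierarchy_sign[OF L] hierarchy_associated[OF C s L] hierarchy_associated[OF D t] by blast
  next
    assume "\<exists>\<Lambda>. sign_sequence \<Lambda> \<and> covering_associated tiling \<C> \<Lambda> \<and> covering_associated tiling \<D> \<Lambda>"
    then obtain L where L: "hierarchy L s" "hierarchy L t"
      using associated_hierarchy[OF C s] associated_hierarchy[OF D t] by blast
    have patch: "\<exists>y. same_patch r z (drawing \<epsilon> s) y (drawing \<epsilon> t)"
      if h: "hierarchy L s" "hierarchy L t" "signs s" for s t r z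
    proof -
      obtain v where "\<And>x. x \<in> {x. dist (pos x) z \<le> r + cmod u} \<Longrightarrow> s x = t (x + v)"
        using hierarchy_translate[OF h finite_near] by blast
      then have "same_patch r z (drawing \<epsilon> s) (z + shift v) (drawing \<epsilon> t)"
        using e by (intro matching_patch) simp_all
      then show ?thesis by blast
    qed
    show "locally_isomorphic (drawing \<epsilon> s) (drawing \<epsilon> t)" unfolding locally_isomorphic_def
      using patch[OF L sg(1)] patch[OF L(2,1) sg(2)] same_patch_sym by blast
  qed
qed

end

theorem theorem2p2:
  fixes P :: "complex set set" and \<C> \<D> :: "(int \<Rightarrow> oside) set set" and \<epsilon> :: real
  assumes "regular_triangular_tiling P"
    and "0 < \<epsilon>" and "\<epsilon> < 1 / 2"
    and "folding_covering P \<C>" and "folding_covering P \<D>"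
  shows "locally_isomorphic (draw_covering \<epsilon> \<C>) (draw_covering \<epsilon> \<D>) \<longleftrightarrow>
    (\<exists>\<Lambda>. sign_sequence \<Lambda> \<and> covering_associated P \<C> \<Lambda> \<and> covering_associated P \<D> \<Lambda>)"
proof -
  obtain c u where u: "u \<noteq> 0" and P: "P = (\<Union>a::int. \<Union>b::int. let x = c + of_int a * u + of_int b * (cis (pi / 3) * u)
      in {{x, x + u, x + cis (pi / 3) * u}, {x, x + cis (pi / 3) * u, x + cis (pi / 3) * u - u}})"
    using assms(1) unfolding regular_triangular_tiling_def by blast
  interpret plane_lattice c u by unfold_locales (rule u)
  have "P = tiling" unfolding P tiling_def ..
  then show ?thesis using coverings_locally_isomorphic[OF assms(2,3)] assms(4,5) by simp
qed

end
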